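(* The form $(\widehat{\mathcal{E}},\mathcal{F})$ is a quasi-regular Dirichlet form on $L^2(\mathbb{R}^d,m(dx))$, where $\mathcal{F}=\{u:\mathbb{R}^d\to\mathbb{R}:\ u\in L^2(\mathbb{R}^d,m(dx)),\ \widehat{\mathcal{E}}(u,u)<\infty\}$.
   Context: Setting. Let $d\ge 2$ and let $j:(0,\infty)\to(0,\infty)$ be non-increasing with $\int_{\mathbb{R}^d}(1\wedge|x|^2)\,j(|x|)\,dx<\infty$. Put $k(x,y):=j(|x-y|)$, $x,y\in\mathbb{R}^d$. Let $D\subset\mathbb{R}^d$ be a bounded open set whose boundary $\partial D$ has Lebesgue measure zero; $D^c=\mathbb{R}^d\setminus D$. All functions are measurable and are identified when equal almost everywhere. For $x\in D^c$ let $\mu(x):=\int_D k(x,y)\,dy\in[0,\infty]$ (finite for $x\notin\overline D$), and let $m(dx):=\mathbf{1}_D(x)\,dx+\mathbf{1}_{D^c}(x)\mu(x)\,dx$ (this need not be a Radon measure on $\mathbb{R}^d$). For $u,v:\mathbb{R}^d\to\mathbb{R}$ let $$\widehat{\mathcal{E}}(u,v):=\frac12\iint_{(\mathbb{R}^d\times\mathbb{R}^d)\setminus(D^c\times D^c)}(u(x)-u(y))(v(x)-v(y))k(x,y)\,dy\,dx .$$ Put $\widehat{\mathcal{E}}_1(u,v):=\widehat{\mathcal{E}}(u,v)+\langle u,v\rangle_{L^2(\mathbb{R}^d,m(dx))}$. Terminology. For a closed $F\subset\mathbb{R}^d$ let $\mathcal{F}_F:=\{u\in\mathcal{F}:u=0\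 m\text{-a.e. on }\mathbb{R}^d\setminus F\}$. An increasing sequence $(F_j)_{j\ge1}$ of closed sets is an $\widehat{\mathcal{E}}$-nest if $\bigcup_j\mathcal{F}_{F_j}$ is dense in $\mathcal{F}$ with respect to the norm $\widehat{\mathcal{E}}_1(\cdot,\cdot)^{1/2}$. A set $N$ is $\widehat{\mathcal{E}}$-polar if $N\subset\bigcap_j(\mathbb{R}^d\setminus F_j)$ for some $\widehat{\mathcal{E}}$-nest $(F_j)$. A function is $\widehat{\mathcal{E}}$-quasi-continuous if its restriction to each $F_j$ is finite and continuous for some $\widehat{\mathcal{E}}$-nest $(F_j)$. A Dirichlet form (a densely defined, closed, symmetric, non-negative definite Markovian bilinear form) is quasi-regular if: (i) there is an $\widehat{\mathcal{E}}$-nest consisting of compact sets; (ii) there is an $\widehat{\mathcal{E}}_1^{1/2}$-dense subset of $\mathcal{F}$ whose elements have $\widehat{\mathcal{E}}$-quasi-continuous $m$-versions; (iii) there are countably many $f_n\in\mathcal{F}$ with $\widehat{\mathcal{E}}$-quasi-continuous $m$-versions $\widetilde f_n$ and an $\widehat{\mathcal{E}}$-polar set $N$ such that $\{\widetilde f_n\}$ separates the points of $\mathbb{R}^d\setminus N$. *)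

theory Defs
  imports "HOL-Analysis.Analysis"
begin

section \<open>Dirichlet forms on L^2 and quasi-regularity\<close>

text \<open>
  Elements of \<open>L\<^sup>2(M)\<close> are represented by measurable real functions, and two representatives are
  identified when they are equal \<open>M\<close>-almost everywhere. A bilinear form is given by a set \<open>F\<close> of
  representatives (its domain) and a function \<open>E\<close>; that both descend to almost-everywhere classes is
  part of the definition of a form below. Values of \<open>E\<close> outside \<open>F\<close> play no role.
\<close>

definition L2 :: "'a measure \<Rightarrow> ('a \<Rightarrow> real) set" where
  "L2 M = {u \<in> borel_measurable M. (\<integral>\<^sup>+x. ennreal ((u x)\<^sup>2) \<partial>M) < \<infinity>}"

definition L2_inner :: "'a measure \<Rightarrow> ('a \<Rightarrow> real) \<Rightarrow> ('a \<Rightarrow> real) \<Rightarrow> real" where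
  "L2_inner M u v = (\<integral>x. u x * v x \<partial>M)"

type_synonym 'a form = "('a \<Rightarrow> real) \<Rightarrow> ('a \<Rightarrow> real) \<Rightarrow> real"

definition form1 :: "'a measure \<Rightarrow> 'a form \<Rightarrow> 'a form" where
  "form1 M E u v = E u v + L2_inner M u v"

definition form1_norm :: "'a measure \<Rightarrow> 'a form \<Rightarrow> ('a \<Rightarrow> real) \<Rightarrow> real" where
  "form1_norm M E u = sqrt (form1 M E u u)"

definition bilinear_form :: "'a measure \<Rightarrow> 'a form \<Rightarrow> ('a \<Rightarrow> real) set \<Rightarrow> bool" where
  "bilinear_form M E F \<longleftrightarrow>
     F \<subseteq> L2 M \<and>
     (\<lambda>x. 0) \<in> F \<and>
     (\<forall>u\<in>F. \<forall>v\<in>F. (\<lambda>x. u x + v x) \<in> F) \<and>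
     (\<forall>c. \<forall>u\<in>F. (\<lambda>x. c * u x) \<in> F) \<and>
     (\<forall>u\<in>F. \<forall>u'\<in>borel_measurable M. (AE x in M. u x = u' x) \<longrightarrow>
        u' \<in> F \<and> (\<forall>v\<in>F. E u' v = E u v \<and> E v u' = E v u)) \<and>
     (\<forall>u\<in>F. \<forall>v\<in>F. \<forall>w\<in>F. E (\<lambda>x. u x + v x) w = E u w + E v w
                               \<and> E w (\<lambda>x. u x + v x) = E w u + E w v) \<and>
     (\<forall>c. \<forall>u\<in>F. \<forall>v\<in>F. E (\<lambda>x. c * u x) v = c * E u v \<and> E u (\<lambda>x. c * v x) = c * E u v)"

definition symmetric_form :: "'a form \<Rightarrow> ('a \<Rightarrow> real) set \<Rightarrow> bool" where
  "symmetric_form E F \<longleftrightarrow> (\<forall>u\<in>F. \<forall>v\<in>F. E u v = E v u)"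

definition nonneg_form :: "'a form \<Rightarrow> ('a \<Rightarrow> real) set \<Rightarrow> bool" where
  "nonneg_form E F \<longleftrightarrow> (\<forall>u\<in>F. 0 \<le> E u u)"

definition densely_defined :: "'a measure \<Rightarrow> ('a \<Rightarrow> real) set \<Rightarrow> bool" where
  "densely_defined M F \<longleftrightarrow>
     (\<forall>u\<in>L2 M. \<forall>e>0. \<exists>v\<in>F. sqrt (L2_inner M (\<lambda>x. u x - v x) (\<lambda>x. u x - v x)) < e)"

definition closed_form :: "'a measure \<Rightarrow> 'a form \<Rightarrow> ('a \<Rightarrow> real) set \<Rightarrow> bool" where
  "closed_form M E F \<longleftrightarrow>
     (\<forall>u. (\<forall>n::nat. u n \<in> F) \<and>
          (\<forall>e>0. \<exists>N. \<forall>n\<ge>N. \<forall>p\<ge>N. form1_norm M E (\<lambda>x. u n x - u p x) < e) \<longrightarrow>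
          (\<exists>v\<in>F. (\<lambda>n. form1_norm M E (\<lambda>x. u n x - v x)) \<longlonglongrightarrow> 0))"

text \<open>Markov property: the unit contraction operates on the form.\<close>

definition markovian_form :: "'a form \<Rightarrow> ('a \<Rightarrow> real) set \<Rightarrow> bool" where
  "markovian_form E F \<longleftrightarrow>
     (\<forall>u\<in>F. (\<lambda>x. min (max 0 (u x)) 1) \<in> F \<and>
            E (\<lambda>x. min (max 0 (u x)) 1) (\<lambda>x. min (max 0 (u x)) 1) \<le> E u u)"

definition dirichlet_form :: "'a measure \<Rightarrow> 'a form \<Rightarrow> ('a \<Rightarrow> real) set \<Rightarrow> bool" where
  "dirichlet_form M E F \<longleftrightarrow>
     bilinear_form M E F \<and> symmetric_form E F \<and> nonneg_form E F \<and>
     densely_defined M F \<and> closed_form M E F \<and> markovian_form E F"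

definition form_dense ::
  "'a measure \<Rightarrow> 'a form \<Rightarrow> ('a \<Rightarrow> real) set \<Rightarrow> ('a \<Rightarrow> real) set \<Rightarrow> bool" where
  "form_dense M E F S \<longleftrightarrow>
     S \<subseteq> F \<and> (\<forall>u\<in>F. \<forall>e>0. \<exists>v\<in>S. form1_norm M E (\<lambda>x. u x - v x) < e)"

definition domain_on :: "'a measure \<Rightarrow> ('a \<Rightarrow> real) set \<Rightarrow> 'a set \<Rightarrow> ('a \<Rightarrow> real) set" where
  "domain_on M F A = {u \<in> F. AE x in M. x \<notin> A \<longrightarrow> u x = 0}"

definition nest :: "'a::topological_space measure \<Rightarrow> 'a form \<Rightarrow> ('a \<Rightarrow> real) set
    \<Rightarrow> (nat \<Rightarrow> 'a set) \<Rightarrow> bool" where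
  "nest M E F K \<longleftrightarrow>
     (\<forall>i. closed (K i)) \<and> incseq K \<and> form_dense M E F (\<Union>i. domain_on M F (K i))"

definition polar :: "'a::topological_space measure \<Rightarrow> 'a form \<Rightarrow> ('a \<Rightarrow> real) set
    \<Rightarrow> 'a set \<Rightarrow> bool" where
  "polar M E F N \<longleftrightarrow> (\<exists>K. nest M E F K \<and> N \<subseteq> (\<Inter>i. - K i))"

text \<open>Functions are real-valued here, so finiteness on the sets of the nest is automatic.\<close>

definition quasi_continuous :: "'a::topological_space measure \<Rightarrow> 'a form \<Rightarrow> ('a \<Rightarrow> real) set
    \<Rightarrow> ('a \<Rightarrow> real) \<Rightarrow> bool" where
  "quasi_continuous M E F f \<longleftrightarrow> (\<exists>K. nest M E F K \<and> (\<forall>i. continuous_on (K i) f))"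

definition qc_version :: "'a::topological_space measure \<Rightarrow> 'a form \<Rightarrow> ('a \<Rightarrow> real) set
    \<Rightarrow> ('a \<Rightarrow> real) \<Rightarrow> ('a \<Rightarrow> real) \<Rightarrow> bool" where
  "qc_version M E F f g \<longleftrightarrow>
     g \<in> borel_measurable M \<and> (AE x in M. g x = f x) \<and> quasi_continuous M E F g"

definition quasi_regular :: "'a::topological_space measure \<Rightarrow> 'a form \<Rightarrow> ('a \<Rightarrow> real) set
    \<Rightarrow> bool" where
  "quasi_regular M E F \<longleftrightarrow>
     (\<exists>K. nest M E F K \<and> (\<forall>i. compact (K i))) \<and>
     (\<exists>S. form_dense M E F S \<and> (\<forall>u\<in>S. \<exists>g. qc_version M E F u g)) \<and>
     (\<exists>(f::nat \<Rightarrow> 'a \<Rightarrow> real) g N.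
        (\<forall>n. f n \<in> F \<and> qc_version M E F (f n) (g n)) \<and>
        polar M E F N \<and>
        (\<forall>x\<in>-N. \<forall>y\<in>-N. x \<noteq> y \<longrightarrow> (\<exists>n. g n x \<noteq> g n y)))"

section \<open>The nonlocal form with jumps inside the complement of D removed\<close>

text \<open>
  The profile \<open>j\<close> only matters on \<open>(0,\<infinity>)\<close>: its value at \<open>0\<close> enters through \<open>kern\<close> on the
  diagonal only, where the increments of the functions vanish.
\<close>

definition kern :: "(real \<Rightarrow> real) \<Rightarrow> 'a::euclidean_space \<Rightarrow> 'a \<Rightarrow> real" where
  "kern j x y = j (norm (x - y))"

definition mu :: "(real \<Rightarrow> real) \<Rightarrow> 'a::euclidean_space set \<Rightarrow> 'a \<Rightarrow> ennreal" where
  "mu j D x = (\<integral>\<^sup>+y\<in>D. ennreal (kern j x y) \<partial>lborel)"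

definition m_measure :: "(real \<Rightarrow> real) \<Rightarrow> 'a::euclidean_space set \<Rightarrow> 'a measure" where
  "m_measure j D = density lborel (\<lambda>x. indicator D x + indicator (- D) x * mu j D x)"

definition E_hat :: "(real \<Rightarrow> real) \<Rightarrow> 'a::euclidean_space set \<Rightarrow> 'a form" where
  "E_hat j D u v = 1/2 * (LINT (x, y) : UNIV - (- D) \<times> (- D) | lborel \<Otimes>\<^sub>M lborel.
      (u x - u y) * (v x - v y) * kern j x y)"

text \<open>
  The energy \<open>E_hat j D u u\<close>, whose integrand is non-negative, as a value in \<open>[0,\<infinity>]\<close>. It is needed
  to express finiteness, as a divergent Bochner integral is \<open>0\<close> by convention.
\<close>

definition energy :: "(real \<Rightarrow> real) \<Rightarrow> 'a::euclidean_space set \<Rightarrow> ('a \<Rightarrow> real) \<Rightarrow> ennreal" where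
  "energy j D u = ennreal (1/2) * (\<integral>\<^sup>+(x, y) \<in> UNIV - (- D) \<times> (- D).
      ennreal ((u x - u y) * (u x - u y) * kern j x y) \<partial>(lborel \<Otimes>\<^sub>M lborel))"

text \<open>Consistency of the two: on measurable functions \<open>energy\<close> is the diagonal of \<open>E_hat\<close>.\<close>

lemma E_hat_diag_eq_energy:
  fixes D :: "'a::euclidean_space set"
  assumes pos: "\<And>r. r > 0 \<Longrightarrow> j r > 0" and mono: "antimono_on {0<..} j"
    and D[measurable]: "D \<in> sets borel" and u[measurable]: "u \<in> borel_measurable borel"
  shows "E_hat j D u u = enn2real (energy j D u)"
proof -
  define h where "h r = (if r \<in> {0<..} then j r else 0)" for r
  have "(\<lambda>r. - j r) \<in> borel_measurable (restrict_space borel {0<..})"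
    by (rule borel_measurable_mono_on_fnc) (use mono in \<open>auto simp: monotone_on_def\<close>)
  then have "(\<lambda>r. - (- j r)) \<in> borel_measurable (restrict_space borel {0<..})"
    by (rule borel_measurable_uminus)
  then have "(\<lambda>r. indicator {0<..} r *\<^sub>R (- (- j r))) \<in> borel_measurable borel"
    by (subst (asm) borel_measurable_restrict_space_iff) auto
  moreover have "(\<lambda>r. indicator {0<..} r *\<^sub>R (- (- j r))) = h"
    by (auto simp: h_def fun_eq_iff)
  ultimately have h[measurable]: "h \<in> borel_measurable borel" by simp
  define f where "f = (\<lambda>p. indicator (UNIV - (- D) \<times> (- D)) p *
      ((u (fst p) - u (snd p)) * (u (fst p) - u (snd p)) * h (norm (fst p - snd p))))"
  have f: "f \<in> borel_measurable ((lborel::'a measure) \<Otimes>\<^sub>M lborel)"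
    unfolding f_def by measurable
  have f0: "0 \<le> f p" for p
    using pos[of "norm (fst p - snd p)"] by (auto simp: f_def h_def indicator_def less_imp_le)
  have fe: "f p = indicator (UNIV - (- D) \<times> (- D)) p *
      ((u (fst p) - u (snd p)) * (u (fst p) - u (snd p)) * kern j (fst p) (snd p))" for p
    by (auto simp: f_def h_def kern_def)
  have "E_hat j D u u = 1/2 * (\<integral>p. f p \<partial>(lborel \<Otimes>\<^sub>M lborel))"
    unfolding E_hat_def set_lebesgue_integral_def fe by (simp add: case_prod_unfold)
  also have "\<dots> = 1/2 * enn2real (\<integral>\<^sup>+p. ennreal (f p) \<partial>(lborel \<Otimes>\<^sub>M lborel))"
    using integral_eq_nn_integral[OF f] f0 by simp
  also have "(\<integral>\<^sup>+p. ennreal (f p) \<partial>(lborel \<Otimes>\<^sub>M lborel)) =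
      (\<integral>\<^sup>+(x, y) \<in> UNIV - (- D) \<times> (- D).
        ennreal ((u x - u y) * (u x - u y) * kern j x y) \<partial>(lborel \<Otimes>\<^sub>M lborel))"
    unfolding fe by (intro nn_integral_cong) (auto simp: indicator_def split: prod.splits)
  finally show ?thesis
    unfolding energy_def enn2real_mult by (subst enn2real_ennreal) auto
qed

definition F_dom :: "(real \<Rightarrow> real) \<Rightarrow> 'a::euclidean_space set \<Rightarrow> ('a \<Rightarrow> real) set" where
  "F_dom j D = {u \<in> L2 (m_measure j D). energy j D u < \<infinity>}"

end

theory Submission
  imports Defs
begin

text \<open>
  Closedness is Fatou's lemma along a rapidly converging subsequence. For quasi-regularity no capacity
  theory is needed. If continuous \<open>a n\<close> have summable energies and tend to \<open>0\<close> almost everywhere, then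
  \<open>g k = sup {min 1 \<bar>a n\<bar> | n \<ge> k}\<close> has energy tending to \<open>0\<close> and equals \<open>1\<close> off the closed set
  \<open>K k = {\<bar>a n\<bar> \<le> 1 for all n \<ge> k}\<close>, so that \<open>f * (1 - g k)\<close> converges to \<open>f\<close> in the form norm for
  bounded \<open>f\<close>. Applied to the scaled differences of a rapidly converging sequence of continuous
  approximants of \<open>u\<close>, this gives a version of \<open>u\<close> that is continuous on each \<open>K k\<close>.

  Boundary points of \<open>D\<close> at which all elements of the domain vanish have to be removed. Let \<open>h\<close> be the
  element of smallest norm above a strictly positive \<open>u0\<close>. It is excessive, hence \<open>min u (n * h)\<close>
  converges to \<open>u\<close> in the form norm, and the sets \<open>K k \<inter> cball 0 (k + 1) \<inter> {h \<ge> 1 / (k + 1)}\<close> form a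
  compact nest, on the union of which \<open>h\<close> is positive; there \<open>h\<close> and the products of \<open>h\<close> with countably
  many truncated distance functions separate points.

  Continuous approximants exist because the form decouples: if \<open>u\<close> belongs to the domain, then so do
  its restrictions to \<open>D\<close> and to the complement of \<open>D\<close>. The latter is just an \<open>L\<^sup>2\<close> function, and the
  former, extended by \<open>0\<close>, has finite energy on the whole space, so that mollification converges in
  energy by dominated convergence over the jump vector.
\<close>

section \<open>Squared \<open>L\<^sup>2\<close> norms\<close>

text \<open>The obstacle is that \<open>M\<close> need not be a Radon measure: \<open>mu\<close> may
  fail to be integrable near the boundary of \<open>D\<close>, so compactly supported continuous
  functions may lie outside the domain. The error of a continuous approximant is therefore measured
  by its energy and by \<open>R\<close>, whose density \<open>min 1 rho\<close> has the same zeros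
  as \<open>rho\<close> but is bounded. The decoupling has one source. An admissible pair has an
  endpoint in \<open>D\<close>, so for a function vanishing on \<open>D\<close> only the value at
  the other endpoint remains in the increment; integrating out the endpoint in \<open>D\<close> then
  produces \<open>mu\<close>, the very weight of \<open>M\<close> outside \<open>D\<close>. For the
  same reason \<open>J\<close> does not charge jumps that start or end in an \<open>M\<close>-null
  set, even where \<open>mu\<close> vanishes. Since the boundary is a null set, the exterior of
  \<open>D\<close> is almost everywhere exhausted by sets at positive distance from
  \<open>D\<close>, on which monotonicity of \<open>j\<close> bounds \<open>mu\<close>; and
  distances to \<open>D\<close> and to its complement give a \<open>u0\<close> vanishing only on the
  boundary.\<close>

lemma inverse_2_less_top_ennreal[simp]: "inverse 2 < (top :: ennreal)"
  and enn2real_inverse_2[simp]: "enn2real (inverse 2) = 1 / 2"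
proof -
  have "inverse 2 = ennreal (1/2)" by simp
  then show "inverse 2 < (top :: ennreal)" "enn2real (inverse 2) = 1 / 2"
    by (metis ennreal_less_top, metis enn2real_ennreal zero_le_divide_1_iff zero_le_numeral)
qed

text \<open>Squared norms are kept in \<open>ennreal\<close>, so that Fatou, series and comparison
  apply before finiteness is known.\<close>

definition sqn :: "'a measure \<Rightarrow> ('a \<Rightarrow> real) \<Rightarrow> ennreal" where
  "sqn M f = (\<integral>\<^sup>+x. ennreal ((f x)\<^sup>2) \<partial>M)"

lemma ennreal_add_sq_le: "ennreal ((a + b)\<^sup>2) \<le> 2 * ennreal (a\<^sup>2) + 2 * ennreal (b\<^sup>2)"
proof -
  have "(a + b)\<^sup>2 \<le> 2 * a\<^sup>2 + 2 * b\<^sup>2"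
    using zero_le_power2[of "a - b"] by (simp add: power2_eq_square algebra_simps)
  then have "ennreal ((a + b)\<^sup>2) \<le> ennreal (2 * a\<^sup>2 + 2 * b\<^sup>2)"
    by (rule ennreal_leI)
  also have "\<dots> = 2 * ennreal (a\<^sup>2) + 2 * ennreal (b\<^sup>2)"
    by (simp add: ennreal_plus ennreal_mult)
  finally show ?thesis .
qed

lemma ennreal_liminf_add_le:
  fixes f g :: "nat \<Rightarrow> ennreal"
  shows "liminf f + liminf g \<le> liminf (\<lambda>n. f n + g n)"
proof -
  have "liminf f + liminf g = (SUP n. (INF m\<in>{n..}. f m) + (INF m\<in>{n..}. g m))"
    unfolding liminf_SUP_INF
    by (intro ennreal_SUP_add[symmetric] monoI INF_superset_mono) auto
  also have "\<dots> \<le> liminf (\<lambda>n. f n + g n)"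
    unfolding liminf_SUP_INF
    by (intro SUP_mono' INF_greatest add_mono INF_lower)
  finally show ?thesis .
qed

lemma sqn_mono_AE:
  assumes "AE x in M. \<bar>f x\<bar> \<le> \<bar>g x\<bar>"
  shows "sqn M f \<le> sqn M g"
  unfolding sqn_def
  by (rule nn_integral_mono_AE) (use assms in \<open>auto simp: abs_le_square_iff intro!: ennreal_leI\<close>)

lemma sqn_mono: "(\<And>x. \<bar>f x\<bar> \<le> \<bar>g x\<bar>) \<Longrightarrow> sqn M f \<le> sqn M g"
  by (rule sqn_mono_AE) auto

lemma sqn_cong_AE:
  assumes "AE x in M. f x = g x"
  shows "sqn M f = sqn M g"
  unfolding sqn_def by (rule nn_integral_cong_AE) (use assms in auto)

lemma sqn_zero[simp]: "sqn M (\<lambda>x. 0) = 0"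
  by (simp add: sqn_def)

lemma sqn_minus: "sqn M (\<lambda>x. - f x) = sqn M f"
  by (simp add: sqn_def)

lemma sqn_add:
  assumes [measurable]: "f \<in> borel_measurable M" "g \<in> borel_measurable M"
  shows "sqn M (\<lambda>x. f x + g x) \<le> 2 * sqn M f + 2 * sqn M g"
proof -
  have "sqn M (\<lambda>x. f x + g x) \<le> (\<integral>\<^sup>+x. 2 * ennreal ((f x)\<^sup>2) + 2 * ennreal ((g x)\<^sup>2) \<partial>M)"
    unfolding sqn_def by (intro nn_integral_mono ennreal_add_sq_le)
  also have "\<dots> = 2 * sqn M f + 2 * sqn M g"
    by (simp add: nn_integral_add nn_integral_cmult sqn_def)
  finally show ?thesis .
qed

lemma sqn_diff:
  assumes [measurable]: "f \<in> borel_measurable M" "g \<in> borel_measurable M"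
  shows "sqn M (\<lambda>x. f x - g x) \<le> 2 * sqn M f + 2 * sqn M g"
  using sqn_add[of f M "\<lambda>x. - g x"] by (simp add: sqn_minus)

lemma sqn_cmult:
  assumes [measurable]: "f \<in> borel_measurable M"
  shows "sqn M (\<lambda>x. c * f x) = ennreal (c\<^sup>2) * sqn M f"
  by (simp add: sqn_def power_mult_distrib ennreal_mult nn_integral_cmult)

lemma sqn_dominated:
  assumes [measurable]: "\<And>n. f n \<in> borel_measurable M" "g \<in> borel_measurable M"
    and dom: "\<And>n. AE x in M. \<bar>f n x\<bar> \<le> \<bar>g x\<bar>" and g: "sqn M g < \<infinity>"
    and lim: "AE x in M. (\<lambda>n. f n x) \<longlonglongrightarrow> 0"
  shows "(\<lambda>n. sqn M (f n)) \<longlonglongrightarrow> 0"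
proof -
  have "(\<lambda>n. \<integral>\<^sup>+x. ennreal ((f n x)\<^sup>2) \<partial>M) \<longlonglongrightarrow> (\<integral>\<^sup>+x. 0 \<partial>M)"
  proof (rule nn_integral_dominated_convergence[where w="\<lambda>x. ennreal ((g x)\<^sup>2)"])
    show "AE x in M. ennreal ((f n x)\<^sup>2) \<le> ennreal ((g x)\<^sup>2)" for n
      using dom[of n] by (auto simp: abs_le_square_iff intro!: ennreal_leI)
    show "AE x in M. (\<lambda>n. ennreal ((f n x)\<^sup>2)) \<longlonglongrightarrow> 0"
      using lim
    proof eventually_elim
      case (elim x)
      have "(\<lambda>n. ennreal ((f n x)\<^sup>2)) \<longlonglongrightarrow> ennreal (0\<^sup>2)"
        by (intro tendsto_ennrealI tendsto_power elim)
      then show ?case by simp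
    qed
  qed (use g in \<open>auto simp: sqn_def\<close>)
  then show ?thesis by (simp add: sqn_def)
qed

lemma sqn_fatou:
  assumes [measurable]: "\<And>n. f n \<in> borel_measurable M"
    and lim: "AE x in M. (\<lambda>n. f n x) \<longlonglongrightarrow> g x"
  shows "sqn M g \<le> liminf (\<lambda>n. sqn M (f n))"
proof -
  have "sqn M g = (\<integral>\<^sup>+x. liminf (\<lambda>n. ennreal ((f n x)\<^sup>2)) \<partial>M)"
    unfolding sqn_def
  proof (rule nn_integral_cong_AE, use lim in eventually_elim)
    case (elim x)
    have "(\<lambda>n. ennreal ((f n x)\<^sup>2)) \<longlonglongrightarrow> ennreal ((g x)\<^sup>2)"
      by (intro tendsto_ennrealI tendsto_power elim)
    then show ?case by (simp add: lim_imp_Liminf[symmetric])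
  qed
  also have "\<dots> \<le> liminf (\<lambda>n. sqn M (f n))"
    unfolding sqn_def by (rule nn_integral_liminf) simp
  finally show ?thesis .
qed

text \<open>By monotone convergence the pointwise series of squares has finite integral, hence is
  finite almost everywhere, and its terms tend to 0.\<close>

lemma sqn_suminf_imp_AE_tendsto_0:
  assumes [measurable]: "\<And>n. a n \<in> borel_measurable M"
    and sum: "(\<Sum>n. sqn M (a n)) < \<infinity>"
  shows "AE x in M. (\<lambda>n. a n x) \<longlonglongrightarrow> 0"
proof -
  have "(\<integral>\<^sup>+x. (\<Sum>n. ennreal ((a n x)\<^sup>2)) \<partial>M) = (\<Sum>n. sqn M (a n))"
    unfolding sqn_def by (rule nn_integral_suminf) simp
  then have "AE x in M. (\<Sum>n. ennreal ((a n x)\<^sup>2)) \<noteq> \<infinity>"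
    using sum by (intro nn_integral_PInf_AE) auto
  then show ?thesis
  proof eventually_elim
    case (elim x)
    then have "summable (\<lambda>n. (a n x)\<^sup>2)"
      by (intro summable_suminf_not_top) (auto simp: top_ennreal.rep_eq)
    then have "(\<lambda>n. (a n x)\<^sup>2) \<longlonglongrightarrow> 0" by (rule summable_LIMSEQ_zero)
    then have "(\<lambda>n. sqrt ((a n x)\<^sup>2)) \<longlonglongrightarrow> sqrt 0" by (rule tendsto_real_sqrt)
    then show ?case by (simp add: tendsto_rabs_zero_iff)
  qed
qed

lemma sqn_diff_trans:
  assumes [measurable]: "u \<in> borel_measurable M" "v \<in> borel_measurable M" "w \<in> borel_measurable M"
  shows "sqn M (\<lambda>x. u x - w x) \<le> 2 * sqn M (\<lambda>x. u x - v x) + 2 * sqn M (\<lambda>x. v x - w x)"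
  using sqn_add[of "\<lambda>x. u x - v x" M "\<lambda>x. v x - w x"] by simp

text \<open>The weight \<open>2 ^ k\<close> turns convergence to 0 into the geometric bound
  \<open>(1/2) ^ k\<close> on the increments, eventually.\<close>

lemma convergent_if_rapid:
  fixes f :: "nat \<Rightarrow> real"
  assumes "(\<lambda>k. 2 ^ k * (f (Suc k) - f k)) \<longlonglongrightarrow> 0"
  shows "convergent f"
proof -
  have "\<forall>\<^sub>F k in sequentially. norm (2 ^ k * (f (Suc k) - f k)) < 1"
    using assms by (auto dest: tendstoD[of _ 0 _ 1] simp: dist_real_def)
  then have "\<forall>\<^sub>F k in sequentially. norm (f (Suc k) - f k) \<le> (1/2) ^ k"
    by eventually_elim (simp add: abs_mult power_one_over pos_le_divide_eq mult.commute)
  then have "summable (\<lambda>k. f (Suc k) - f k)"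
    by (rule summable_comparison_test_ev) (rule summable_geometric, simp)
  then have "convergent (\<lambda>n. f n - f 0)"
    by (simp add: summable_iff_convergent sum_lessThan_telescope)
  then show ?thesis by (simp add: convergent_diff_const_right_iff)
qed

lemma suminf_geometric_quarter_finite: "(\<Sum>k. ennreal (c * (1/4) ^ k)) < \<infinity>" if "0 \<le> c"
proof -
  have "summable (\<lambda>k. c * (1/4::real) ^ k)" by (intro summable_mult summable_geometric) simp
  then show ?thesis using that by (subst suminf_ennreal2) (auto simp: ennreal_less_top)
qed

text \<open>Scaling by \<open>2 ^ k\<close> costs \<open>4 ^ k\<close> in the squared norm; starting
  from \<open>(1/16) ^ k\<close> leaves the summable \<open>(1/4) ^ k\<close>.\<close>

lemma sqn_scaled_power:
  assumes [measurable]: "f \<in> borel_measurable M" and "sqn M f \<le> ennreal (c * (1/16) ^ k)" "0 \<le> c"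
  shows "sqn M (\<lambda>x. 2 ^ k * f x) \<le> ennreal (c * (1/4) ^ k)"
proof -
  have "sqn M (\<lambda>x. 2 ^ k * f x) = ennreal ((2 ^ k)\<^sup>2) * sqn M f" by (simp add: sqn_cmult)
  also have "\<dots> \<le> ennreal ((2 ^ k)\<^sup>2) * ennreal (c * (1/16) ^ k)"
    by (intro mult_left_mono assms) simp
  also have "\<dots> = ennreal (c * (1/4) ^ k)"
  proof -
    have "(2 ^ k)\<^sup>2 * (c * (1/16) ^ k) = c * (4 ^ k * (1/16 :: real) ^ k)"
      by (simp add: power2_eq_square flip: power_mult_distrib)
    also have "\<dots> = c * (1/4) ^ k" by (simp flip: power_mult_distrib)
    finally show ?thesis using assms by (simp flip: ennreal_mult)
  qed
  finally show ?thesis .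
qed

lemma AE_convergent_if_rapid:
  assumes [measurable]: "\<And>k. f k \<in> borel_measurable M"
    and "\<And>k. sqn M (\<lambda>x. f (Suc k) x - f k x) \<le> ennreal ((1/16) ^ k)"
  shows "AE x in M. convergent (\<lambda>k. f k x)"
proof -
  have "sqn M (\<lambda>x. 2 ^ k * (f (Suc k) x - f k x)) \<le> ennreal (1 * (1/4) ^ k)" for k
    by (rule sqn_scaled_power) (use assms in auto)
  then have "(\<Sum>k. sqn M (\<lambda>x. 2 ^ k * (f (Suc k) x - f k x))) \<le> (\<Sum>k. ennreal (1 * (1/4) ^ k))"
    by (intro suminf_le) auto
  also have "\<dots> < \<infinity>" by (rule suminf_geometric_quarter_finite) simp
  finally have "AE x in M. (\<lambda>k. 2 ^ k * (f (Suc k) x - f k x)) \<longlonglongrightarrow> 0"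
    by (intro sqn_suminf_imp_AE_tendsto_0) auto
  then show ?thesis by eventually_elim (rule convergent_if_rapid)
qed

lemma sqn_eq_0_iff:
  assumes [measurable]: "f \<in> borel_measurable M"
  shows "sqn M f = 0 \<longleftrightarrow> (AE x in M. f x = 0)"
  unfolding sqn_def by (subst nn_integral_0_iff_AE) auto

lemma integrable_mult_sqn:
  assumes [measurable]: "f \<in> borel_measurable M" "g \<in> borel_measurable M"
    and "sqn M f < \<infinity>" "sqn M g < \<infinity>"
  shows "integrable M (\<lambda>x. f x * g x)"
proof (rule Bochner_Integration.integrable_bound)
  show "integrable M (\<lambda>x. (f x)\<^sup>2 + (g x)\<^sup>2)"
    using assms by (intro Bochner_Integration.integrable_add integrableI_nonneg) (auto simp: sqn_def)
  have "\<bar>a * b\<bar> \<le> \<bar>a\<^sup>2 + b\<^sup>2\<bar>" for a b :: real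
  proof -
    have "2 * (\<bar>a\<bar> * \<bar>b\<bar>) \<le> a\<^sup>2 + b\<^sup>2"
      using sum_squares_bound[of "\<bar>a\<bar>" "\<bar>b\<bar>"] by simp
    moreover have "0 \<le> \<bar>a\<bar> * \<bar>b\<bar>" by simp
    ultimately show ?thesis unfolding abs_mult by linarith
  qed
  then show "AE x in M. norm (f x * g x) \<le> norm ((f x)\<^sup>2 + (g x)\<^sup>2)" by simp
qed simp

lemma L2_inner_self:
  assumes [measurable]: "f \<in> borel_measurable M"
  shows "L2_inner M f f = enn2real (sqn M f)"
  unfolding L2_inner_def sqn_def power2_eq_square by (subst integral_eq_nn_integral) auto

lemma L2_inner_commute: "L2_inner M u v = L2_inner M v u"
  by (simp add: L2_inner_def mult.commute)

lemma L2_inner_add_left: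
  assumes "u \<in> borel_measurable M" "v \<in> borel_measurable M" "w \<in> borel_measurable M"
    and "sqn M u < \<infinity>" "sqn M v < \<infinity>" "sqn M w < \<infinity>"
  shows "L2_inner M (\<lambda>x. u x + v x) w = L2_inner M u w + L2_inner M v w"
  unfolding L2_inner_def ring_distribs
  by (intro Bochner_Integration.integral_add integrable_mult_sqn assms)

lemma L2_inner_cmult_left: "L2_inner M (\<lambda>x. c * u x) w = c * L2_inner M u w"
  unfolding L2_inner_def by (simp add: mult.assoc)

text \<open>Turns the energy into half a squared norm over pairs of points, so that the calculus of
  \<open>sqn\<close> serves for \<open>M\<close> and \<open>J\<close> alike.\<close>

definition incr :: "('a \<Rightarrow> real) \<Rightarrow> 'a \<times> 'a \<Rightarrow> real" where
  "incr u p = u (fst p) - u (snd p)"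

lemma incr_add: "incr (\<lambda>x. u x + v x) = (\<lambda>p. incr u p + incr v p)"
  and incr_cmult: "incr (\<lambda>x. c * u x) = (\<lambda>p. c * incr u p)"
  and incr_minus: "incr (\<lambda>x. - u x) = (\<lambda>p. - incr u p)"
  and incr_const: "incr (\<lambda>x. c) = (\<lambda>p. 0)"
  by (auto simp: incr_def fun_eq_iff algebra_simps)

section \<open>Jump forms\<close>

text \<open>\<open>AE_J\<close> says that \<open>J\<close> does not charge jumps from or to
  \<open>M\<close>-null sets. It makes the energy a function of almost everywhere classes and
  carries almost everywhere limits over to increments.\<close>

locale jump_form =
  fixes M :: "'a::euclidean_space measure" and J :: "('a \<times> 'a) measure" and E :: "'a form"
    and F :: "('a \<Rightarrow> real) set"
  assumes sets_M[measurable_cong]: "sets M = sets borel"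
    and sets_J[measurable_cong]: "sets J = sets (borel \<Otimes>\<^sub>M borel)"
    and AE_J: "\<And>P. (AE x in M. P x) \<Longrightarrow> (AE p in J. P (fst p) \<and> P (snd p))"
    and E_eq: "\<And>u v. u \<in> borel_measurable borel \<Longrightarrow> v \<in> borel_measurable borel \<Longrightarrow>
      E u v = 1/2 * L2_inner J (incr u) (incr v)"
    and F_eq: "F = {u \<in> borel_measurable borel. sqn M u < \<infinity> \<and> sqn J (incr u) < \<infinity>}"
begin

lemma measurable_incr[measurable]:
  assumes [measurable]: "u \<in> borel_measurable borel"
  shows "incr u \<in> borel_measurable J"
  unfolding incr_def by measurable

lemma borel_measurable_M: "borel_measurable M = borel_measurable borel"
  by (rule measurable_cong_sets) (auto simp: sets_M)

text \<open>The square of \<open>form1_norm\<close>, extended to all functions with values in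
  \<open>ennreal\<close>; the domain consists of the Borel functions at which it is finite.\<close>

definition N :: "('a \<Rightarrow> real) \<Rightarrow> ennreal" where
  "N u = sqn M u + ennreal (1/2) * sqn J (incr u)"

lemma F_D: assumes "u \<in> F"
  shows F_meas: "u \<in> borel_measurable borel" and F_sqn: "sqn M u < \<infinity>"
    and F_incr: "sqn J (incr u) < \<infinity>"
  using assms by (auto simp: F_eq)

lemma F_meas_M: "u \<in> F \<Longrightarrow> u \<in> borel_measurable M"
  using F_meas borel_measurable_M by auto

lemma F_I: "u \<in> borel_measurable borel \<Longrightarrow> sqn M u < \<infinity> \<Longrightarrow> sqn J (incr u) < \<infinity> \<Longrightarrow> u \<in> F"
  by (auto simp: F_eq)

lemma F_N: "u \<in> F \<longleftrightarrow> u \<in> borel_measurable borel \<and> N u < \<infinity>"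
  by (auto simp: F_eq N_def ennreal_mult_less_top)

lemma N_minus: "N (\<lambda>x. - u x) = N u"
  by (simp add: N_def incr_minus sqn_minus)

lemma N_add:
  assumes [measurable]: "u \<in> borel_measurable borel" "v \<in> borel_measurable borel"
  shows "N (\<lambda>x. u x + v x) \<le> 2 * N u + 2 * N v"
proof -
  have "N (\<lambda>x. u x + v x) \<le> (2 * sqn M u + 2 * sqn M v) +
      ennreal (1/2) * (2 * sqn J (incr u) + 2 * sqn J (incr v))"
    unfolding N_def incr_add by (intro add_mono mult_left_mono sqn_add) auto
  also have "\<dots> = 2 * N u + 2 * N v"
    by (simp add: N_def algebra_simps)
  finally show ?thesis .
qed

lemma F_zero: "(\<lambda>x. 0) \<in> F" by (rule F_I) (auto simp: incr_const)

lemma F_add: assumes "u \<in> F" "v \<in> F" shows "(\<lambda>x. u x + v x) \<in> F"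
  using assms N_add[of u v] unfolding F_N
  by (auto simp: ennreal_mult_less_top elim!: le_less_trans)

lemma F_cmult: assumes "u \<in> F" shows "(\<lambda>x. c * u x) \<in> F"
proof -
  have [measurable]: "u \<in> borel_measurable borel" using assms by (rule F_meas)
  show ?thesis using F_D[OF assms]
    by (intro F_I) (auto simp: incr_cmult sqn_cmult ennreal_mult_less_top)
qed

lemma F_minus: "u \<in> F \<Longrightarrow> (\<lambda>x. - u x) \<in> F"
  using F_cmult[of u "-1"] by simp

lemma F_diff: "u \<in> F \<Longrightarrow> v \<in> F \<Longrightarrow> (\<lambda>x. u x - v x) \<in> F"
  using F_add[of u "\<lambda>x. - v x"] F_minus by simp

lemma N_mono:
  assumes "AE x in M. \<bar>v x\<bar> \<le> \<bar>u x\<bar>" "\<And>x y. \<bar>v x - v y\<bar> \<le> \<bar>u x - u y\<bar>"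
  shows "N v \<le> N u"
  unfolding N_def using assms
  by (intro add_mono mult_left_mono sqn_mono_AE) (auto simp: incr_def)

lemma AE_J_incr:
  assumes "AE x in M. u x = v x"
  shows "AE p in J. incr u p = incr v p"
  using AE_J[OF assms] by eventually_elim (auto simp: incr_def)

lemma N_cong_AE:
  assumes "AE x in M. u x = v x"
  shows "N u = N v"
  unfolding N_def using assms AE_J_incr[OF assms] by (auto cong: sqn_cong_AE)

lemma F_cong_AE: 
  assumes "u \<in> F" "v \<in> borel_measurable borel" "AE x in M. u x = v x"
  shows "v \<in> F"
  using assms N_cong_AE[OF assms(3)] by (simp add: F_N)

lemma form1_eq:
  assumes "u \<in> borel_measurable borel" "v \<in> borel_measurable borel"
  shows "form1 M E u v = L2_inner M u v + 1/2 * L2_inner J (incr u) (incr v)"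
  using assms by (simp add: form1_def E_eq)

lemma form1_self:
  assumes "u \<in> F"
  shows "form1 M E u u = enn2real (N u)"
proof -
  have [measurable]: "u \<in> borel_measurable borel" using assms by (rule F_meas)
  have "ennreal (1/2) * sqn J (incr u) < \<infinity>"
    using F_incr[OF assms] by (simp add: ennreal_mult_less_top)
  then show ?thesis using F_sqn[OF assms]
    unfolding N_def by (subst enn2real_plus) (auto simp: form1_eq L2_inner_self enn2real_mult)
qed

lemma form1_norm_less_iff:
  assumes "u \<in> F" "e > 0"
  shows "form1_norm M E u < e \<longleftrightarrow> N u < ennreal (e\<^sup>2)"
proof -
  have "N u < \<infinity>" using assms by (simp add: F_N)
  then have "N u < ennreal (e\<^sup>2) \<longleftrightarrow> enn2real (N u) < e\<^sup>2"
    by (cases "N u" rule: ennreal_cases) (auto simp: ennreal_less_iff)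
  also have "\<dots> \<longleftrightarrow> sqrt (enn2real (N u)) < e"
    using real_sqrt_less_iff[of "enn2real (N u)" "e\<^sup>2"] assms by simp
  finally show ?thesis using assms by (simp add: form1_norm_def form1_self)
qed

lemma bilinear: "bilinear_form M E F"
  unfolding bilinear_form_def
proof (intro conjI ballI allI impI)
  show "F \<subseteq> L2 M" by (auto simp: F_eq L2_def borel_measurable_M sqn_def)
  show "(\<lambda>x. 0) \<in> F" by (rule F_zero)
  fix u v assume u: "u \<in> F" and v: "v \<in> F"
  have [measurable]: "u \<in> borel_measurable borel" "v \<in> borel_measurable borel"
    using u v by (auto dest: F_meas)
  show "(\<lambda>x. u x + v x) \<in> F" using u v by (rule F_add)
  show "E (\<lambda>x. c * u x) v = c * E u v" for c
    by (simp add: E_eq incr_cmult L2_inner_cmult_left)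
  show "E u (\<lambda>x. c * v x) = c * E u v" for c
    by (simp add: E_eq incr_cmult L2_inner_cmult_left L2_inner_commute[of J "incr u"])
  fix w assume w: "w \<in> F"
  have [measurable]: "w \<in> borel_measurable borel" using w by (auto dest: F_meas)
  show "E (\<lambda>x. u x + v x) w = E u w + E v w"
    using F_incr[OF u] F_incr[OF v] F_incr[OF w]
    by (simp add: E_eq incr_add L2_inner_add_left)
  show "E w (\<lambda>x. u x + v x) = E w u + E w v"
    using F_incr[OF u] F_incr[OF v] F_incr[OF w]
    by (simp add: E_eq incr_add L2_inner_add_left L2_inner_commute[of J "incr w"])
next
  fix c u assume u: "u \<in> F" then show "(\<lambda>x. c * u x) \<in> F" by (rule F_cmult)
next
  fix u u' assume u: "u \<in> F" and "u' \<in> borel_measurable M" and AE: "AE x in M. u x = u' x"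
  then have [measurable]: "u' \<in> borel_measurable borel" by (simp add: borel_measurable_M)
  have [measurable]: "u \<in> borel_measurable borel" using u by (auto dest: F_meas)
  show "u' \<in> F" by (rule F_cong_AE[OF u _ AE]) simp
  fix v assume v: "v \<in> F"
  have [measurable]: "v \<in> borel_measurable borel" using v by (auto dest: F_meas)
  have "L2_inner J (incr u') (incr v) = L2_inner J (incr u) (incr v)"
    unfolding L2_inner_def by (rule integral_cong_AE) (use AE_J_incr[OF AE] in auto)
  then show "E u' v = E u v" "E v u' = E v u"
    by (simp_all add: E_eq L2_inner_commute[of J "incr v"])
qed

lemma symmetric: "symmetric_form E F"
  unfolding symmetric_form_def
proof (intro ballI)
  fix u v assume "u \<in> F" "v \<in> F"
  then show "E u v = E v u"
    by (simp add: E_eq F_meas L2_inner_commute[of J "incr u"])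
qed

lemma nonneg: "nonneg_form E F"
  unfolding nonneg_form_def
proof (intro ballI)
  fix u assume "u \<in> F"
  then have [measurable]: "u \<in> borel_measurable borel" by (rule F_meas)
  show "0 \<le> E u u" by (simp add: E_eq L2_inner_self)
qed

lemma F_contraction:
  assumes "u \<in> F" "v \<in> borel_measurable borel"
    and "\<And>x. \<bar>v x\<bar> \<le> \<bar>u x\<bar>" "\<And>x y. \<bar>v x - v y\<bar> \<le> \<bar>u x - u y\<bar>"
  shows "v \<in> F"
  using assms N_mono[of v u] unfolding F_N by (auto elim!: le_less_trans)

lemma markovian: "markovian_form E F"
  unfolding markovian_form_def
proof (intro ballI)
  fix u assume u: "u \<in> F"
  let ?v = "\<lambda>x. min (max 0 (u x)) 1"
  have [measurable]: "u \<in> borel_measurable borel" using u by (auto dest: F_meas)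
  have c: "\<bar>?v x - ?v y\<bar> \<le> \<bar>u x - u y\<bar>" for x y by (auto simp: min_def max_def)
  have v: "?v \<in> F" by (rule F_contraction[OF u _ _ c]) (auto simp: min_def max_def)
  have "sqn J (incr ?v) \<le> sqn J (incr u)"
    by (rule sqn_mono) (use c in \<open>auto simp: incr_def\<close>)
  then have "E ?v ?v \<le> E u u"
    using F_incr[OF u] by (simp add: E_eq L2_inner_self enn2real_mono)
  with v show "?v \<in> F \<and> E ?v ?v \<le> E u u" by simp
qed

text \<open>\<open>AE_J\<close> turns convergence under \<open>M\<close> into convergence of the
  increments under \<open>J\<close>, so Fatou applies to both summands.\<close>

lemma N_fatou:
  assumes [measurable]: "\<And>n. f n \<in> borel_measurable borel"
    and lim: "AE x in M. (\<lambda>n. f n x) \<longlonglongrightarrow> g x"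
  shows "N g \<le> liminf (\<lambda>n. N (f n))"
proof -
  have "AE p in J. (\<lambda>n. incr (f n) p) \<longlonglongrightarrow> incr g p"
    using AE_J[OF lim] by eventually_elim (auto simp: incr_def intro!: tendsto_diff)
  then have "sqn J (incr g) \<le> liminf (\<lambda>n. sqn J (incr (f n)))"
    by (intro sqn_fatou) auto
  moreover have "sqn M g \<le> liminf (\<lambda>n. sqn M (f n))"
    using lim by (intro sqn_fatou) auto
  ultimately have "N g \<le> liminf (\<lambda>n. sqn M (f n)) + ennreal (1/2) * liminf (\<lambda>n. sqn J (incr (f n)))"
    unfolding N_def by (intro add_mono mult_left_mono) auto
  also have "\<dots> = liminf (\<lambda>n. sqn M (f n)) + liminf (\<lambda>n. ennreal (1/2) * sqn J (incr (f n)))"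
    by (intro arg_cong2[where f="(+)"] refl Liminf_compose_continuous_mono[symmetric] monoI mult_left_mono
        ennreal_continuous_on_cmult continuous_on_id) auto
  also have "\<dots> \<le> liminf (\<lambda>n. N (f n))"
    unfolding N_def by (rule ennreal_liminf_add_le)
  finally show ?thesis .
qed

lemma closed: "closed_form M E F"
  unfolding closed_form_def
proof (intro allI impI, elim conjE)
  fix u :: "nat \<Rightarrow> 'a \<Rightarrow> real"
  assume uF: "\<forall>n. u n \<in> F"
    and "\<forall>e>0. \<exists>n0. \<forall>n\<ge>n0. \<forall>p\<ge>n0. form1_norm M E (\<lambda>x. u n x - u p x) < e"
  then have Cauchy: "\<exists>n0. \<forall>n\<ge>n0. \<forall>p\<ge>n0. N (\<lambda>x. u n x - u p x) < ennreal (e\<^sup>2)" if "e > 0" for e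
    using that by (simp add: form1_norm_less_iff F_diff)
  have [measurable]: "u n \<in> borel_measurable borel" for n using uF by (auto dest: F_meas)
  \<comment> \<open>The radius \<open>(1/4) ^ k\<close> has square \<open>(1/16) ^ k\<close>, the
    rate that \<open>AE_convergent_if_rapid\<close> expects.\<close>
  have "\<forall>k. \<exists>n0. \<forall>n\<ge>n0. \<forall>p\<ge>n0. N (\<lambda>x. u n x - u p x) < ennreal (((1/4) ^ k)\<^sup>2)"
    using Cauchy by simp
  then obtain K where K: "\<And>k n p. K k \<le> n \<Longrightarrow> K k \<le> p \<Longrightarrow>
      N (\<lambda>x. u n x - u p x) < ennreal (((1/4) ^ k)\<^sup>2)"
    by metis
  \<comment> \<open>The sum dominates every \<open>K i\<close> with \<open>i \<le> k\<close>, and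
    the summand \<open>k\<close> makes the indices tend to infinity.\<close>
  define s where "s k = k + (\<Sum>i\<le>k. K i)" for k
  have sK: "K i \<le> s k" if "i \<le> k" for i k
    using member_le_sum[of i "{..k}" K] that by (simp add: s_def)
  define v where "v x = lim (\<lambda>k. u (s k) x)" for x
  have [measurable]: "v \<in> borel_measurable borel" unfolding v_def by measurable
  have "AE x in M. convergent (\<lambda>k. u (s k) x)"
  proof (rule AE_convergent_if_rapid)
    fix k
    have "sqn M (\<lambda>x. u (s (Suc k)) x - u (s k) x) \<le> N (\<lambda>x. u (s (Suc k)) x - u (s k) x)"
      by (simp add: N_def)
    also have "\<dots> \<le> ennreal (((1/4) ^ k)\<^sup>2)"
      using K[of k "s (Suc k)" "s k"] sK[of k "Suc k"] sK[of k k] by simp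
    also have "((1/4) ^ k)\<^sup>2 = ((1/16) ^ k :: real)"
      by (simp add: power2_eq_square flip: power_mult_distrib)
    finally show "sqn M (\<lambda>x. u (s (Suc k)) x - u (s k) x) \<le> ennreal ((1/16) ^ k)" .
  qed simp
  then have lim: "AE x in M. (\<lambda>k. u (s k) x) \<longlonglongrightarrow> v x"
    by eventually_elim (auto simp: v_def convergent_LIMSEQ_iff)
  \<comment> \<open>Fatou in the second index: a Cauchy bound between \<open>u n\<close> and
    \<open>u p\<close> survives \<open>p\<close> running to infinity along \<open>s\<close>.\<close>
  have le: "N (\<lambda>x. u n x - v x) \<le> ennreal (e\<^sup>2)"
    if n: "n0 \<le> n" and n0: "\<And>n p. n0 \<le> n \<Longrightarrow> n0 \<le> p \<Longrightarrow> N (\<lambda>x. u n x - u p x) < ennreal (e\<^sup>2)"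
    for n n0 e
  proof -
    have "N (\<lambda>x. u n x - v x) \<le> liminf (\<lambda>k. N (\<lambda>x. u n x - u (s k) x))"
      by (rule N_fatou) (use lim in \<open>auto elim!: eventually_mono intro!: tendsto_diff\<close>)
    also have "\<dots> \<le> liminf (\<lambda>k. ennreal (e\<^sup>2))"
    proof (rule Liminf_mono)
      have "N (\<lambda>x. u n x - u (s k) x) \<le> ennreal (e\<^sup>2)" if "n0 \<le> k" for k
        using n0[OF n, of "s k"] that by (simp add: s_def)
      then show "\<forall>\<^sub>F k in sequentially. N (\<lambda>x. u n x - u (s k) x) \<le> ennreal (e\<^sup>2)"
        by (auto simp: eventually_sequentially)
    qed
    finally show ?thesis by (simp add: Liminf_const)
  qed
  obtain n0 where n0: "\<forall>n\<ge>n0. \<forall>p\<ge>n0. N (\<lambda>x. u n x - u p x) < ennreal (1\<^sup>2)"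
    using Cauchy[of 1] by auto
  have "N (\<lambda>x. u n0 x - v x) \<le> ennreal (1\<^sup>2)" by (rule le[of n0 n0]) (use n0 in auto)
  then have "(\<lambda>x. u n0 x - v x) \<in> F" unfolding F_N by (auto elim: le_less_trans)
  then have "(\<lambda>x. u n0 x - (u n0 x - v x)) \<in> F" using uF F_diff[of "u n0" "\<lambda>x. u n0 x - v x"] by blast
  then have vF: "v \<in> F" by simp
  have "(\<lambda>n. form1_norm M E (\<lambda>x. u n x - v x)) \<longlonglongrightarrow> 0"
  proof (rule LIMSEQ_I)
    fix r :: real assume r: "0 < r"
    obtain n0 where n0: "\<forall>n\<ge>n0. \<forall>p\<ge>n0. N (\<lambda>x. u n x - u p x) < ennreal ((r/2)\<^sup>2)"
      using Cauchy[of "r/2"] r by auto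
    have "norm (form1_norm M E (\<lambda>x. u n x - v x) - 0) < r" if "n \<ge> n0" for n
    proof -
      have "N (\<lambda>x. u n x - v x) \<le> ennreal ((r/2)\<^sup>2)" by (rule le[of n0 n]) (use n0 that in auto)
      also have "\<dots> < ennreal (r\<^sup>2)" using r by (intro ennreal_lessI power_strict_mono) auto
      finally have "form1_norm M E (\<lambda>x. u n x - v x) < r"
        using form1_norm_less_iff[OF F_diff[OF _ vF] r, of "u n"] uF by blast
      moreover have "0 \<le> form1_norm M E (\<lambda>x. u n x - v x)"
        using uF by (simp add: form1_norm_def form1_self F_diff vF)
      ultimately show ?thesis by simp
    qed
    then show "\<exists>n0. \<forall>n\<ge>n0. norm (form1_norm M E (\<lambda>x. u n x - v x) - 0) < r" by blast
  qed
  then show "\<exists>v\<in>F. (\<lambda>n. form1_norm M E (\<lambda>x. u n x - v x)) \<longlonglongrightarrow> 0" using vF by blast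
qed

end

lemma tendsto_0_le_ennreal:
  fixes f g :: "nat \<Rightarrow> ennreal"
  assumes "g \<longlonglongrightarrow> 0" "\<And>n. f n \<le> g n"
  shows "f \<longlonglongrightarrow> 0"
  by (rule tendsto_sandwich[OF _ _ tendsto_const assms(1)]) (simp_all add: assms(2))

section \<open>Approximation by contractions, bounded multipliers and cutoffs of small
  energy\<close>

context jump_form
begin

text \<open>The error \<open>u - T n u\<close> has values and increments at most twice those of
  \<open>u\<close>, so dominated convergence works on \<open>M\<close> and on \<open>J\<close>
  separately.\<close>

lemma N_contraction_tendsto_0:
  fixes T :: "nat \<Rightarrow> real \<Rightarrow> real"
  assumes u: "u \<in> F" and T0: "\<And>n. T n 0 = 0"
    and T1: "\<And>n s t. \<bar>T n s - T n t\<bar> \<le> \<bar>s - t\<bar>"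
    and T[measurable]: "\<And>n. T n \<in> borel_measurable borel"
    and lim: "\<And>t::real. (\<lambda>n. T n t) \<longlonglongrightarrow> t"
  shows "(\<lambda>n. N (\<lambda>x. u x - T n (u x))) \<longlonglongrightarrow> 0"
proof -
  have [measurable]: "u \<in> borel_measurable borel" using u by (rule F_meas)
  have b: "\<bar>s - t - (T n s - T n t)\<bar> \<le> \<bar>2 * (s - t)\<bar>" for n s t
  proof -
    have "a \<le> x + y \<Longrightarrow> y \<le> x \<Longrightarrow> a \<le> 2 * x" for a x y :: real by simp
    from this[OF abs_triangle_ineq4 T1] show ?thesis by (simp only: abs_mult abs_numeral)
  qed
  have b0: "\<bar>s - T n s\<bar> \<le> \<bar>2 * s\<bar>" for n s using b[of s 0 n] T0 by simp
  have "(\<lambda>n. sqn M (\<lambda>x. u x - T n (u x))) \<longlonglongrightarrow> 0"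
  proof (rule sqn_dominated)
    show "AE x in M. \<bar>u x - T n (u x)\<bar> \<le> \<bar>2 * u x\<bar>" for n using b0 by auto
    show "sqn M (\<lambda>x. 2 * u x) < \<infinity>" using F_sqn[OF u] by (simp add: sqn_cmult ennreal_mult_less_top)
    have "(\<lambda>n. u x - T n (u x)) \<longlonglongrightarrow> u x - u x" for x by (intro tendsto_diff lim tendsto_const)
    then show "AE x in M. (\<lambda>n. u x - T n (u x)) \<longlonglongrightarrow> 0" by simp
  qed auto
  moreover have "(\<lambda>n. sqn J (incr (\<lambda>x. u x - T n (u x)))) \<longlonglongrightarrow> 0"
  proof (rule sqn_dominated)
    show "AE p in J. \<bar>incr (\<lambda>x. u x - T n (u x)) p\<bar> \<le> \<bar>2 * incr u p\<bar>" for n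
      using b by (auto simp: incr_def algebra_simps)
    show "sqn J (\<lambda>x. 2 * incr u x) < \<infinity>" using F_incr[OF u] by (simp add: sqn_cmult ennreal_mult_less_top)
    have "(\<lambda>n. incr (\<lambda>x. u x - T n (u x)) p) \<longlonglongrightarrow>
        (u (fst p) - u (fst p)) - (u (snd p) - u (snd p))" for p
      unfolding incr_def by (intro tendsto_diff lim tendsto_const)
    then show "AE p in J. (\<lambda>n. incr (\<lambda>x. u x - T n (u x)) p) \<longlonglongrightarrow> 0" by simp
  qed auto
  ultimately have "(\<lambda>n. sqn M (\<lambda>x. u x - T n (u x)) + ennreal (1/2) * sqn J (incr (\<lambda>x. u x - T n (u x))))
      \<longlonglongrightarrow> 0 + ennreal (1/2) * 0"
    by (intro tendsto_add ennreal_tendsto_cmult) auto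
  then show ?thesis unfolding N_def by simp
qed

text \<open>Product rule with \<open>f\<close> frozen at the first point and \<open>g\<close> at the
  second. The bound \<open>C\<close> is spent on the increment of \<open>g\<close> only; the other
  term keeps the factor \<open>g (snd p)\<close>, which can then tend to 0.\<close>

lemma incr_mult_le:
  assumes [measurable]: "f \<in> borel_measurable borel" "g \<in> borel_measurable borel"
    and f: "\<And>x. \<bar>f x\<bar> \<le> C"
  shows "sqn J (incr (\<lambda>x. f x * g x)) \<le>
    2 * (ennreal (C\<^sup>2) * sqn J (incr g)) + 2 * sqn J (\<lambda>p. g (snd p) * incr f p)"
proof -
  have [measurable]: "(\<lambda>p. f (fst p) * incr g p) \<in> borel_measurable J"
    "(\<lambda>p. g (snd p) * incr f p) \<in> borel_measurable J" by measurable
  have C: "0 \<le> C" using f[of undefined] by linarith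
  have "incr (\<lambda>x. f x * g x) = (\<lambda>p. f (fst p) * incr g p + g (snd p) * incr f p)"
    by (auto simp: incr_def algebra_simps)
  then have "sqn J (incr (\<lambda>x. f x * g x)) \<le>
      2 * sqn J (\<lambda>p. f (fst p) * incr g p) + 2 * sqn J (\<lambda>p. g (snd p) * incr f p)"
    by (simp add: sqn_add)
  also have "\<dots> \<le> 2 * sqn J (\<lambda>p. C * incr g p) + 2 * sqn J (\<lambda>p. g (snd p) * incr f p)"
    using f C by (intro add_mono mult_left_mono sqn_mono) (auto simp: abs_mult intro!: mult_right_mono)
  also have "sqn J (\<lambda>p. C * incr g p) = ennreal (C\<^sup>2) * sqn J (incr g)"
    by (simp add: sqn_cmult)
  finally show ?thesis .
qed

lemma F_mult:
  assumes f: "f \<in> F" "\<And>x. \<bar>f x\<bar> \<le> C"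
    and g[measurable]: "g \<in> borel_measurable borel" "\<And>x. \<bar>g x\<bar> \<le> 1" "sqn J (incr g) < \<infinity>"
  shows "(\<lambda>x. f x * g x) \<in> F"
proof -
  have [measurable]: "f \<in> borel_measurable borel" using f by (auto dest: F_meas)
  have m: "\<bar>a * g x\<bar> \<le> \<bar>a\<bar>" for a x
    using mult_left_mono[OF g(2), of "\<bar>a\<bar>" x] by (simp add: abs_mult)
  have "sqn M (\<lambda>x. f x * g x) \<le> sqn M f" by (rule sqn_mono) (rule m)
  moreover have "sqn J (incr (\<lambda>x. f x * g x)) \<le>
      2 * (ennreal (C\<^sup>2) * sqn J (incr g)) + 2 * sqn J (\<lambda>p. g (snd p) * incr f p)"
    by (rule incr_mult_le) (use f in auto)
  moreover have "sqn J (\<lambda>p. g (snd p) * incr f p) \<le> sqn J (incr f)"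
    by (rule sqn_mono) (use m in \<open>auto simp: mult.commute\<close>)
  ultimately show ?thesis using F_D[OF f(1)] g(3)
    by (intro F_I) (auto simp: ennreal_mult_less_top elim!: le_less_trans)
qed

lemma N_mult_tendsto_0:
  assumes f: "f \<in> F" "\<And>x. \<bar>f x\<bar> \<le> C"
    and g[measurable]: "\<And>n. g n \<in> borel_measurable borel"
    and g1: "\<And>n x. \<bar>g n x\<bar> \<le> 1" and gJ: "(\<lambda>n. sqn J (incr (g n))) \<longlonglongrightarrow> 0"
    and g0: "AE x in M. (\<lambda>n. g n x) \<longlonglongrightarrow> 0"
  shows "(\<lambda>n. N (\<lambda>x. f x * g n x)) \<longlonglongrightarrow> 0"
proof -
  have [measurable]: "f \<in> borel_measurable borel" using f by (auto dest: F_meas)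
  have m: "\<bar>a * g n x\<bar> \<le> \<bar>a\<bar>" for a x n
    using mult_left_mono[OF g1, of "\<bar>a\<bar>" n x] by (simp add: abs_mult)
  have 1: "(\<lambda>n. sqn M (\<lambda>x. f x * g n x)) \<longlonglongrightarrow> 0"
    by (rule sqn_dominated[where g=f])
      (use m F_sqn[OF f(1)] g0 in \<open>auto elim!: eventually_mono intro!: tendsto_mult_right_zero\<close>)
  have "(\<lambda>n. sqn J (\<lambda>p. g n (snd p) * incr f p)) \<longlonglongrightarrow> 0"
  proof (rule sqn_dominated[where g="incr f"])
    show "AE p in J. (\<lambda>n. g n (snd p) * incr f p) \<longlonglongrightarrow> 0"
      using AE_J[OF g0] by eventually_elim (auto intro!: tendsto_mult_left_zero)
    show "sqn J (incr f) < \<infinity>" using f(1) by (rule F_incr)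
  qed (use m in \<open>auto simp: mult.commute\<close>)
  then have "(\<lambda>n. 2 * (ennreal (C\<^sup>2) * sqn J (incr (g n))) + 2 * sqn J (\<lambda>p. g n (snd p) * incr f p))
      \<longlonglongrightarrow> 2 * (ennreal (C\<^sup>2) * 0) + 2 * 0"
    by (intro tendsto_add ennreal_tendsto_cmult gJ) auto
  then have 2: "(\<lambda>n. 2 * (ennreal (C\<^sup>2) * sqn J (incr (g n))) + 2 * sqn J (\<lambda>p. g n (snd p) * incr f p))
      \<longlonglongrightarrow> 0" by simp
  have "(\<lambda>n. sqn J (incr (\<lambda>x. f x * g n x))) \<longlonglongrightarrow> 0"
    by (rule tendsto_0_le_ennreal[OF 2]) (rule incr_mult_le, use f in auto)
  with 1 have "(\<lambda>n. sqn M (\<lambda>x. f x * g n x) + ennreal (1/2) * sqn J (incr (\<lambda>x. f x * g n x)))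
      \<longlonglongrightarrow> 0 + ennreal (1/2) * 0"
    by (intro tendsto_add ennreal_tendsto_cmult) auto
  then show ?thesis unfolding N_def by simp
qed

text \<open>\<open>g n\<close> acts as an equilibrium potential of the complement of
  \<open>K n\<close>. Its energy and its almost everywhere limit are controlled, not its norm in
  \<open>L2 M\<close>: these functions only multiply bounded elements of \<open>F\<close>.\<close>

definition vanishing_cutoffs :: "(nat \<Rightarrow> 'a \<Rightarrow> real) \<Rightarrow> (nat \<Rightarrow> 'a set) \<Rightarrow> bool" where
  "vanishing_cutoffs g K \<longleftrightarrow>
     (\<forall>n. g n \<in> borel_measurable borel \<and> (\<forall>x. 0 \<le> g n x \<and> g n x \<le> 1) \<and>
       sqn J (incr (g n)) < \<infinity> \<and> Topological_Spaces.closed (K n) \<and> (\<forall>x. x \<notin> K n \<longrightarrow> g n x = 1)) \<and>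
     incseq K \<and> (\<lambda>n. sqn J (incr (g n))) \<longlonglongrightarrow> 0 \<and> (AE x in M. (\<lambda>n. g n x) \<longlonglongrightarrow> 0)"

lemma vanishing_cutoffs_max:
  assumes "vanishing_cutoffs g K" "vanishing_cutoffs g' K'"
  shows "vanishing_cutoffs (\<lambda>n x. max (g n x) (g' n x)) (\<lambda>n. K n \<inter> K' n)"
proof -
  note v = assms[unfolded vanishing_cutoffs_def]
  have [measurable]: "g n \<in> borel_measurable borel" "g' n \<in> borel_measurable borel" for n
    using v by auto
  have le: "sqn J (incr (\<lambda>x. max (g n x) (g' n x))) \<le> sqn J (incr (g n)) + sqn J (incr (g' n))" for n
  proof -
    \<comment> \<open>An increment of a maximum is at most the larger of the two increments, so its
      square is at most the sum of the squares.\<close>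
    have "(max a b - max c d)\<^sup>2 \<le> (a - c)\<^sup>2 + (b - d)\<^sup>2" for a b c d :: real
    proof -
      have "\<bar>max a b - max c d\<bar> \<le> \<bar>a - c\<bar> \<or> \<bar>max a b - max c d\<bar> \<le> \<bar>b - d\<bar>" by linarith
      then show ?thesis
        by (auto simp: abs_le_square_iff intro: order_trans)
    qed
    then have "sqn J (incr (\<lambda>x. max (g n x) (g' n x))) \<le>
        (\<integral>\<^sup>+p. ennreal ((incr (g n) p)\<^sup>2) + ennreal ((incr (g' n) p)\<^sup>2) \<partial>J)"
      unfolding sqn_def by (intro nn_integral_mono) (auto simp: incr_def simp flip: ennreal_plus intro!: ennreal_leI)
    then show ?thesis by (simp add: sqn_def nn_integral_add)
  qed
  have "(\<lambda>n. sqn J (incr (g n)) + sqn J (incr (g' n))) \<longlonglongrightarrow> 0 + 0"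
    using v by (intro tendsto_add) auto
  then have "(\<lambda>n. sqn J (incr (\<lambda>x. max (g n x) (g' n x)))) \<longlonglongrightarrow> 0"
    by (intro tendsto_0_le_ennreal[OF _ le]) simp
  moreover have "sqn J (incr (\<lambda>x. max (g n x) (g' n x))) < \<infinity>" for n
  proof (rule le_less_trans[OF le])
    show "sqn J (incr (g n)) + sqn J (incr (g' n)) < \<infinity>" using v by simp
  qed
  moreover have "AE x in M. (\<lambda>n. max (g n x) (g' n x)) \<longlonglongrightarrow> 0"
  proof -
    have "AE x in M. (\<lambda>n. g n x) \<longlonglongrightarrow> 0" "AE x in M. (\<lambda>n. g' n x) \<longlonglongrightarrow> 0" using v by auto
    then show ?thesis
    proof eventually_elim
      case (elim x)
      then have "(\<lambda>n. max (g n x) (g' n x)) \<longlonglongrightarrow> max 0 0" by (intro tendsto_max)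
      then show ?case by simp
    qed
  qed
  moreover have "incseq (\<lambda>n. K n \<inter> K' n)" using v by (fastforce simp: incseq_def)
  moreover have "max (g n x) (g' n x) = 1" if "x \<notin> K n \<inter> K' n" for n x
  proof -
    have "g n x \<le> 1" "g' n x \<le> 1" "x \<notin> K n \<Longrightarrow> g n x = 1" "x \<notin> K' n \<Longrightarrow> g' n x = 1"
      using v by auto
    then show ?thesis using that by (cases "x \<in> K n") auto
  qed
  ultimately show ?thesis unfolding vanishing_cutoffs_def using v
    by (auto simp: le_max_iff_disj)
qed

lemma vanishing_cutoffs_continuous:
  assumes cont: "\<And>n. continuous_on UNIV (a n)"
    and sum: "(\<Sum>n. sqn J (incr (a n))) < \<infinity>"
    and a0: "AE x in M. (\<lambda>n. a n x) \<longlonglongrightarrow> 0"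
  shows "\<exists>g. vanishing_cutoffs g (\<lambda>k. {x. \<forall>n. \<bar>a (n + k) x\<bar> \<le> 1})"
proof -
  have [measurable]: "a n \<in> borel_measurable borel" for n
    using cont by (rule borel_measurable_continuous_onI)
  \<comment> \<open>Truncation at 1 keeps the supremum finite, also at points where the sequence is
    unbounded.\<close>
  define g where "g k x = (SUP n. min 1 \<bar>a (n + k) x\<bar>)" for k x
  have bdd: "bdd_above (range (\<lambda>n. min 1 \<bar>a (n + k) x\<bar>))" for k x
    by (rule bdd_aboveI[of _ 1]) auto
  have g_upper: "min 1 \<bar>a (n + k) x\<bar> \<le> g k x" for n k x
    unfolding g_def by (rule cSUP_upper[OF _ bdd]) simp
  have g_least: "g k x \<le> c" if "\<And>n. min 1 \<bar>a (n + k) x\<bar> \<le> c" for k x c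
    unfolding g_def by (rule cSUP_least) (use that in auto)
  have [measurable]: "g k \<in> borel_measurable borel" for k
    unfolding g_def by (rule borel_measurable_cSUP) (use bdd in auto)
  have g01: "0 \<le> g k x" "g k x \<le> 1" for k x
    using g_upper[where n=0 and k=k and x=x] by (auto intro: g_least)
  have out: "g k x = 1" if large: "\<not> (\<forall>n. \<bar>a (n + k) x\<bar> \<le> 1)" for k x
  proof -
    obtain n where "1 < \<bar>a (n + k) x\<bar>" using large by (auto simp: not_le)
    then show ?thesis using g_upper[of n k x] g01[of k x] by simp
  qed
  \<comment> \<open>An increment of a supremum is at most the supremum of the increments, whose
    square is at most the sum of their squares.\<close>
  have pt: "ennreal ((incr (g k) p)\<^sup>2) \<le> (\<Sum>n. ennreal ((incr (a (n + k)) p)\<^sup>2))" (is "_ \<le> ?S") for k p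
  proof (cases "?S = \<infinity>")
    case False
    define S where "S = (\<Sum>n. (incr (a (n + k)) p)\<^sup>2)"
    have sm: "summable (\<lambda>n. (incr (a (n + k)) p)\<^sup>2)"
      using False by (intro summable_suminf_not_top) auto
    then have S: "?S = ennreal S" unfolding S_def
      by (intro suminf_ennreal2) auto
    have "(incr (a (n + k)) p)\<^sup>2 \<le> S" for n
      unfolding S_def using sum_le_suminf[OF sm, of "{n}"] by simp
    then have d: "\<bar>a (n + k) (fst p) - a (n + k) (snd p)\<bar> \<le> sqrt S" for n
      using real_le_rsqrt[of "\<bar>incr (a (n + k)) p\<bar>" S] by (simp add: incr_def)
    have "g k (fst p) \<le> g k (snd p) + sqrt S"
    proof (rule g_least)
      show "min 1 \<bar>a (n + k) (fst p)\<bar> \<le> g k (snd p) + sqrt S" for n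
        using g_upper[of n k "snd p"] d[of n] by linarith
    qed
    moreover have "g k (snd p) \<le> g k (fst p) + sqrt S"
    proof (rule g_least)
      show "min 1 \<bar>a (n + k) (snd p)\<bar> \<le> g k (fst p) + sqrt S" for n
        using g_upper[of n k "fst p"] d[of n] by linarith
    qed
    ultimately have "\<bar>incr (g k) p\<bar> \<le> sqrt S" unfolding incr_def by linarith
    then have "(incr (g k) p)\<^sup>2 \<le> S"
      using sqrt_ge_absD by blast
    then show ?thesis unfolding S by (rule ennreal_leI)
  qed auto
  have le: "sqn J (incr (g k)) \<le> (\<Sum>n. sqn J (incr (a (n + k))))" for k
  proof -
    have "sqn J (incr (g k)) \<le> (\<integral>\<^sup>+p. (\<Sum>n. ennreal ((incr (a (n + k)) p)\<^sup>2)) \<partial>J)"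
      unfolding sqn_def by (intro nn_integral_mono pt)
    also have "\<dots> = (\<Sum>n. sqn J (incr (a (n + k))))"
      unfolding sqn_def by (rule nn_integral_suminf) simp
    finally show ?thesis .
  qed
  \<comment> \<open>Over the reals, tails of a convergent series tend to 0; this yields the
    vanishing of the energies of \<open>g k\<close>.\<close>
  define r where "r n = enn2real (sqn J (incr (a n)))" for n
  have fin: "sqn J (incr (a n)) < \<infinity>" for n
    using ennreal_suminf_lessD[of "\<lambda>n. sqn J (incr (a n))"] sum by auto
  then have r: "sqn J (incr (a n)) = ennreal (r n)" for n by (auto simp: r_def less_top)
  have sr: "summable r"
    using sum unfolding r by (intro summable_suminf_not_top) (auto simp: r_def)
  have tail: "(\<Sum>n. sqn J (incr (a (n + k)))) = ennreal (\<Sum>n. r (n + k))" for k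
    unfolding r by (rule suminf_ennreal2) (use sr in \<open>auto simp: r_def[symmetric] summable_iff_shift\<close>, simp add: r_def)
  have le': "sqn J (incr (g k)) \<le> ennreal (\<Sum>n. r (n + k))" for k
    using le[of k] unfolding tail .
  have "(\<lambda>k. ennreal (\<Sum>n. r (n + k))) \<longlonglongrightarrow> ennreal 0"
    by (intro tendsto_ennrealI suminf_exist_split2 sr)
  then have "(\<lambda>k. sqn J (incr (g k))) \<longlonglongrightarrow> 0"
    by (intro tendsto_0_le_ennreal[OF _ le']) simp
  moreover have "sqn J (incr (g k)) < \<infinity>" for k
    using le'[of k] by (rule le_less_trans) simp
  moreover have "AE x in M. (\<lambda>n. g n x) \<longlonglongrightarrow> 0"
    using a0
  proof eventually_elim
    case (elim x)
    show ?case
    proof (rule LIMSEQ_I)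
      fix e :: real assume "0 < e"
      then obtain n0 where n0: "\<forall>n\<ge>n0. norm (a n x - 0) < e/2"
        using LIMSEQ_D[OF elim, of "e/2"] by auto
      have "norm (g k x - 0) < e" if "n0 \<le> k" for k
      proof -
        have "g k x \<le> e/2" 
        proof (rule g_least)
          show "min 1 \<bar>a (n + k) x\<bar> \<le> e/2" for n using n0[rule_format, of "n + k"] that by simp
        qed
        then show ?thesis using g01[of k x] \<open>0 < e\<close> by simp
      qed
      then show "\<exists>n0. \<forall>n\<ge>n0. norm (g n x - 0) < e" by blast
    qed
  qed
  moreover have "Topological_Spaces.closed {x. \<forall>n. \<bar>a (n + k) x\<bar> \<le> 1}" for k
    by (intro closed_Collect_all closed_Collect_le continuous_intros cont)
  moreover have "incseq (\<lambda>k. {x. \<forall>n. \<bar>a (n + k) x\<bar> \<le> 1})"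
  proof (rule incseq_SucI, safe)
    fix k x n assume "\<forall>n. \<bar>a (n + k) x\<bar> \<le> 1"
    then show "\<bar>a (n + Suc k) x\<bar> \<le> 1" by (elim allE[of _ "Suc n"]) simp
  qed
  ultimately show ?thesis using g01 out unfolding vanishing_cutoffs_def
    by (intro exI[of _ g]) auto
qed


lemma form_denseI:
  assumes "S \<subseteq> F" "\<And>u e. u \<in> F \<Longrightarrow> 0 < e \<Longrightarrow> \<exists>v\<in>S. N (\<lambda>x. u x - v x) < ennreal e"
  shows "form_dense M E F S"
  unfolding form_dense_def
proof (intro conjI ballI allI impI assms(1))
  fix u and e :: real assume u: "u \<in> F" and e: "0 < e"
  obtain v where v: "v \<in> S" "N (\<lambda>x. u x - v x) < ennreal (e\<^sup>2)"
    using assms(2)[OF u, of "e\<^sup>2"] e by auto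
  moreover have "v \<in> F" using v assms(1) by auto
  ultimately show "\<exists>v\<in>S. form1_norm M E (\<lambda>x. u x - v x) < e"
    using form1_norm_less_iff[OF F_diff[OF u] e] by blast
qed

text \<open>\<open>N\<close> is a squared norm and satisfies the triangle inequality with a factor
  2, so two errors of \<open>e/4\<close> add up to \<open>e\<close>. Chains of approximations are
  budgeted as \<open>e/4\<close>, \<open>e/4/4\<close> and so on.\<close>

lemma N_diff_trans:
  assumes [measurable]: "u \<in> borel_measurable borel" "v \<in> borel_measurable borel" "w \<in> borel_measurable borel"
    and "N (\<lambda>x. u x - v x) < ennreal (e/4)" "N (\<lambda>x. v x - w x) < ennreal (e/4)"
  shows "N (\<lambda>x. u x - w x) < ennreal e"
proof -
  have e: "0 < e" using assms(4) by (cases "0 < e") (auto simp: ennreal_neg)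
  have "N (\<lambda>x. u x - w x) \<le> 2 * N (\<lambda>x. u x - v x) + 2 * N (\<lambda>x. v x - w x)"
    using N_add[of "\<lambda>x. u x - v x" "\<lambda>x. v x - w x"] by simp
  also have "\<dots> < 2 * ennreal (e/4) + 2 * ennreal (e/4)"
    using assms(4,5) by (intro add_strict_mono ennreal_mult_strict_left_mono) auto
  also have "\<dots> = ennreal (2 * (e/4) + 2 * (e/4))"
    using e by (simp flip: ennreal_plus ennreal_mult ennreal_numeral)
  finally show ?thesis by simp
qed

lemma N_tendsto_0_D:
  assumes "(\<lambda>n. N (f n)) \<longlonglongrightarrow> 0" "0 < e"
  shows "\<forall>\<^sub>F n in sequentially. N (f n) < ennreal e"
  using order_tendstoD(2)[OF assms(1), of "ennreal e"] assms(2) by simp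

section \<open>The form inner product, excessive elements and truncation by their multiples\<close>

abbreviation ip :: "('a \<Rightarrow> real) \<Rightarrow> ('a \<Rightarrow> real) \<Rightarrow> real" where
  "ip \<equiv> form1 M E"

lemma ip_sym: "u \<in> F \<Longrightarrow> v \<in> F \<Longrightarrow> ip u v = ip v u"
  by (simp add: form1_eq F_meas L2_inner_commute[of _ u] L2_inner_commute[of _ "incr u"])

lemma ip_add:
  assumes "u \<in> F" "v \<in> F" "w \<in> F"
  shows "ip (\<lambda>x. u x + v x) w = ip u w + ip v w"
proof -
  have [measurable]: "u \<in> borel_measurable borel" "v \<in> borel_measurable borel" "w \<in> borel_measurable borel"
    using assms by (auto dest: F_meas)
  show ?thesis using F_D[OF assms(1)] F_D[OF assms(2)] F_D[OF assms(3)]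
    by (simp add: form1_eq incr_add L2_inner_add_left algebra_simps)
qed

lemma ip_cmult:
  assumes "u \<in> F" "w \<in> F"
  shows "ip (\<lambda>x. c * u x) w = c * ip u w"
proof -
  have [measurable]: "u \<in> borel_measurable borel" "w \<in> borel_measurable borel"
    using assms by (auto dest: F_meas)
  show ?thesis 
    by (simp add: form1_eq incr_cmult L2_inner_cmult_left algebra_simps)
qed

lemma N_eq_ip: "u \<in> F \<Longrightarrow> N u = ennreal (ip u u)"
  by (simp add: form1_self F_N)

lemma ip_nonneg: "u \<in> F \<Longrightarrow> 0 \<le> ip u u"
  by (simp add: form1_self)

lemma ip_add_cmult_self:
  assumes "u \<in> F" "v \<in> F"
  shows "ip (\<lambda>x. u x + c * v x) (\<lambda>x. u x + c * v x) = ip u u + 2 * c * ip u v + c\<^sup>2 * ip v v"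
  using assms ip_sym[of u "\<lambda>x. u x + c * v x"] ip_sym[of v "\<lambda>x. u x + c * v x"] ip_sym[of u v]
  by (simp add: ip_add ip_cmult F_add F_cmult power2_eq_square algebra_simps)

lemma ip_diff_self:
  assumes "u \<in> F" "v \<in> F"
  shows "ip (\<lambda>x. u x - v x) (\<lambda>x. u x - v x) = ip u u - 2 * ip u v + ip v v"
  using ip_add_cmult_self[OF assms, of "-1"] by simp

text \<open>The variational description of 1-excessive elements of the domain: a non-negative
  pairing with every non-negative element.\<close>

definition excessive :: "('a \<Rightarrow> real) \<Rightarrow> bool" where
  "excessive h \<longleftrightarrow> h \<in> F \<and> (\<forall>v\<in>F. (AE x in M. 0 \<le> v x) \<longrightarrow> 0 \<le> ip h v)"

text \<open>The element of smallest norm above an obstacle is excessive.\<close>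

lemma ex_excessive_ge:
  assumes u0: "u0 \<in> F"
  shows "\<exists>h. excessive h \<and> (AE x in M. u0 x \<le> h x)"
proof -
  define C where "C = {w \<in> F. AE x in M. u0 x \<le> w x}"
  define I where "I = Inf ((\<lambda>w. ip w w) ` C)"
  have CF: "w \<in> F" if "w \<in> C" for w using that by (simp add: C_def)
  have I_le: "I \<le> ip w w" if "w \<in> C" for w
    unfolding I_def
    by (rule cInf_lower) (use that CF ip_nonneg in \<open>auto intro!: bdd_belowI[of _ 0]\<close>)
  have "\<exists>w\<in>C. ip w w < I + 1 / real (Suc n)" for n
  proof -
    have "(\<lambda>w. ip w w) ` C \<noteq> {}" using u0 by (auto simp: C_def)
    moreover have "Inf ((\<lambda>w. ip w w) ` C) < I + 1 / real (Suc n)" by (simp add: I_def)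
    ultimately show ?thesis by (drule_tac cInf_lessD) auto
  qed
  then obtain w where wC: "\<And>n. w n \<in> C" and w_less: "\<And>n. ip (w n) (w n) < I + 1 / real (Suc n)"
    by metis
  have wF: "w n \<in> F" for n using wC CF by auto
  \<comment> \<open>Parallelogram law: \<open>C\<close> is convex, so the midpoint of
    \<open>w n\<close> and \<open>w p\<close> has squared norm at least \<open>I\<close>. A
    minimising sequence is therefore Cauchy.\<close>
  have par: "ip (\<lambda>x. w n x - w p x) (\<lambda>x. w n x - w p x) \<le> 2 / real (Suc n) + 2 / real (Suc p)" for n p
  proof -
    have "(\<lambda>x. (1/2) * (w n x + 1 * w p x)) \<in> F"
      using wF by (intro F_cmult F_add)
    moreover have "AE x in M. u0 x \<le> (1/2) * (w n x + 1 * w p x)"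
    proof -
      have "AE x in M. u0 x \<le> w n x" "AE x in M. u0 x \<le> w p x" using wC by (auto simp: C_def)
      then show ?thesis by eventually_elim simp
    qed
    ultimately have "I \<le> ip (\<lambda>x. (1/2) * (w n x + 1 * w p x)) (\<lambda>x. (1/2) * (w n x + 1 * w p x))"
      by (intro I_le) (simp add: C_def)
    \<comment> \<open>The quadratic expansion with first argument 0 and coefficient
      \<open>1/2\<close> gives the factor \<open>1/4\<close>; the two instances of
      \<open>ip_cmult\<close> remove the terms containing the zero function.\<close>
    also have "\<dots> = (1/4) * ip (\<lambda>x. w n x + 1 * w p x) (\<lambda>x. w n x + 1 * w p x)"
      using ip_add_cmult_self[OF F_zero F_add[OF wF F_cmult[OF wF]], of "1/2" n 1 p] 
        ip_cmult[OF F_zero F_zero, of 0] ip_cmult[OF F_zero F_add[OF wF F_cmult[OF wF]], of 0 n 1 p]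
      by (simp add: power2_eq_square)
    also have "\<dots> = (1/4) * (ip (w n) (w n) + 2 * ip (w n) (w p) + ip (w p) (w p))"
      by (subst ip_add_cmult_self[OF wF wF]) simp
    finally show ?thesis
      using w_less[of n] w_less[of p] by (simp add: ip_diff_self wF)
  qed
  have "\<exists>n0. \<forall>n\<ge>n0. \<forall>p\<ge>n0. form1_norm M E (\<lambda>x. w n x - w p x) < e" if "0 < e" for e
  proof -
    obtain n0 :: nat where n0: "4 / e\<^sup>2 < real n0" using reals_Archimedean2 by blast
    then have n0': "4 / real (Suc n0) < e\<^sup>2"
      using that add_strict_mono[of 4 "real n0 * e\<^sup>2" 0 "e\<^sup>2"] by (simp add: field_simps)
    have "form1_norm M E (\<lambda>x. w n x - w p x) < e" if "n0 \<le> n" "n0 \<le> p" for n p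
    proof -
      have "2 / real (Suc n) \<le> 2 / real (Suc n0)" "2 / real (Suc p) \<le> 2 / real (Suc n0)"
        using that by (auto intro!: divide_left_mono)
      with par[of n p] n0' have "ip (\<lambda>x. w n x - w p x) (\<lambda>x. w n x - w p x) < e\<^sup>2"
        by simp
      then show ?thesis unfolding form1_norm_def
        using \<open>0 < e\<close> by (metis abs_of_pos real_sqrt_abs real_sqrt_less_mono)
    qed
    then show ?thesis by blast
  qed
  then obtain h where hF: "h \<in> F" and h: "(\<lambda>n. form1_norm M E (\<lambda>x. w n x - h x)) \<longlonglongrightarrow> 0"
    using closed[unfolded closed_form_def, rule_format, of w] wF by blast
  define d where "d n = ip (\<lambda>x. h x - w n x) (\<lambda>x. h x - w n x)" for n
  have "(\<lambda>n. (form1_norm M E (\<lambda>x. w n x - h x))\<^sup>2) \<longlonglongrightarrow> 0\<^sup>2"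
    using h by (rule tendsto_power)
  moreover have "(form1_norm M E (\<lambda>x. w n x - h x))\<^sup>2 = d n" for n
    using ip_nonneg[OF F_diff[OF wF hF], of n]
    by (simp add: form1_norm_def d_def ip_diff_self wF hF ip_sym[OF hF wF])
  ultimately have d0: "d \<longlonglongrightarrow> 0" by simp
  have [measurable]: "h \<in> borel_measurable borel" "w n \<in> borel_measurable borel"
    "u0 \<in> borel_measurable borel" for n using hF wF u0 by (auto dest: F_meas)
  have "AE x in M. u0 x \<le> h x"
  proof -
    \<comment> \<open>The obstacle condition is closed: as \<open>u0 \<le> w n\<close> almost
      everywhere, the violation \<open>u0 - h\<close> is bounded by the distance of \<open>h\<close>
      to \<open>w n\<close>.\<close>
    have "sqn M (\<lambda>x. max 0 (u0 x - h x)) \<le> ennreal (d n)" for n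
    proof -
      have "AE x in M. u0 x \<le> w n x" using wC by (auto simp: C_def)
      then have "sqn M (\<lambda>x. max 0 (u0 x - h x)) \<le> sqn M (\<lambda>x. h x - w n x)"
        by (intro sqn_mono_AE) (auto elim!: eventually_mono)
      also have "\<dots> \<le> N (\<lambda>x. h x - w n x)" by (simp add: N_def)
      also have "\<dots> = ennreal (d n)" unfolding d_def by (rule N_eq_ip[OF F_diff[OF hF wF]])
      finally show ?thesis .
    qed
    then have "sqn M (\<lambda>x. max 0 (u0 x - h x)) \<le> ennreal 0"
      by (intro LIMSEQ_le_const[OF tendsto_ennrealI[OF d0]]) auto
    then have "AE x in M. max 0 (u0 x - h x) = 0"
      by (subst sqn_eq_0_iff[symmetric]) auto
    then show ?thesis by eventually_elim (auto simp: max_def split: if_splits)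
  qed
  moreover have "0 \<le> ip h v" if v: "v \<in> F" "AE x in M. 0 \<le> v x" for v
  proof -
    \<comment> \<open>First variation in the admissible direction \<open>v\<close>: adding
      \<open>t * v\<close> preserves the obstacle condition.\<close>
    have key: "- (2 * t * ip h v) \<le> 2 * t\<^sup>2 * ip v v" if t: "0 < t" for t
    proof -
      have "- (2 * t * ip h v) \<le> 1 / real (Suc n) + d n + 2 * t\<^sup>2 * ip v v" for n
      proof -
        have "AE x in M. u0 x \<le> w n x" using wC by (auto simp: C_def)
        with v(2) have "AE x in M. u0 x \<le> w n x + t * v x"
          by eventually_elim (use t in \<open>simp add: add_increasing2\<close>)
        then have "(\<lambda>x. w n x + t * v x) \<in> C"
          using wF v by (simp add: C_def F_add F_cmult)
        then have "I \<le> ip (w n) (w n) + 2 * t * ip (w n) v + t\<^sup>2 * ip v v"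
          using I_le by (simp add: ip_add_cmult_self[OF wF v(1), symmetric])
        \<comment> \<open>Non-negativity of the squared norm of \<open>h - w n + t * v\<close>
          replaces Cauchy-Schwarz when passing from \<open>w n\<close> to \<open>h\<close>; this is
          where the second \<open>ip v v\<close> term in \<open>key\<close> comes from.\<close>
        moreover have "0 \<le> d n + 2 * t * ip (\<lambda>x. h x - w n x) v + t\<^sup>2 * ip v v"
          unfolding d_def by (subst ip_add_cmult_self[symmetric])
            (auto intro!: ip_nonneg F_add F_cmult F_diff hF wF v)
        moreover have "ip (\<lambda>x. h x - w n x) v + ip (w n) v = ip h v"
          using ip_add[OF F_diff[OF hF wF] wF v(1), of n n] by simp
        then have "2 * t * ip (\<lambda>x. h x - w n x) v + 2 * t * ip (w n) v = 2 * t * ip h v"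
          by (metis distrib_left)
        ultimately show ?thesis using w_less[of n] by linarith
      qed
      moreover have "(\<lambda>n. 1 / real (Suc n) + d n + 2 * t\<^sup>2 * ip v v) \<longlonglongrightarrow> 0 + 0 + 2 * t\<^sup>2 * ip v v"
        by (intro tendsto_add d0 tendsto_const) (rule LIMSEQ_inverse_real_of_nat[unfolded inverse_eq_divide])
      ultimately show ?thesis by (intro LIMSEQ_le_const) auto
    qed
    show ?thesis
    proof (rule ccontr)
      assume neg: "\<not> 0 \<le> ip h v"
      \<comment> \<open>Chosen so that the quadratic term is at most half of the linear one; the
        summand 1 covers \<open>ip v v = 0\<close>.\<close>
      define t where "t = - ip h v / (2 * (ip v v + 1))"
      have vv: "0 \<le> ip v v" using v by (intro ip_nonneg)
      then have t: "0 < t" using neg unfolding t_def by (intro divide_pos_pos) auto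
      have "t * (- ip h v) \<le> t * (t * ip v v)" using key[OF t] by (simp add: power2_eq_square mult.assoc)
      then have "- ip h v \<le> t * ip v v" using t by (simp only: mult_le_cancel_left_pos)
      also have "\<dots> \<le> t * (ip v v + 1)" using t by simp
      also have "\<dots> = - ip h v / 2" using vv by (simp add: t_def field_simps)
      finally show False using neg by simp
    qed
  qed
  ultimately show ?thesis using hF by (auto simp: excessive_def)
qed

lemma positive_part_F:
  assumes "u \<in> F" shows "(\<lambda>x. max 0 (u x)) \<in> F"
proof (rule F_contraction[OF assms])
  show "(\<lambda>x. max 0 (u x)) \<in> borel_measurable borel" using F_meas[OF assms] by measurable
qed auto

text \<open>\<open>max 0 u\<close> and \<open>u - max 0 u\<close> are nondecreasing functions of
  \<open>u\<close>, so their increments never have opposite signs, while their pointwise product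
  vanishes. Hence their inner product is non-negative.\<close>

lemma ip_positive_part:
  assumes u: "u \<in> F"
  shows "ip (\<lambda>x. max 0 (u x)) (\<lambda>x. max 0 (u x)) \<le> ip u (\<lambda>x. max 0 (u x))"
proof -
  let ?p = "\<lambda>x. max 0 (u x)" and ?n = "\<lambda>x. u x - max 0 (u x)"
  note p = positive_part_F[OF u]
  note n = F_diff[OF u p]
  have "L2_inner M ?n ?p = 0"
  proof -
    have "?n x * ?p x = 0" for x by (auto simp: max_def)
    then show ?thesis unfolding L2_inner_def by (simp only: Bochner_Integration.integral_zero)
  qed
  moreover have "0 \<le> L2_inner J (incr ?n) (incr ?p)"
  proof -
    have "0 \<le> ((a - max 0 a) - (b - max 0 b)) * (max 0 a - max 0 b)" for a b :: real
      by (auto simp: max_def mult_nonneg_nonneg mult_nonpos_nonpos zero_le_mult_iff)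
    then show ?thesis unfolding L2_inner_def incr_def by (intro Bochner_Integration.integral_nonneg) simp
  qed
  ultimately have "0 \<le> ip ?n ?p" by (simp add: form1_eq F_meas n p)
  also have "ip ?n ?p = ip u ?p - ip ?p ?p"
    using ip_add[OF n p p] by simp
  finally show ?thesis by simp
qed

text \<open>Testing with the excess \<open>w\<close> itself, excessiveness discards the term with
  \<open>h\<close> and leaves \<open>ip w w \<le> ip u w\<close>. Expanding the square of
  \<open>u - w\<close>, which is \<open>min u (c * h)\<close>, then gives a Pythagorean
  inequality.\<close>

lemma ip_excess_le:
  assumes u: "u \<in> F" and h: "excessive h" and c: "0 \<le> c"
  defines "w \<equiv> \<lambda>x. max 0 (u x - c * h x)"
  shows "w \<in> F" "ip w w + ip (\<lambda>x. u x - w x) (\<lambda>x. u x - w x) \<le> ip u u"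
proof -
  have hF: "h \<in> F" using h by (simp add: excessive_def)
  have uh: "(\<lambda>x. u x - c * h x) \<in> F" by (intro F_diff u F_cmult hF)
  show w: "w \<in> F" unfolding w_def by (rule positive_part_F[OF uh])
  have "0 \<le> ip h w" using h w by (auto simp: excessive_def w_def)
  then have "0 \<le> c * ip h w" using c by simp
  moreover have "ip w w \<le> ip (\<lambda>x. u x - c * h x) w"
    using ip_positive_part[OF uh] by (simp add: w_def)
  moreover have "ip (\<lambda>x. u x - c * h x) w = ip u w - c * ip h w"
    using ip_add[OF u F_cmult[OF hF, of "-c"] w] ip_cmult[OF hF w, of "-c"] by simp
  ultimately have "ip w w \<le> ip u w" by simp
  then show "ip w w + ip (\<lambda>x. u x - w x) (\<lambda>x. u x - w x) \<le> ip u u"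
    by (simp add: ip_diff_self u w)
qed

text \<open>Strong convergence comes for free here: the excess over \<open>n * h\<close> has energy at most
  the energy lost by truncating \<open>u\<close> at \<open>n * h\<close>, and energy is lower semicontinuous.\<close>

lemma N_excess_tendsto_0:
  assumes u: "u \<in> F" and h: "excessive h" and pos: "AE x in M. 0 < h x"
  shows "(\<lambda>n. N (\<lambda>x. max 0 (u x - real n * h x))) \<longlonglongrightarrow> 0"
proof -
  define w where "w n x = max 0 (u x - real n * h x)" for n x
  have wF: "w n \<in> F" for n unfolding w_def by (rule ip_excess_le[OF u h]) simp
  have le: "ip (w n) (w n) + ip (\<lambda>x. u x - w n x) (\<lambda>x. u x - w n x) \<le> ip u u" for n
    unfolding w_def by (rule ip_excess_le[OF u h]) simp
  have [measurable]: "u \<in> borel_measurable borel" "w n \<in> borel_measurable borel" for n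
    using u wF by (auto dest: F_meas)
  have "AE x in M. (\<lambda>n. u x - w n x) \<longlonglongrightarrow> u x"
    using pos
  proof eventually_elim
    case (elim x)
    obtain n0 :: nat where n0: "u x / h x < real n0" using reals_Archimedean2 by blast
    have "u x - w n x = u x" if "n0 \<le> n" for n
    proof -
      have "u x < real n0 * h x" using n0 elim by (simp add: field_simps)
      also have "\<dots> \<le> real n * h x" using elim that by simp
      finally show ?thesis by (simp add: w_def)
    qed
    then show ?case by (intro tendsto_eventually) (auto simp: eventually_sequentially)
  qed
  then have fatou: "N u \<le> liminf (\<lambda>n. N (\<lambda>x. u x - w n x))" by (intro N_fatou) auto
  have "(\<lambda>n. ip (w n) (w n)) \<longlonglongrightarrow> 0"
  proof (rule LIMSEQ_I)
    fix e :: real assume e: "0 < e"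
    show "\<exists>n0. \<forall>n\<ge>n0. norm (ip (w n) (w n) - 0) < e"
    \<comment> \<open>The case split keeps \<open>ip u u - e\<close> non-negative, so that
      \<open>ennreal\<close> does not truncate it to 0.\<close>
    proof (cases "ip u u < e")
      case True
      have "norm (ip (w n) (w n) - 0) < e" for n
        using le[of n] True ip_nonneg[OF wF[of n]] ip_nonneg[OF F_diff[OF u wF[of n]]] by simp
      then show ?thesis by blast
    next
      case False
      then have "ennreal (ip u u - e) < N u" using e by (simp add: N_eq_ip[OF u] ennreal_less_iff)
      then have "\<forall>\<^sub>F n in sequentially. ennreal (ip u u - e) < N (\<lambda>x. u x - w n x)"
        using fatou unfolding le_Liminf_iff by blast
      then have "\<forall>\<^sub>F n in sequentially. norm (ip (w n) (w n) - 0) < e"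
      proof eventually_elim
        case (elim n)
        then have "ip u u - e < ip (\<lambda>x. u x - w n x) (\<lambda>x. u x - w n x)"
          using False by (simp add: N_eq_ip F_diff u wF ennreal_less_iff)
        then show ?case using le[of n] ip_nonneg[OF wF[of n]] by simp
      qed
      then show ?thesis by (simp add: eventually_sequentially)
    qed
  qed
  then have "(\<lambda>n. ennreal (ip (w n) (w n))) \<longlonglongrightarrow> ennreal 0" by (rule tendsto_ennrealI)
  then have "(\<lambda>n. N (w n)) \<longlonglongrightarrow> 0" by (simp add: N_eq_ip wF)
  then show ?thesis unfolding w_def .
qed

end

section \<open>Nests and quasi-continuity\<close>

text \<open>Soft thresholding by \<open>1 / real (Suc n)\<close>, then clamping at \<open>n\<close>.
  Thresholding kills values dominated by a small multiple of \<open>h\<close>, clamping provides the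
  bound needed for products, and subtracting the threshold rather than cutting off keeps the map a
  contraction.\<close>

definition soft_clamp :: "nat \<Rightarrow> real \<Rightarrow> real" where
  "soft_clamp n t = max (- real n) (min (real n) (max 0 (t - 1 / real (Suc n)) + min 0 (t + 1 / real (Suc n))))"

lemma soft_clamp_measurable[measurable]: "soft_clamp n \<in> borel_measurable borel"
  unfolding soft_clamp_def by measurable

lemma soft_clamp_0[simp]: "soft_clamp n 0 = 0"
  by (simp add: soft_clamp_def)

lemma soft_clamp_small: "\<bar>t\<bar> \<le> 1 / real (Suc n) \<Longrightarrow> soft_clamp n t = 0"
  unfolding soft_clamp_def by (auto simp: min_def max_def)

lemma soft_clamp_bounded: "\<bar>soft_clamp n t\<bar> \<le> real n"
  unfolding soft_clamp_def by (auto simp: min_def max_def)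

lemma soft_clamp_contraction: "\<bar>soft_clamp n s - soft_clamp n t\<bar> \<le> \<bar>s - t\<bar>"
proof -
  have clamp: "\<bar>max (- c) (min c a) - max (- c) (min c b)\<bar> \<le> \<bar>a - b\<bar>" for a b c :: real
    by (auto simp: min_def max_def)
  have soft: "\<bar>(max 0 (s - d) + min 0 (s + d)) - (max 0 (t - d) + min 0 (t + d))\<bar> \<le> \<bar>s - t\<bar>"
    if "0 \<le> d" for d :: real
    using that by (auto simp: min_def max_def abs_if)
  show ?thesis
    unfolding soft_clamp_def by (rule order_trans[OF clamp soft]) simp
qed

lemma soft_clamp_tendsto: "(\<lambda>n. soft_clamp n t) \<longlonglongrightarrow> t"
proof -
  let ?s = "\<lambda>n. max 0 (t - 1 / real (Suc n)) + min 0 (t + 1 / real (Suc n))"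
  have d: "(\<lambda>n. 1 / real (Suc n)) \<longlonglongrightarrow> 0"
    by (rule LIMSEQ_inverse_real_of_nat[unfolded inverse_eq_divide])
  have "?s \<longlonglongrightarrow> max 0 (t - 0) + min 0 (t + 0)"
    by (intro tendsto_add tendsto_max tendsto_min tendsto_diff d tendsto_const)
  then have s: "?s \<longlonglongrightarrow> t" by (simp add: max_def min_def split: if_splits)
  obtain n0 :: nat where n0: "\<bar>t\<bar> \<le> real n0" using real_arch_simple by blast
  have "soft_clamp n t = ?s n" if "n0 \<le> n" for n
  proof -
    have "\<bar>max 0 (t - d) + min 0 (t + d)\<bar> \<le> \<bar>t\<bar>" if "0 \<le> d" for d :: real
      using that by (auto simp: min_def max_def abs_if)
    then have "\<bar>?s n\<bar> \<le> \<bar>t\<bar>" by simp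
    then have "\<bar>?s n\<bar> \<le> real n" using n0 that by linarith
    then show ?thesis unfolding soft_clamp_def by linarith
  qed
  then have "\<forall>\<^sub>F n in sequentially. ?s n = soft_clamp n t"
    by (intro eventually_sequentiallyI[of n0]) (simp del: of_nat_Suc)
  with s show ?thesis by (rule Lim_transform_eventually)
qed

context jump_form
begin

text \<open>Larger closed sets carry larger spaces \<open>domain_on\<close>, so density is
  inherited. This allows a nest to be built from smaller sets than those on which continuity is
  wanted.\<close>

lemma nest_mono:
  assumes P: "nest M E F P" and sub: "\<And>k. P k \<subseteq> K k"
    and K: "\<And>k. Topological_Spaces.closed (K k)" "incseq K"
  shows "nest M E F K"
proof -
  have "domain_on M F (P k) \<subseteq> domain_on M F (K k)" for k
    using sub[of k] by (auto simp: domain_on_def elim!: eventually_mono)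
  then have "(\<Union>k. domain_on M F (P k)) \<subseteq> (\<Union>k. domain_on M F (K k))" by blast
  moreover have "(\<Union>k. domain_on M F (K k)) \<subseteq> F" by (auto simp: domain_on_def)
  moreover have "form_dense M E F (\<Union>k. domain_on M F (P k))"
    using P by (simp add: nest_def)
  ultimately have "form_dense M E F (\<Union>k. domain_on M F (K k))"
    unfolding form_dense_def by (meson subsetD)
  then show ?thesis using K by (simp add: nest_def)
qed

text \<open>Four approximations: truncate \<open>u\<close> above at \<open>n1 * h\<close> and below
  at \<open>- n2 * h\<close>, apply \<open>soft_clamp m\<close>, multiply by \<open>1 - g k\<close>.
  The result vanishes off \<open>K k\<close> because of the last factor, and where \<open>h\<close>
  is small because it was dominated by \<open>c * h\<close> before the clamp.\<close>

lemma nest_superlevel: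
  assumes h: "excessive h" and pos: "AE x in M. 0 < h x"
    and hv: "hv \<in> borel_measurable borel" "AE x in M. hv x = h x"
    and g: "vanishing_cutoffs g K" and cont: "\<And>k. continuous_on (K k) hv"
  shows "nest M E F (\<lambda>k. K k \<inter> {x. 1 / real (Suc k) \<le> hv x})"
proof -
  define P where "P k = K k \<inter> {x. 1 / real (Suc k) \<le> hv x}" for k
  note v = g[unfolded vanishing_cutoffs_def]
  have "Topological_Spaces.closed (P k)" for k
  proof -
    have "Topological_Spaces.closed (K k \<inter> hv -` {1 / real (Suc k)..})"
      by (rule continuous_closed_preimage) (use v cont in auto)
    then show ?thesis by (simp add: P_def vimage_def)
  qed
  moreover have "incseq P"
  proof (rule incseq_SucI, safe)
    fix k x assume "x \<in> P k"
    moreover have "K k \<subseteq> K (Suc k)" using v by (simp add: incseq_SucD)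
    moreover have "1 / real (Suc (Suc k)) \<le> 1 / real (Suc k)" by (simp add: frac_le)
    ultimately show "x \<in> P (Suc k)" unfolding P_def by fastforce
  qed
  moreover have "form_dense M E F (\<Union>k. domain_on M F (P k))"
  proof (rule form_denseI)
    show "(\<Union>k. domain_on M F (P k)) \<subseteq> F" by (auto simp: domain_on_def)
    fix u and e :: real assume u: "u \<in> F" and e: "0 < e"
    have hF: "h \<in> F" using h by (simp add: excessive_def)
    have [measurable]: "u \<in> borel_measurable borel" "h \<in> borel_measurable borel"
      using u hF by (auto dest: F_meas)
    have "\<forall>\<^sub>F n in sequentially. N (\<lambda>x. max 0 (u x - real n * h x)) < ennreal (e/4)"
      by (rule N_tendsto_0_D[OF N_excess_tendsto_0[OF u h pos]]) (use e in simp)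
    then obtain n1 :: nat where n1: "N (\<lambda>x. max 0 (u x - real n1 * h x)) < ennreal (e/4)"
      by (auto simp: eventually_sequentially)
    define u1 where "u1 x = u x - max 0 (u x - real n1 * h x)" for x
    have u1: "u1 \<in> F" unfolding u1_def by (intro F_diff u ip_excess_le(1)[OF u h]) simp
    have e1: "N (\<lambda>x. u x - u1 x) < ennreal (e/4)" using n1 by (simp add: u1_def)
    \<comment> \<open>Truncation by an excessive element is one-sided; the lower bound comes from
      applying it to \<open>- u1\<close>.\<close>
    have "\<forall>\<^sub>F n in sequentially. N (\<lambda>x. max 0 (- u1 x - real n * h x)) < ennreal (e/4/4)"
      by (rule N_tendsto_0_D[OF N_excess_tendsto_0[OF F_minus[OF u1] h pos]]) (use e in simp)
    then obtain n2 :: nat where n2: "N (\<lambda>x. max 0 (- u1 x - real n2 * h x)) < ennreal (e/4/4)"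
      by (auto simp: eventually_sequentially)
    define u2 where "u2 x = u1 x + max 0 (- u1 x - real n2 * h x)" for x
    have u2: "u2 \<in> F" unfolding u2_def
      by (intro F_add u1 ip_excess_le(1)[OF F_minus[OF u1] h]) simp
    have e2: "N (\<lambda>x. u1 x - u2 x) < ennreal (e/4/4)"
      using n2 by (simp add: u2_def N_minus)
    define c where "c = max n1 n2"
    have u2_le: "AE x in M. \<bar>u2 x\<bar> \<le> real c * h x"
      using pos
    proof eventually_elim
      case (elim x)
      have "real n1 * h x \<le> real c * h x" "real n2 * h x \<le> real c * h x" "0 \<le> real c * h x" "0 \<le> real n2 * h x"
        using elim by (auto simp: c_def)
      moreover have "u1 x \<le> real n1 * h x" unfolding u1_def by linarith
      ultimately show ?case unfolding u2_def by (auto simp: max_def abs_if)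
    qed
    have "\<forall>\<^sub>F m in sequentially. N (\<lambda>x. u2 x - soft_clamp m (u2 x)) < ennreal (e/4/4/4)"
      by (rule N_tendsto_0_D[OF N_contraction_tendsto_0[OF u2]])
        (use e in \<open>auto intro: soft_clamp_contraction soft_clamp_tendsto\<close>)
    then obtain m where e3: "N (\<lambda>x. u2 x - soft_clamp m (u2 x)) < ennreal (e/4/4/4)"
      by (auto simp: eventually_sequentially)
    define u3 where "u3 x = soft_clamp m (u2 x)" for x
    have [measurable]: "u1 \<in> borel_measurable borel" "u2 \<in> borel_measurable borel"
      "u3 \<in> borel_measurable borel" using u1 u2 unfolding u3_def by (auto dest: F_meas)
    have u3: "u3 \<in> F"
    proof (rule F_contraction[OF u2])
      show "\<bar>u3 x\<bar> \<le> \<bar>u2 x\<bar>" for x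
        using soft_clamp_contraction[of m "u2 x" 0] by (simp add: u3_def)
      show "\<bar>u3 x - u3 y\<bar> \<le> \<bar>u2 x - u2 y\<bar>" for x y
        unfolding u3_def by (rule soft_clamp_contraction)
    qed simp
    have u3_bdd: "\<bar>u3 x\<bar> \<le> real m" for x unfolding u3_def by (rule soft_clamp_bounded)
    have gm[measurable]: "g k \<in> borel_measurable borel" and g1: "\<bar>g k x\<bar> \<le> 1" for k x using v by auto
    have "\<forall>\<^sub>F k in sequentially. N (\<lambda>x. u3 x * g k x) < ennreal (e/4/4/4)"
      by (rule N_tendsto_0_D[OF N_mult_tendsto_0[OF u3 u3_bdd gm g1]]) (use e v in auto)
    then obtain k0 where k0: "\<And>k. k0 \<le> k \<Longrightarrow> N (\<lambda>x. u3 x * g k x) < ennreal (e/4/4/4)"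
      by (auto simp: eventually_sequentially)
    \<comment> \<open>From \<open>\<bar>u2 x\<bar> \<le> c * h x\<close> and
      \<open>h x \<le> 1 / Suc k\<close> the bound \<open>1 / Suc m\<close>, the dead zone of
      \<open>soft_clamp m\<close>, has to follow; this needs
      \<open>c * Suc m \<le> Suc k\<close>.\<close>
    define k where "k = max k0 (c * Suc m)"
    define u4 where "u4 x = u3 x - u3 x * g k x" for x
    have u4: "u4 \<in> F" unfolding u4_def
      by (intro F_diff u3 F_mult[OF u3 u3_bdd gm g1]) (use v in simp)
    have e4: "N (\<lambda>x. u3 x - u4 x) < ennreal (e/4/4/4)" using k0[of k] by (simp add: u4_def k_def)
    have [measurable]: "u4 \<in> borel_measurable borel" using u4 by (auto dest: F_meas)
    have "AE x in M. x \<notin> P k \<longrightarrow> u4 x = 0"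
      using u2_le hv(2)
    proof eventually_elim
      case (elim x)
      show ?case
      proof (cases "x \<in> K k")
        case False
        then show ?thesis using v by (simp add: u4_def)
      next
        case True
        show ?thesis
        proof
          assume "x \<notin> P k"
          then have "h x \<le> 1 / real (Suc k)" using True elim(2) by (auto simp: P_def)
          then have "real c * h x \<le> real c * (1 / real (Suc k))" by (intro mult_left_mono) auto
          also have "\<dots> \<le> 1 / real (Suc m)"
          proof -
            have "c * Suc m \<le> Suc k" unfolding k_def by linarith
            then have "real c * real (Suc m) \<le> real (Suc k)" by (metis of_nat_mult of_nat_le_iff)
            then show ?thesis by (simp add: field_simps)
          qed
          finally have "\<bar>u2 x\<bar> \<le> 1 / real (Suc m)" using elim(1) by simp
          then have "u3 x = 0" unfolding u3_def by (rule soft_clamp_small)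
          then show "u4 x = 0" by (simp add: u4_def)
        qed
      qed
    qed
    then have "u4 \<in> domain_on M F (P k)" using u4 by (simp add: domain_on_def)
    moreover have "N (\<lambda>x. u x - u4 x) < ennreal e"
    proof -
      have "N (\<lambda>x. u2 x - u4 x) < ennreal (e/4/4)"
        by (rule N_diff_trans[of u2 u3]) (use e3 e4 in \<open>simp_all add: u3_def\<close>)
      from N_diff_trans[OF _ _ _ e2 this] have "N (\<lambda>x. u1 x - u4 x) < ennreal (e/4)" by simp
      from N_diff_trans[OF _ _ _ e1 this] show ?thesis by simp
    qed
    ultimately show "\<exists>v\<in>\<Union>k. domain_on M F (P k). N (\<lambda>x. u x - v x) < ennreal e" by blast
  qed
  ultimately have "nest M E F P" by (simp add: nest_def)
  then show ?thesis unfolding P_def .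
qed

end

text \<open>The measure \<open>R\<close> only serves to control almost everywhere convergence of the continuous
  approximants, which need not be square integrable with respect to \<open>M\<close>.\<close>

locale approximable_jump_form = jump_form M J E F
  for M :: "'a::euclidean_space measure" and J :: "('a \<times> 'a) measure" and E :: "'a form"
    and F :: "('a \<Rightarrow> real) set" +
  fixes R :: "'a measure" and u0 :: "'a \<Rightarrow> real"
  assumes sets_R[measurable_cong]: "sets R = sets borel"
    and AE_R: "\<And>P. (AE x in R. P x) \<Longrightarrow> (AE x in M. P x)"
    and approx: "\<And>u e. u \<in> F \<Longrightarrow> 0 < e \<Longrightarrow> \<exists>v. continuous_on UNIV v \<and>
      sqn J (incr (\<lambda>x. u x - v x)) < ennreal e \<and> sqn R (\<lambda>x. u x - v x) < ennreal e"
    and J_min: "sqn J (\<lambda>p. min 1 (dist (fst p) (snd p))) < \<infinity>"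
    and u0: "u0 \<in> F" "AE x in M. 0 < u0 x"
begin

lemma incr_finite_if_lipschitz:
  assumes "\<And>x y. \<bar>f x - f y\<bar> \<le> min 1 (dist x y)"
  shows "sqn J (incr f) < \<infinity>"
proof (rule le_less_trans[OF sqn_mono J_min])
  show "\<bar>incr f p\<bar> \<le> \<bar>min 1 (dist (fst p) (snd p))\<bar>" for p
    using assms[of "fst p" "snd p"] by (simp add: incr_def)
qed

text \<open>Supplies the bounded part of a compact nest. The increments are at most
  \<open>min 1 (dist x y)\<close>, so \<open>J_min\<close> is an integrable majorant for the decay
  of the energies.\<close>

lemma vanishing_cutoffs_cball:
  "vanishing_cutoffs (\<lambda>n x. min 1 (norm x / real (Suc n))) (\<lambda>n. cball 0 (real (Suc n)))"
proof -
  define g where "g n x = min 1 (norm x / real (Suc n))" for n and x :: 'a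
  have [measurable]: "g n \<in> borel_measurable borel" for n unfolding g_def by measurable
  have lip: "\<bar>g n x - g n y\<bar> \<le> min 1 (dist x y)" for n x y
  proof -
    have "\<bar>norm x / real (Suc n) - norm y / real (Suc n)\<bar> = \<bar>norm x - norm y\<bar> / real (Suc n)"
      by (simp add: diff_divide_distrib[symmetric])
    also have "\<dots> \<le> \<bar>norm x - norm y\<bar> / 1" by (intro divide_left_mono) auto
    also have "\<dots> \<le> dist x y" by (simp add: dist_norm norm_triangle_ineq3)
    finally have "\<bar>norm x / real (Suc n) - norm y / real (Suc n)\<bar> \<le> dist x y" .
    moreover have "\<bar>min 1 a - min 1 b\<bar> \<le> min 1 \<bar>a - b\<bar>" if "0 \<le> a" "0 \<le> b" for a b :: real
      using that by (auto simp: min_def abs_if)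
    then have "\<bar>g n x - g n y\<bar> \<le> min 1 \<bar>norm x / real (Suc n) - norm y / real (Suc n)\<bar>"
      unfolding g_def by simp
    ultimately show ?thesis by linarith
  qed
  have g0: "(\<lambda>n. g n x) \<longlonglongrightarrow> 0" for x
  proof -
    have "(\<lambda>n. norm x * inverse (real (Suc n))) \<longlonglongrightarrow> norm x * 0"
      by (intro tendsto_mult tendsto_const LIMSEQ_inverse_real_of_nat)
    then have "(\<lambda>n. min 1 (norm x * inverse (real (Suc n)))) \<longlonglongrightarrow> min 1 (norm x * 0)"
      by (intro tendsto_min tendsto_const)
    then show ?thesis by (simp add: g_def divide_inverse)
  qed
  have g_range: "0 \<le> g n x" "g n x \<le> 1" for n x by (auto simp: g_def)
  have g_out: "g n x = 1" if "x \<notin> cball 0 (real (Suc n))" for n x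
    using that by (auto simp: g_def min_def field_simps)
  have "(\<lambda>n. sqn J (incr (g n))) \<longlonglongrightarrow> 0"
  proof (rule sqn_dominated[OF _ _ _ J_min])
    show "AE p in J. \<bar>incr (g n) p\<bar> \<le> \<bar>min 1 (dist (fst p) (snd p))\<bar>" for n
      using lip by (simp add: incr_def)
    show "AE p in J. (\<lambda>n. incr (g n) p) \<longlonglongrightarrow> 0"
      using tendsto_diff[OF g0 g0] by (simp add: incr_def)
  qed measurable
  moreover have "incseq (\<lambda>n. cball (0::'a) (real (Suc n)))"
    by (rule incseq_SucI) auto
  ultimately have "vanishing_cutoffs g (\<lambda>n. cball 0 (real (Suc n)))"
    unfolding vanishing_cutoffs_def
    using g0 incr_finite_if_lipschitz[OF lip] g_range g_out by auto
  then show ?thesis unfolding g_def .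
qed

lemma ex_continuous_version:
  assumes u: "u \<in> F"
  shows "\<exists>w g K. w \<in> borel_measurable borel \<and> (AE x in M. w x = u x) \<and>
    vanishing_cutoffs g K \<and> (\<forall>k. continuous_on (K k) w)"
proof -
  have [measurable]: "u \<in> borel_measurable borel" using u by (rule F_meas)
  \<comment> \<open>The rate \<open>(1/16) ^ n\<close> survives the scaling of differences by
    \<open>2 ^ n\<close> as a summable bound.\<close>
  have "\<forall>n. \<exists>v. continuous_on UNIV v \<and> sqn J (incr (\<lambda>x. u x - v x)) < ennreal ((1/16) ^ n) \<and>
      sqn R (\<lambda>x. u x - v x) < ennreal ((1/16) ^ n)"
    using approx[OF u] by simp
  then obtain v where v: "\<And>n. continuous_on UNIV (v n)"
    and vJ: "\<And>n. sqn J (incr (\<lambda>x. u x - v n x)) < ennreal ((1/16) ^ n)"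
    and vR: "\<And>n. sqn R (\<lambda>x. u x - v n x) < ennreal ((1/16) ^ n)" by metis
  have [measurable]: "v n \<in> borel_measurable borel" for n
    using v by (rule borel_measurable_continuous_onI)
  \<comment> \<open>With this scaling, \<open>\<bar>a n x\<bar> \<le> 1\<close> on a closed set
    means that consecutive approximants differ there by at most \<open>(1/2) ^ n\<close>, hence
    uniform convergence.\<close>
  define a where "a n x = 2 ^ n * (v (Suc n) x - v n x)" for n x
  \<comment> \<open>Stated for an arbitrary measure because it is applied to values under
    \<open>R\<close> and to increments under \<open>J\<close>. The 4 comes from the two error terms,
    each carrying a factor 2.\<close>
  have geom: "sqn S (\<lambda>x. 2 ^ n * (f x - g x)) \<le> ennreal (4 * (1/4) ^ n)"
    if [measurable]: "f \<in> borel_measurable S" "g \<in> borel_measurable S"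
      and f: "sqn S f < ennreal ((1/16) ^ n)" and g: "sqn S g < ennreal ((1/16) ^ Suc n)"
    for S :: "'b measure" and f g n
  proof (rule sqn_scaled_power)
    have "sqn S (\<lambda>x. f x - g x) \<le> 2 * sqn S f + 2 * sqn S g" by (rule sqn_diff) auto
    also have "\<dots> \<le> 2 * ennreal ((1/16) ^ n) + 2 * ennreal ((1/16) ^ n)"
    proof (intro add_mono mult_left_mono)
      have "(1/16) ^ Suc n \<le> ((1/16) ^ n :: real)" by simp
      then show "sqn S g \<le> ennreal ((1/16) ^ n)"
        using g by (meson ennreal_leI less_imp_le order_trans)
    qed (use f in auto)
    also have "\<dots> = ennreal (2 * (1/16) ^ n + 2 * (1/16) ^ n)"
      by (subst ennreal_plus) (auto simp: ennreal_mult)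
    finally show "sqn S (\<lambda>x. f x - g x) \<le> ennreal (4 * (1/16) ^ n)" by simp
  qed auto
  have sumR: "(\<Sum>n. sqn R (a n)) < \<infinity>"
  proof (rule le_less_trans)
    have "sqn R (a n) \<le> ennreal (4 * (1/4) ^ n)" for n
      using geom[OF _ _ vR[of n] vR[of "Suc n"]] by (simp add: a_def[abs_def])
    then show "(\<Sum>n. sqn R (a n)) \<le> (\<Sum>n. ennreal (4 * (1/4) ^ n))" by (intro suminf_le) auto
  qed (rule suminf_geometric_quarter_finite, simp)
  have sumJ: "(\<Sum>n. sqn J (incr (a n))) < \<infinity>"
  proof (rule le_less_trans)
    \<comment> \<open>A difference of approximants is a difference of errors: the contributions of
      \<open>u\<close> cancel.\<close>
    have "incr (a n) = (\<lambda>p. 2 ^ n * (incr (\<lambda>x. u x - v n x) p - incr (\<lambda>x. u x - v (Suc n) x) p))" for n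
      by (auto simp: incr_def a_def algebra_simps)
    then have "sqn J (incr (a n)) \<le> ennreal (4 * (1/4) ^ n)" for n
      using geom[OF _ _ vJ[of n] vJ[of "Suc n"]] by simp
    then show "(\<Sum>n. sqn J (incr (a n))) \<le> (\<Sum>n. ennreal (4 * (1/4) ^ n))" by (intro suminf_le) auto
  qed (rule suminf_geometric_quarter_finite, simp)
  have a_cont: "continuous_on UNIV (a n)" for n
    unfolding a_def by (intro continuous_intros v)
  have "AE x in R. (\<lambda>n. a n x) \<longlonglongrightarrow> 0"
    by (rule sqn_suminf_imp_AE_tendsto_0[OF _ sumR]) (simp add: a_def[abs_def])
  then have "AE x in M. (\<lambda>n. a n x) \<longlonglongrightarrow> 0" by (rule AE_R)
  then obtain g where g: "vanishing_cutoffs g (\<lambda>k. {x. \<forall>n. \<bar>a (n + k) x\<bar> \<le> 1})"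
    using vanishing_cutoffs_continuous[OF a_cont sumJ] by blast
  \<comment> \<open>\<open>lim\<close> fixes a Borel function everywhere; its value matters only
    where the sequence converges, which includes every set of the nest.\<close>
  define w where "w x = lim (\<lambda>n. v n x)" for x
  have [measurable]: "w \<in> borel_measurable borel" unfolding w_def by measurable
  have "AE x in R. (\<lambda>n. u x - v n x) \<longlonglongrightarrow> 0"
  proof (rule sqn_suminf_imp_AE_tendsto_0)
    have "(\<Sum>n. sqn R (\<lambda>x. u x - v n x)) \<le> (\<Sum>n. ennreal (1 * (1/4) ^ n))"
    proof (intro suminf_le)
      fix n
      have "(1/16) ^ n \<le> ((1/4) ^ n :: real)" by (intro power_mono) auto
      then show "sqn R (\<lambda>x. u x - v n x) \<le> ennreal (1 * (1/4) ^ n)"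
        using vR[of n] by (simp add: order.strict_implies_order order_less_le_trans)
    qed auto
    also have "\<dots> < \<infinity>" by (rule suminf_geometric_quarter_finite) simp
    finally show "(\<Sum>n. sqn R (\<lambda>x. u x - v n x)) < \<infinity>" .
  qed simp
  then have "AE x in M. (\<lambda>n. u x - v n x) \<longlonglongrightarrow> 0" by (rule AE_R)
  then have "AE x in M. w x = u x"
  proof eventually_elim
    case (elim x)
    then have "(\<lambda>n. u x - (u x - v n x)) \<longlonglongrightarrow> u x - 0" by (intro tendsto_diff tendsto_const)
    then show ?case unfolding w_def by (intro limI) simp
  qed
  moreover have "continuous_on {x. \<forall>n. \<bar>a (n + k) x\<bar> \<le> 1} w" (is "continuous_on ?K w") for k
  proof -
    \<comment> \<open>On the \<open>k\<close>-th set only the differences from index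
      \<open>k\<close> on are controlled, so the Weierstrass test is applied to the series starting
      from \<open>v k\<close>.\<close>
    define d where "d n x = v (Suc n + k) x - v (n + k) x" for n x
    have d_le: "norm (d n x) \<le> (1/2) ^ n" if "x \<in> ?K" for n x
    proof -
      have "2 ^ (n + k) * \<bar>d n x\<bar> \<le> 1" using that by (simp add: a_def d_def abs_mult)
      then have "\<bar>d n x\<bar> \<le> (1/2) ^ (n + k)" by (simp add: power_one_over pos_le_divide_eq mult.commute)
      also have "\<dots> \<le> (1/2) ^ n" by (rule power_decreasing) auto
      finally show ?thesis by simp
    qed
    have "uniform_limit ?K (\<lambda>n x. \<Sum>i<n. d i x) (\<lambda>x. suminf (\<lambda>i. d i x)) sequentially"
      by (rule Weierstrass_m_test[OF d_le]) (auto intro: summable_geometric)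
    then have "continuous_on ?K (\<lambda>x. suminf (\<lambda>i. d i x))"
    proof (rule uniform_limit_theorem[rotated])
      show "\<forall>\<^sub>F n in sequentially. continuous_on ?K (\<lambda>x. \<Sum>i<n. d i x)"
        unfolding d_def
        by (intro always_eventually allI continuous_intros continuous_on_subset[OF v]) auto
    qed simp
    then have c: "continuous_on ?K (\<lambda>x. v k x + suminf (\<lambda>i. d i x))"
      by (intro continuous_intros continuous_on_subset[OF v]) auto
    have w_eq: "w x = v k x + suminf (\<lambda>i. d i x)" if "x \<in> ?K" for x
    proof -
      have "summable (\<lambda>i. d i x)"
        by (rule summable_comparison_test'[where g="\<lambda>n. (1/2) ^ n" and N=0])
          (use d_le[OF that] in \<open>auto intro: summable_geometric\<close>)
      then have "(\<lambda>n. \<Sum>i<n. d i x) \<longlonglongrightarrow> suminf (\<lambda>i. d i x)" by (rule summable_LIMSEQ)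
      moreover have "(\<Sum>i<n. d i x) = v (n + k) x - v k x" for n
        using sum_lessThan_telescope[of "\<lambda>i. v (i + k) x" n] by (simp add: d_def)
      ultimately have "(\<lambda>n. v k x + (v (n + k) x - v k x)) \<longlonglongrightarrow> v k x + suminf (\<lambda>i. d i x)"
        by (intro tendsto_add tendsto_const) simp
      then have "(\<lambda>n. v n x) \<longlonglongrightarrow> v k x + suminf (\<lambda>i. d i x)"
        by (simp add: LIMSEQ_offset)
      then show ?thesis unfolding w_def by (rule limI)
    qed
    show ?thesis by (rule continuous_on_eq[OF c]) (rule w_eq[symmetric])
  qed
  ultimately show ?thesis using g by (intro exI[of _ w]) auto
qed

lemma quasi_regular: "quasi_regular M E F"
proof -
  obtain h where h: "excessive h" and "AE x in M. u0 x \<le> h x"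
    using ex_excessive_ge[OF u0(1)] by blast
  from this(2) u0(2) have pos: "AE x in M. 0 < h x" by eventually_elim simp
  have hF: "h \<in> F" using h by (simp add: excessive_def)
  obtain w g K where w[measurable]: "w \<in> borel_measurable borel" and wh: "AE x in M. w x = h x"
    and g: "vanishing_cutoffs g K" and w_cont: "\<And>k. continuous_on (K k) w"
    using ex_continuous_version[OF hF] by blast
  define P where "P k = (K k \<inter> cball 0 (real (Suc k))) \<inter> {x. 1 / real (Suc k) \<le> w x}" for k
  have nestP: "nest M E F P"
    unfolding P_def
    by (rule nest_superlevel[OF h pos w wh vanishing_cutoffs_max[OF g vanishing_cutoffs_cball]])
      (auto intro: continuous_on_subset[OF w_cont])
  have "compact (P k)" for k
  proof -
    have "Topological_Spaces.closed (P k)" using nestP by (simp add: nest_def)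
    moreover have "bounded (P k)" by (rule bounded_subset[OF bounded_cball]) (auto simp: P_def)
    ultimately show ?thesis by (simp add: compact_eq_bounded_closed)
  qed
  then have 1: "\<exists>K. nest M E F K \<and> (\<forall>i. compact (K i))" using nestP by blast
  have "\<exists>v. qc_version M E F u v" if u: "u \<in> F" for u
  proof -
    obtain v g' L where v: "v \<in> borel_measurable borel" "AE x in M. v x = u x"
      and g': "vanishing_cutoffs g' L" and v_cont: "\<And>k. continuous_on (L k) v"
      using ex_continuous_version[OF u] by blast
    \<comment> \<open>\<open>v\<close> is continuous on \<open>L k\<close> but \<open>w\<close> only
      on \<open>K k\<close>, so the nest is first obtained for the smaller sets and then enlarged to
      \<open>L\<close>.\<close>
    have "nest M E F (\<lambda>k. (L k \<inter> K k) \<inter> {x. 1 / real (Suc k) \<le> w x})"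
      by (rule nest_superlevel[OF h pos w wh vanishing_cutoffs_max[OF g' g]])
        (auto intro: continuous_on_subset[OF w_cont])
    then have "nest M E F L"
      by (rule nest_mono) (use g' in \<open>auto simp: vanishing_cutoffs_def\<close>)
    then show ?thesis using v v_cont
      unfolding qc_version_def quasi_continuous_def borel_measurable_M by blast
  qed
  \<comment> \<open>Every element has a quasi-continuous version, so the whole domain serves as the
    dense set.\<close>
  moreover have "form_dense M E F F"
    by (rule form_denseI) (auto simp: N_def incr_const intro!: bexI)
  ultimately have 2: "\<exists>S. form_dense M E F S \<and> (\<forall>u\<in>S. \<exists>g. qc_version M E F u g)" by blast
  \<comment> \<open>Clamping to the unit interval keeps positivity and makes \<open>hh\<close>
    bounded, so that products with \<open>hh\<close> stay in the domain.\<close>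
  define hh where "hh x = max 0 (min 1 (w x))" for x
  have [measurable]: "hh \<in> borel_measurable borel" unfolding hh_def by measurable
  have "w \<in> F" by (rule F_cong_AE[OF hF w]) (use wh in auto)
  then have hhF: "hh \<in> F"
    by (rule F_contraction) (auto simp: hh_def min_def max_def)
  have hh1: "\<bar>hh x\<bar> \<le> 1" for x by (auto simp: hh_def)
  obtain Q :: "'a set" where Q: "countable Q" "\<And>X. open X \<Longrightarrow> X \<noteq> {} \<Longrightarrow> \<exists>d\<in>Q. d \<in> X"
    by (rule countable_dense_setE) blast
  have "Q \<noteq> {}" using Q(2)[of UNIV] by auto
  define q where "q = from_nat_into Q"
  have q: "\<exists>n. dist x (q n) < e" if "0 < e" for x e
  proof -
    have "ball x e \<noteq> {}" using that by simp
    then obtain d where d: "d \<in> Q" "d \<in> ball x e" using Q(2)[OF open_ball] by blast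
    obtain n where "q n = d" using from_nat_into_surj[OF Q(1) d(1)] by (auto simp: q_def)
    then show ?thesis using d by auto
  qed
  define \<psi> where "\<psi> n x = min 1 (dist x (q n))" for n x
  have \<psi>_cont: "continuous_on A (\<psi> n)" for A n unfolding \<psi>_def by (intro continuous_intros)
  have [measurable]: "\<psi> n \<in> borel_measurable borel" for n
    using \<psi>_cont by (rule borel_measurable_continuous_onI)
  have \<psi>_lip: "\<bar>\<psi> n x - \<psi> n y\<bar> \<le> min 1 (dist x y)" for n x y
  proof -
    have "\<bar>min 1 a - min 1 b\<bar> \<le> min 1 \<bar>a - b\<bar>" if "0 \<le> a" "0 \<le> b" for a b :: real
      using that by (auto simp: min_def abs_if)
    then have "\<bar>\<psi> n x - \<psi> n y\<bar> \<le> min 1 \<bar>dist x (q n) - dist y (q n)\<bar>" by (simp add: \<psi>_def)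
    also have "\<dots> \<le> min 1 (dist x y)" using abs_dist_diff_le[of x "q n" y] by (intro min.mono) (simp_all add: dist_commute)
    finally show ?thesis .
  qed
  have hh\<psi>F: "(\<lambda>x. hh x * \<psi> n x) \<in> F" for n
    by (rule F_mult[OF hhF hh1 _ _ incr_finite_if_lipschitz[OF \<psi>_lip]]) (auto simp: \<psi>_def)
  define f where "f n = (case n of 0 \<Rightarrow> hh | Suc m \<Rightarrow> (\<lambda>x. hh x * \<psi> m x))" for n
  have fF: "f n \<in> F" for n using hhF hh\<psi>F by (cases n) (auto simp: f_def)
  have "continuous_on (P k) (f n)" for k n
  proof -
    have "continuous_on (P k) w" by (rule continuous_on_subset[OF w_cont]) (auto simp: P_def)
    then have "continuous_on (P k) hh" unfolding hh_def by (intro continuous_intros)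
    then show ?thesis by (cases n) (auto simp: f_def intro!: continuous_intros \<psi>_cont)
  qed
  then have fqc: "qc_version M E F (f n) (f n)" for n
    unfolding qc_version_def quasi_continuous_def using nestP F_meas_M[OF fF] by auto
  have pol: "polar M E F (\<Inter>i. - P i)" unfolding polar_def using nestP by blast
  have sep: "\<exists>n. f n x \<noteq> f n y" if x: "x \<notin> (\<Inter>i. - P i)" and y: "y \<notin> (\<Inter>i. - P i)" and "x \<noteq> y" for x y
  proof (rule ccontr)
    assume "\<nexists>n. f n x \<noteq> f n y"
    then have eq: "f n x = f n y" for n by auto
    have hh0: "0 < hh z" if z: "z \<notin> (\<Inter>i. - P i)" for z
    proof -
      obtain i where "1 / real (Suc i) \<le> w z" using z by (auto simp: P_def)
      moreover have "0 < 1 / real (Suc i)" by simp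
      ultimately have "0 < w z" by linarith
      then show ?thesis by (simp add: hh_def)
    qed
    have eq0: "hh x = hh y" using eq[of 0] by (simp add: f_def)
    have eqn: "\<psi> n x = \<psi> n y" for n using eq[of "Suc n"] hh0[OF y] by (simp add: f_def eq0)
    \<comment> \<open>A centre closer to \<open>x\<close> than half of \<open>dist x y\<close> is
      strictly closer to \<open>x\<close> than to \<open>y\<close>; being also closer than 1, it is
      separated by the truncated distance.\<close>
    have "0 < min 1 (dist x y / 2)" using \<open>x \<noteq> y\<close> by simp
    then obtain n where "dist x (q n) < min 1 (dist x y / 2)" using q by blast
    then have n: "dist x (q n) < 1" "dist x (q n) < dist x y / 2" by simp_all
    have "dist x y \<le> dist x (q n) + dist y (q n)" by (metis dist_commute dist_triangle)
    then have "dist x (q n) < dist y (q n)" using n by simp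
    then have "\<psi> n x < \<psi> n y" using n(1) by (simp add: \<psi>_def)
    then show False using eqn by simp
  qed
  have 3: "\<exists>(f::nat \<Rightarrow> 'a \<Rightarrow> real) g N. (\<forall>n. f n \<in> F \<and> qc_version M E F (f n) (g n)) \<and>
      polar M E F N \<and> (\<forall>x\<in>-N. \<forall>y\<in>-N. x \<noteq> y \<longrightarrow> (\<exists>n. g n x \<noteq> g n y))"
    by (rule exI[of _ f], rule exI[of _ f], rule exI[of _ "\<Inter>i. - P i"])
      (use fF fqc pol sep in blast)
  show ?thesis unfolding quasi_regular_def using 1 2 3 by blast
qed

end

section \<open>Mollification\<close>

lemma nn_integral_lborel_shift:
  fixes c :: "'a::euclidean_space"
  assumes [measurable]: "f \<in> borel_measurable borel"
  shows "(\<integral>\<^sup>+x. f (c + x) \<partial>lborel) = (\<integral>\<^sup>+x. f x \<partial>lborel)"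
proof -
  have "(\<integral>\<^sup>+x. f x \<partial>lborel) = (\<integral>\<^sup>+x. f x \<partial>distr lborel borel ((+) c))"
    by (simp add: lborel_distr_plus)
  also have "\<dots> = (\<integral>\<^sup>+x. f (c + x) \<partial>lborel)" by (simp add: nn_integral_distr)
  finally show ?thesis ..
qed

lemma sqn_lborel_shift:
  fixes f :: "'a::euclidean_space \<Rightarrow> real"
  assumes [measurable]: "f \<in> borel_measurable borel"
  shows "sqn lborel (\<lambda>x. f (x + t)) = sqn lborel f"
  using nn_integral_lborel_shift[of "\<lambda>x. ennreal ((f x)\<^sup>2)" t] by (simp add: sqn_def add.commute)

lemma integrable_lborel_bounded_support:
  fixes f :: "'a::euclidean_space \<Rightarrow> real"
  assumes [measurable]: "f \<in> borel_measurable borel"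
    and bdd: "\<And>x. \<bar>f x\<bar> \<le> B" and supp: "\<And>x. c < norm x \<Longrightarrow> f x = 0"
  shows "integrable lborel f"
proof (rule Bochner_Integration.integrable_bound)
  show "integrable lborel (\<lambda>x. B * indicator (cball (0::'a) c) x)"
    by (intro integrable_mult_right integrable_real_indicator) (auto simp: emeasure_lborel_cball_finite[unfolded infinity_ennreal_def])
  show "AE x in lborel. norm (f x) \<le> norm (B * indicator (cball 0 c) x)"
    using bdd supp by (auto simp: indicator_def not_le intro: order_trans[OF _ abs_ge_self])
qed simp

lemma sqn_lborel_bounded_support:
  fixes f :: "'a::euclidean_space \<Rightarrow> real"
  assumes bdd: "\<And>x. \<bar>f x\<bar> \<le> B" and supp: "\<And>x. c < norm x \<Longrightarrow> f x = 0"
  shows "sqn lborel f \<le> ennreal (B\<^sup>2) * emeasure lborel (cball (0::'a) c)"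
proof -
  have "sqn lborel f \<le> sqn lborel (\<lambda>x. B * indicator (cball (0::'a) c) x)"
    by (rule sqn_mono) (use bdd supp in \<open>auto simp: indicator_def not_le intro: order_trans[OF _ abs_ge_self]\<close>)
  also have "\<dots> = ennreal (B\<^sup>2) * sqn lborel (indicator (cball (0::'a) c))"
    by (rule sqn_cmult) (intro borel_measurable_indicator, simp)
  also have "sqn lborel (indicator (cball (0::'a) c)) = (\<integral>\<^sup>+x. indicator (cball (0::'a) c) x \<partial>lborel)"
    unfolding sqn_def by (intro nn_integral_cong) (auto simp: indicator_def)
  finally show ?thesis by simp
qed

text \<open>A Lipschitz profile of compact support already makes mollified functions Lipschitz,
  which is all the regularity aimed at.\<close>

definition tent :: "real \<Rightarrow> 'a::euclidean_space \<Rightarrow> real" where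
  "tent r z = max 0 (1 - norm z / r)"

definition bump :: "real \<Rightarrow> 'a::euclidean_space \<Rightarrow> real" where
  "bump r z = tent r z / integral\<^sup>L lborel (tent r :: 'a \<Rightarrow> real)"

text \<open>The usual convolution, as \<open>bump r\<close> is even; in this form it visibly
  commutes with translations.\<close>

definition mollify :: "real \<Rightarrow> ('a::euclidean_space \<Rightarrow> real) \<Rightarrow> 'a \<Rightarrow> real" where
  "mollify r f x = (\<integral>z. bump r z * f (x + z) \<partial>lborel)"

lemma tent_measurable[measurable]: "tent r \<in> borel_measurable borel"
  unfolding tent_def by measurable

lemma bump_measurable[measurable]: "bump r \<in> borel_measurable borel"
  unfolding bump_def by measurable

context
  fixes r :: real assumes r: "0 < r"
begin

lemma tent_nonneg: "0 \<le> tent r z" and tent_le_1: "tent r z \<le> 1"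
  and tent_outside: "r \<le> norm z \<Longrightarrow> tent r z = 0"
  using r by (auto simp: tent_def)

lemma tent_lipschitz: "\<bar>tent r z - tent r z'\<bar> \<le> norm (z - z') / r"
proof -
  have "\<bar>max 0 (1 - a) - max 0 (1 - b)\<bar> \<le> \<bar>a - b\<bar>" for a b :: real
    by (auto simp: max_def abs_if)
  then have "\<bar>tent r z - tent r z'\<bar> \<le> \<bar>norm z / r - norm z' / r\<bar>"
    by (simp add: tent_def)
  also have "\<dots> = \<bar>norm z - norm z'\<bar> / r" using r by (simp add: diff_divide_distrib[symmetric])
  also have "\<dots> \<le> norm (z - z') / r" using r by (intro divide_right_mono norm_triangle_ineq3) auto
  finally show ?thesis .
qed

lemma integrable_tent: "integrable lborel (tent r :: 'a::euclidean_space \<Rightarrow> real)"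
  by (rule integrable_lborel_bounded_support[of _ 1 r])
    (simp_all add: tent_nonneg tent_le_1 tent_outside)

lemma tent_mass_pos: "0 < integral\<^sup>L lborel (tent r :: 'a::euclidean_space \<Rightarrow> real)"
proof -
  have "0 < 1/2 * measure lborel (ball (0::'a) (r/2))"
    using r content_ball_pos[of "r/2" "0::'a"] by simp
  also have "\<dots> = (\<integral>y. 1/2 * indicator (ball (0::'a) (r/2)) y \<partial>lborel)" by simp
  also have "\<dots> \<le> integral\<^sup>L lborel (tent r :: 'a \<Rightarrow> real)"
  proof (rule integral_mono[OF _ integrable_tent])
    show "integrable lborel (\<lambda>y::'a. 1/2 * indicator (ball 0 (r/2)) y :: real)"
      by (intro integrable_mult_right integrable_real_indicator) (auto simp: emeasure_lborel_ball_finite[unfolded infinity_ennreal_def])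
    show "1/2 * indicator (ball 0 (r/2)) y \<le> tent r y" for y :: 'a
      using r tent_nonneg[of y] by (auto simp: indicator_def tent_def field_simps)
  qed
  finally show ?thesis .
qed

lemma bump_nonneg: "0 \<le> bump r z"
  unfolding bump_def by (intro divide_nonneg_nonneg tent_nonneg less_imp_le tent_mass_pos)

lemma bump_outside: "r \<le> norm z \<Longrightarrow> bump r z = 0"
  by (simp add: bump_def tent_outside)

lemma integrable_bump: "integrable lborel (bump r)"
  unfolding bump_def by (intro integrable_divide integrable_tent)

lemma integral_bump: "integral\<^sup>L lborel (bump r :: 'a::euclidean_space \<Rightarrow> real) = 1"
  unfolding bump_def using tent_mass_pos[where ?'a='a] by simp

lemma integrable_bump_mult:
  fixes f :: "'a::euclidean_space \<Rightarrow> real"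
  assumes [measurable]: "f \<in> borel_measurable borel" and bdd: "\<And>x. \<bar>f x\<bar> \<le> B"
  shows "integrable lborel (\<lambda>z. bump r z * f z)"
proof (rule Bochner_Integration.integrable_bound)
  show "integrable lborel (\<lambda>z::'a. bump r z * B)" by (intro integrable_mult_left integrable_bump)
  show "AE z in lborel. norm (bump r z * f z) \<le> norm (bump r z * B)"
    using bdd bump_nonneg by (auto simp: abs_mult intro!: mult_left_mono order_trans[OF bdd])
qed simp

text \<open>Moves the dependence on \<open>x\<close> from the merely measurable \<open>f\<close> to
  the Lipschitz kernel.\<close>

lemma mollify_eq_shift:
  fixes f :: "'a::euclidean_space \<Rightarrow> real"
  assumes [measurable]: "f \<in> borel_measurable borel"
  shows "mollify r f x = (\<integral>y. bump r (y - x) * f y \<partial>lborel)"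
proof -
  have "(\<integral>y. bump r (y - x) * f y \<partial>lborel) = (\<integral>y. bump r (y - x) * f y \<partial>distr lborel borel ((+) x))"
    by (simp add: lborel_distr_plus)
  also have "\<dots> = mollify r f x" unfolding mollify_def by (subst integral_distr) auto
  finally show ?thesis ..
qed

lemma mollify_lipschitz:
  fixes f :: "'a::euclidean_space \<Rightarrow> real"
  assumes [measurable]: "f \<in> borel_measurable borel"
    and bdd: "\<And>x. \<bar>f x\<bar> \<le> B" and supp: "\<And>x. c < norm x \<Longrightarrow> f x = 0"
  shows "\<exists>L\<ge>0. \<forall>x y. \<bar>mollify r f x - mollify r f y\<bar> \<le> L * dist x y"
proof -
  define m where "m = integral\<^sup>L lborel (tent r :: 'a \<Rightarrow> real)"
  have m: "0 < m" unfolding m_def by (rule tent_mass_pos)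
  have f: "integrable lborel f" by (rule integrable_lborel_bounded_support[OF _ bdd supp]) simp
  have bf: "integrable lborel (\<lambda>y. bump r (y - x) * f y)" for x
  proof (rule integrable_lborel_bounded_support)
    show "\<bar>bump r (y - x) * f y\<bar> \<le> (1 / m) * B" for y
    proof -
      have "bump r (y - x) \<le> 1 / m" unfolding bump_def m_def[symmetric]
        using m tent_le_1 by (intro divide_right_mono) auto
      then show ?thesis using bdd[of y] bump_nonneg[of "y - x"] m
        unfolding abs_mult by (intro mult_mono) auto
    qed
    show "bump r (y - x) * f y = 0" if "c < norm y" for y using supp[OF that] by simp
  qed simp
  \<comment> \<open>Lipschitz constant of the normalised kernel times the integral of the absolute
    value of \<open>f\<close>.\<close>
  define L where "L = (1 / (r * m)) * (\<integral>y. \<bar>f y\<bar> \<partial>lborel)"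
  have "\<bar>mollify r f x - mollify r f y\<bar> \<le> L * dist x y" for x y
  proof -
    have "mollify r f x - mollify r f y = (\<integral>z. (bump r (z - x) - bump r (z - y)) * f z \<partial>lborel)"
      by (simp add: mollify_eq_shift bf left_diff_distrib flip: Bochner_Integration.integral_diff)
    also have "\<bar>\<dots>\<bar> \<le> (\<integral>z. (1 / (r * m)) * dist x y * \<bar>f z\<bar> \<partial>lborel)"
    proof (rule integral_abs_bound_integral)
      show "integrable lborel (\<lambda>z. (bump r (z - x) - bump r (z - y)) * f z)"
        unfolding left_diff_distrib by (intro Bochner_Integration.integrable_diff bf)
      show "integrable lborel (\<lambda>z. (1 / (r * m)) * dist x y * \<bar>f z\<bar>)"
        by (intro integrable_mult_right integrable_abs f)
      show "\<bar>(bump r (z - x) - bump r (z - y)) * f z\<bar> \<le> (1 / (r * m)) * dist x y * \<bar>f z\<bar>" for z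
      proof -
        have "bump r (z - x) - bump r (z - y) = (tent r (z - x) - tent r (z - y)) / m"
          by (simp add: bump_def m_def diff_divide_distrib)
        also have "\<bar>\<dots>\<bar> \<le> (norm ((z - x) - (z - y)) / r) / m"
          unfolding abs_divide abs_of_pos[OF m] using m
          by (intro divide_right_mono tent_lipschitz) auto
        also have "\<dots> = (1 / (r * m)) * dist x y" by (simp add: dist_norm norm_minus_commute)
        finally show ?thesis unfolding abs_mult by (intro mult_right_mono) auto
      qed
    qed
    also have "\<dots> = L * dist x y" by (simp add: L_def)
    finally show ?thesis .
  qed
  moreover have "0 \<le> L" unfolding L_def using r m by (intro mult_nonneg_nonneg) auto
  ultimately show ?thesis by blast
qed

lemma mollify_continuous:
  fixes f :: "'a::euclidean_space \<Rightarrow> real"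
  assumes "f \<in> borel_measurable borel"
    and "\<And>x. \<bar>f x\<bar> \<le> B" and "\<And>x. c < norm x \<Longrightarrow> f x = 0"
  shows "continuous_on UNIV (mollify r f)"
proof -
  obtain L where L: "\<And>x y. \<bar>mollify r f x - mollify r f y\<bar> \<le> L * dist x y" "0 \<le> L"
    using mollify_lipschitz[OF assms] by blast
  then have "L-lipschitz_on UNIV (mollify r f)" by (auto simp: lipschitz_on_def dist_real_def)
  then show ?thesis by (rule lipschitz_on_continuous_on)
qed

lemma mollify_bounded:
  fixes f :: "'a::euclidean_space \<Rightarrow> real"
  assumes [measurable]: "f \<in> borel_measurable borel" and bdd: "\<And>x. \<bar>f x\<bar> \<le> B"
  shows "\<bar>mollify r f x\<bar> \<le> B"
proof -
  have "\<bar>mollify r f x\<bar> \<le> (\<integral>z. bump r (z::'a) * B \<partial>lborel)"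
    unfolding mollify_def
  proof (rule integral_abs_bound_integral)
    show "integrable lborel (\<lambda>z. bump r z * f (x + z))" by (rule integrable_bump_mult[OF _ bdd]) simp
    show "integrable lborel (\<lambda>z::'a. bump r z * B)" by (intro integrable_mult_left integrable_bump)
    show "\<bar>bump r z * f (x + z)\<bar> \<le> bump r z * B" for z
      unfolding abs_mult using bump_nonneg[of z] bdd by (auto intro!: mult_left_mono)
  qed
  then show ?thesis by (simp add: integral_bump)
qed

lemma mollify_eq_0:
  assumes "\<And>z. norm z < r \<Longrightarrow> f (x + z) = 0"
  shows "mollify r f x = 0"
proof -
  have "bump r z * f (x + z) = 0" for z
    using assms[of z] bump_outside[of z] by (cases "norm z < r") auto
  then show ?thesis unfolding mollify_def by (simp only: Bochner_Integration.integral_zero)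
qed

lemma mollify_diff:
  fixes f g :: "'a::euclidean_space \<Rightarrow> real"
  assumes [measurable]: "f \<in> borel_measurable borel" "g \<in> borel_measurable borel"
    and f: "\<And>x. \<bar>f x\<bar> \<le> B" and g: "\<And>x. \<bar>g x\<bar> \<le> C"
  shows "mollify r (\<lambda>x. f x - g x) x = mollify r f x - mollify r g x"
  unfolding mollify_def right_diff_distrib
  by (intro Bochner_Integration.integral_diff integrable_bump_mult[OF _ f] integrable_bump_mult[OF _ g]) auto

lemma mollify_shift: "mollify r (\<lambda>x. f (x + t)) x = mollify r f (x + t)"
  by (simp add: mollify_def add_ac)

lemma mollify_measurable:
  fixes f :: "'a::euclidean_space \<Rightarrow> real"
  assumes [measurable]: "f \<in> borel_measurable borel"
  shows "mollify r f \<in> borel_measurable borel"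
  unfolding mollify_def by measurable

text \<open>Jensen for the probability density \<open>bump r\<close>, followed by Tonelli and
  translation invariance.\<close>

lemma sqn_mollify_le:
  fixes f :: "'a::euclidean_space \<Rightarrow> real"
  assumes [measurable]: "f \<in> borel_measurable borel" and bdd: "\<And>x. \<bar>f x\<bar> \<le> B"
  shows "sqn lborel (mollify r f) \<le> sqn lborel f"
proof -
  have bdd2: "\<bar>(f x)\<^sup>2\<bar> \<le> B\<^sup>2" for x using bdd[of x] by (simp add: abs_le_square_iff[symmetric])
  have pt: "ennreal ((mollify r f x)\<^sup>2) \<le> (\<integral>\<^sup>+z. ennreal (bump r z) * ennreal ((f (x + z))\<^sup>2) \<partial>lborel)" for x
  proof -
    define c where "c = mollify r f x"
    have i1: "integrable lborel (\<lambda>z. bump r z * f (x + z))" by (rule integrable_bump_mult[OF _ bdd]) simp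
    have i2: "integrable lborel (\<lambda>z. bump r z * (f (x + z))\<^sup>2)" by (rule integrable_bump_mult[OF _ bdd2]) simp
    \<comment> \<open>Jensen for the square is non-negativity of the variance; \<open>c\<close> is
      the mean.\<close>
    have "0 \<le> (\<integral>z. bump r z * (f (x + z) - c)\<^sup>2 \<partial>lborel)"
      by (intro Bochner_Integration.integral_nonneg mult_nonneg_nonneg bump_nonneg) simp
    also have "\<dots> = (\<integral>z. bump r z * (f (x + z))\<^sup>2 - 2 * c * (bump r z * f (x + z)) + c\<^sup>2 * bump r z \<partial>lborel)"
      by (simp add: power2_eq_square algebra_simps)
    also have "\<dots> = (\<integral>z. bump r z * (f (x + z))\<^sup>2 \<partial>lborel) - 2 * c * c + c\<^sup>2 * 1"
      using i1 i2 integrable_bump[where ?'a='a] by (simp add: integral_bump c_def mollify_def)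
    finally have "c\<^sup>2 \<le> (\<integral>z. bump r z * (f (x + z))\<^sup>2 \<partial>lborel)" by (simp add: power2_eq_square)
    then have "ennreal (c\<^sup>2) \<le> ennreal (\<integral>z. bump r z * (f (x + z))\<^sup>2 \<partial>lborel)" by (rule ennreal_leI)
    also have "\<dots> = (\<integral>\<^sup>+z. ennreal (bump r z * (f (x + z))\<^sup>2) \<partial>lborel)"
      by (rule nn_integral_eq_integral[symmetric]) (simp_all add: i2 bump_nonneg)
    finally show ?thesis by (simp add: c_def ennreal_mult' bump_nonneg)
  qed
  have "sqn lborel (mollify r f) \<le>
      (\<integral>\<^sup>+x. \<integral>\<^sup>+z. ennreal (bump r z) * ennreal ((f (x + z))\<^sup>2) \<partial>lborel \<partial>lborel)"
    unfolding sqn_def by (intro nn_integral_mono pt)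
  also have "\<dots> = (\<integral>\<^sup>+z. \<integral>\<^sup>+x. ennreal (bump r z) * ennreal ((f (x + z))\<^sup>2) \<partial>lborel \<partial>lborel)"
    by (rule lborel_pair.Fubini'[symmetric]) measurable
  also have "\<dots> = (\<integral>\<^sup>+z. ennreal (bump r (z::'a)) * sqn lborel f \<partial>lborel)"
    by (simp add: nn_integral_cmult sqn_lborel_shift flip: sqn_def)
  also have "\<dots> = (\<integral>\<^sup>+z. ennreal (bump r (z::'a)) \<partial>lborel) * sqn lborel f"
    by (rule nn_integral_multc) simp
  also have "(\<integral>\<^sup>+z. ennreal (bump r (z::'a)) \<partial>lborel) = 1"
    by (subst nn_integral_eq_integral[OF integrable_bump]) (simp_all add: integral_bump bump_nonneg)
  finally show ?thesis by simp
qed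

end

lemma sqn_mollify_diff_continuous:
  fixes f :: "'a::euclidean_space \<Rightarrow> real"
  assumes cont: "continuous_on UNIV f" and bdd: "\<And>x. \<bar>f x\<bar> \<le> B"
    and supp: "\<And>x. c < norm x \<Longrightarrow> f x = 0" and e: "0 < e"
  shows "\<exists>r0>0. \<forall>r. 0 < r \<and> r \<le> r0 \<longrightarrow> sqn lborel (\<lambda>x. f x - mollify r f x) < ennreal e"
proof -
  have [measurable]: "f \<in> borel_measurable borel" by (rule borel_measurable_continuous_onI[OF cont])
  define V where "V = measure lborel (cball (0::'a) (c + 1))"
  have V: "emeasure lborel (cball (0::'a) (c + 1)) = ennreal V" "0 \<le> V"
    using emeasure_lborel_cball_finite[of "0::'a" "c + 1"]
    by (auto simp: V_def intro!: emeasure_eq_ennreal_measure)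
  \<comment> \<open>Makes \<open>d\<^sup>2 * V\<close> at most \<open>e / 2\<close>; the summand 1
    avoids dividing by a vanishing volume.\<close>
  define d where "d = sqrt (e / (V + 1) / 2)"
  have d: "0 < d" "d\<^sup>2 * V < e"
  proof -
    show "0 < d" using e V(2) by (simp add: d_def)
    have "d\<^sup>2 * V = (e / 2) * (V / (V + 1))" using e V(2) by (simp add: d_def)
    also have "\<dots> \<le> (e / 2) * 1" using e V(2) by (intro mult_left_mono) auto
    also have "\<dots> < e" using e by simp
    finally show "d\<^sup>2 * V < e" .
  qed
  \<comment> \<open>Points of norm at most \<open>c + 1\<close> are moved by less than
    \<open>r \<le> 1\<close>, so they stay in the ball of radius \<open>c + 2\<close>.\<close>
  have "uniformly_continuous_on (cball 0 (c + 2)) f"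
    by (rule compact_uniformly_continuous) (auto intro: continuous_on_subset[OF cont])
  then obtain s where s: "0 < s"
    "\<And>x y. x \<in> cball 0 (c + 2) \<Longrightarrow> y \<in> cball 0 (c + 2) \<Longrightarrow> dist y x < s \<Longrightarrow> dist (f y) (f x) < d"
    using d(1) unfolding uniformly_continuous_on_def by metis
  have "sqn lborel (\<lambda>x. f x - mollify r f x) < ennreal e" if r: "0 < r" "r \<le> min 1 (s/2)" for r
  proof -
    have far: "mollify r f x = 0" "f x = 0" if "c + 1 < norm x" for x
    proof -
      show "mollify r f x = 0"
      proof (rule mollify_eq_0[OF r(1)])
        fix z :: 'a assume "norm z < r"
        then have "c < norm (x + z)" using that r norm_triangle_ineq4[of "x + z" z] by simp
        then show "f (x + z) = 0" by (rule supp)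
      qed
      show "f x = 0" using that by (intro supp) simp
    qed
    have near: "\<bar>f x - mollify r f x\<bar> \<le> d" for x
    proof (cases "c + 1 < norm x")
      case True then show ?thesis using far d by simp
    next
      case False
      have i1: "integrable lborel (\<lambda>z. bump r z * f (x + z))"
        by (rule integrable_bump_mult[OF r(1) _ bdd]) simp
      have i2: "integrable lborel (\<lambda>z::'a. bump r z * f x)"
        by (intro integrable_mult_left integrable_bump r)
      have "f x - mollify r f x = (\<integral>z. bump r z * f x - bump r z * f (x + z) \<partial>lborel)"
        using i1 i2 integral_bump[OF r(1), where ?'a='a]
        by (simp add: mollify_def)
      also have "\<bar>\<dots>\<bar> \<le> (\<integral>z. bump r (z::'a) * d \<partial>lborel)"
      proof (rule integral_abs_bound_integral)
        show "\<bar>bump r z * f x - bump r z * f (x + z)\<bar> \<le> bump r z * d" for z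
        proof (cases "norm z < r")
          case True
          have "norm (x + z) \<le> c + 2" using False True r norm_triangle_ineq[of x z] by simp
          then have "dist (f x) (f (x + z)) < d" using False True r
            by (intro s(2)) (auto simp: mem_cball_0 dist_norm simp del: mem_cball)
          then show ?thesis using bump_nonneg[OF r(1), of z]
            by (simp add: dist_real_def abs_mult flip: right_diff_distrib) (simp add: mult_left_mono)
        next
          case False
          then show ?thesis using bump_outside[OF r(1), of z] by simp
        qed
      qed (use i1 i2 in \<open>auto intro: integrable_bump[OF r(1)]\<close>)
      finally show ?thesis using integral_bump[OF r(1), where ?'a='a] by simp
    qed
    have "sqn lborel (\<lambda>x. f x - mollify r f x) \<le> ennreal (d\<^sup>2) * emeasure lborel (cball (0::'a) (c + 1))"
      by (rule sqn_lborel_bounded_support[OF near]) (simp add: far)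
    also have "\<dots> = ennreal (d\<^sup>2 * V)" using V by (simp add: ennreal_mult)
    also have "\<dots> < ennreal e" using d V by (intro ennreal_lessI) (auto simp: e)
    finally show ?thesis .
  qed
  then show ?thesis using s(1) by (intro exI[of _ "min 1 (s/2)"]) auto
qed

lemma ex_continuous_sqn_close:
  fixes f :: "'a::euclidean_space \<Rightarrow> real"
  assumes f[measurable]: "f \<in> borel_measurable borel" and bdd: "\<And>x. \<bar>f x\<bar> \<le> B"
    and supp: "\<And>x. c < norm x \<Longrightarrow> f x = 0" and e: "0 < e"
  shows "\<exists>g. continuous_on UNIV g \<and> (\<forall>x. \<bar>g x\<bar> \<le> B) \<and> (\<forall>x. c + 1 < norm x \<longrightarrow> g x = 0) \<and>
    sqn lborel (\<lambda>x. f x - g x) < ennreal e"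
proof -
  have B: "0 \<le> B" using bdd[of undefined] by linarith
  \<comment> \<open>A Lebesgue measurable function is the limit of continuous functions off a
    negligible set. Clamping at \<open>B\<close> and a radial cutoff provide the domination that
    turns this into convergence of \<open>sqn\<close>.\<close>
  have "f measurable_on UNIV"
    by (rule lebesgue_measurable_imp_measurable_on) (auto intro: measurable_completion)
  then obtain Z g where Z: "negligible Z" and gc: "\<And>n. continuous_on UNIV (g n)"
    and gl: "\<And>x. x \<notin> Z \<Longrightarrow> (\<lambda>n. g n x) \<longlonglongrightarrow> f x"
    unfolding measurable_on_def by auto
  define cut where "cut x = max 0 (min 1 (c + 1 - norm x))" for x :: 'a
  define k where "k n x = max (- B) (min B (g n x)) * cut x" for n x
  have kc: "continuous_on UNIV (k n)" for n
    unfolding k_def cut_def by (intro continuous_intros gc)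
  have [measurable]: "k n \<in> borel_measurable borel" for n by (rule borel_measurable_continuous_onI[OF kc])
  have k_bdd: "\<bar>k n x\<bar> \<le> B" for n x
  proof -
    have "\<bar>max (- B) (min B (g n x))\<bar> \<le> B" "\<bar>cut x\<bar> \<le> 1" using B by (auto simp: cut_def)
    then have "\<bar>max (- B) (min B (g n x))\<bar> * \<bar>cut x\<bar> \<le> B * 1" using B by (intro mult_mono) auto
    then show ?thesis by (simp add: k_def abs_mult)
  qed
  have k_supp: "k n x = 0" if "c + 1 < norm x" for n x using that by (simp add: k_def cut_def)
  have "(\<lambda>n. sqn lborel (\<lambda>x. f x - k n x)) \<longlonglongrightarrow> 0"
  proof (rule sqn_dominated)
    show "(\<lambda>x::'a. 2 * B * indicator (cball 0 (c + 1)) x) \<in> borel_measurable lborel"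
      by (intro borel_measurable_times borel_measurable_indicator) auto
    show "AE x in lborel. \<bar>f x - k n x\<bar> \<le> \<bar>2 * B * indicator (cball 0 (c + 1)) x\<bar>" for n
    proof (rule AE_I2)
      fix x :: 'a
      show "\<bar>f x - k n x\<bar> \<le> \<bar>2 * B * indicator (cball 0 (c + 1)) x\<bar>"
      proof (cases "norm x \<le> c + 1")
        case True
        then show ?thesis using bdd[of x] k_bdd[of n x] B by (simp add: abs_mult)
      next
        case False
        then show ?thesis using supp[of x] k_supp[of x n] by simp
      qed
    qed
    have "sqn lborel (\<lambda>x. 2 * B * indicator (cball (0::'a) (c + 1)) x) \<le>
        ennreal ((2 * B)\<^sup>2) * emeasure lborel (cball (0::'a) (c + 1))"
      by (rule sqn_lborel_bounded_support) (use B in \<open>auto simp: indicator_def\<close>)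
    also have "\<dots> < \<infinity>" by (auto simp: ennreal_mult_less_top emeasure_lborel_cball_finite[unfolded infinity_ennreal_def])
    finally show "sqn lborel (\<lambda>x. 2 * B * indicator (cball (0::'a) (c + 1)) x) < \<infinity>" .
    have "AE x in lebesgue. x \<notin> Z" using Z by (intro AE_not_in) (simp add: negligible_iff_null_sets)
    then have "AE x in lborel. x \<notin> Z" by (simp add: AE_completion_iff)
    then show "AE x in lborel. (\<lambda>n. f x - k n x) \<longlonglongrightarrow> 0"
    proof eventually_elim
      case (elim x)
      have "(\<lambda>n. f x - k n x) \<longlonglongrightarrow> f x - max (- B) (min B (f x)) * cut x"
        unfolding k_def by (intro tendsto_intros tendsto_max tendsto_min gl elim)
      moreover have "max (- B) (min B (f x)) = f x" using bdd[of x] by (simp add: abs_le_iff max_def min_def)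
      moreover have "f x * cut x = f x"
        using supp[of x] by (cases "norm x \<le> c") (auto simp: cut_def)
      ultimately show ?case by simp
    qed
  qed auto
  then have "\<forall>\<^sub>F n in sequentially. sqn lborel (\<lambda>x. f x - k n x) < ennreal e"
    using order_tendstoD(2)[of _ 0 _ "ennreal e"] e by simp
  then obtain n where "sqn lborel (\<lambda>x. f x - k n x) < ennreal e" by (auto simp: eventually_sequentially)
  then show ?thesis using kc k_bdd k_supp by blast
qed

lemma sqn_mollify_diff:
  fixes f :: "'a::euclidean_space \<Rightarrow> real"
  assumes f[measurable]: "f \<in> borel_measurable borel" and bdd: "\<And>x. \<bar>f x\<bar> \<le> B"
    and supp: "\<And>x. c < norm x \<Longrightarrow> f x = 0" and e: "0 < e"
  shows "\<exists>r0>0. \<forall>r. 0 < r \<and> r \<le> r0 \<longrightarrow> sqn lborel (\<lambda>x. f x - mollify r f x) < ennreal e"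
proof -
  \<comment> \<open>The three errors enter with factors 2, 4 and 4, in total 10, so twelfths leave a
    strict inequality.\<close>
  have e8: "0 < e / 12" using e by simp
  obtain g where gc: "continuous_on UNIV g" and gb: "\<And>x. \<bar>g x\<bar> \<le> B"
    and gs: "\<And>x. c + 1 < norm x \<Longrightarrow> g x = 0" and fg: "sqn lborel (\<lambda>x. f x - g x) < ennreal (e / 12)"
    using ex_continuous_sqn_close[OF f bdd supp e8] by blast
  have [measurable]: "g \<in> borel_measurable borel" by (rule borel_measurable_continuous_onI[OF gc])
  obtain r0 where r0: "0 < r0" "\<And>r. 0 < r \<Longrightarrow> r \<le> r0 \<Longrightarrow> sqn lborel (\<lambda>x. g x - mollify r g x) < ennreal (e / 12)"
    using sqn_mollify_diff_continuous[OF gc gb gs e8] by blast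
  have "sqn lborel (\<lambda>x. f x - mollify r f x) < ennreal e" if r: "0 < r" "r \<le> r0" for r
  proof -
    note [measurable] = mollify_measurable[OF r(1)]
    have fgb: "\<bar>g x - f x\<bar> \<le> B + B" for x using bdd[of x] gb[of x] by linarith
    have "sqn lborel (\<lambda>x. mollify r g x - mollify r f x) = sqn lborel (mollify r (\<lambda>x. g x - f x))"
      by (rule arg_cong[where f="sqn lborel"], rule ext, rule mollify_diff[OF r(1) _ _ gb bdd, symmetric]) simp_all
    also have "\<dots> \<le> sqn lborel (\<lambda>x. g x - f x)" by (rule sqn_mollify_le[OF r(1) _ fgb]) simp
    also have "\<dots> = sqn lborel (\<lambda>x. f x - g x)" by (simp add: sqn_def power2_commute)
    finally have 3: "sqn lborel (\<lambda>x. mollify r g x - mollify r f x) < ennreal (e / 12)" using fg by simp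
    have "sqn lborel (\<lambda>x. f x - mollify r f x) \<le> 2 * sqn lborel (\<lambda>x. f x - g x) +
        2 * sqn lborel (\<lambda>x. g x - mollify r f x)"
      by (rule sqn_diff_trans) auto
    also have "\<dots> \<le> 2 * sqn lborel (\<lambda>x. f x - g x) +
        2 * (2 * sqn lborel (\<lambda>x. g x - mollify r g x) + 2 * sqn lborel (\<lambda>x. mollify r g x - mollify r f x))"
      by (intro add_left_mono mult_left_mono sqn_diff_trans) auto
    also have "\<dots> \<le> 2 * ennreal (e / 12) + 2 * (2 * ennreal (e / 12) + 2 * ennreal (e / 12))"
      using fg r0(2)[OF r] 3 by (intro add_mono mult_left_mono) auto
    also have "\<dots> = ennreal (2 * (e / 12) + 2 * (2 * (e / 12) + 2 * (e / 12)))"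
      using e by (simp flip: ennreal_plus ennreal_mult ennreal_numeral)
    also have "\<dots> < ennreal e" using e by (intro ennreal_lessI) auto
    finally show ?thesis .
  qed
  then show ?thesis using r0(1) by blast
qed

section \<open>The form with jumps inside the complement removed\<close>

locale censored_kernel =
  fixes j :: "real \<Rightarrow> real" and D :: "'a::euclidean_space set"
  assumes j_pos: "\<And>r. r > 0 \<Longrightarrow> j r > 0"
    and j_antimono: "antimono_on {0<..} j"
    and j_integrable: "(\<integral>\<^sup>+x. ennreal (min 1 ((norm x)\<^sup>2) * j (norm x)) \<partial>(lborel :: 'a measure)) < \<infinity>"
    and D_bounded: "bounded D" and D_open: "open D"
    and D_frontier: "emeasure lborel (frontier D) = 0"
begin

text \<open>The kernel as a function of the jump vector. The value 0 at the origin makes it Borel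
  and non-negative, as \<open>j 0\<close> is arbitrary; on the diagonal increments vanish
  anyway.\<close>

definition kappa :: "'a \<Rightarrow> real" where
  "kappa z = (if z = 0 then 0 else j (norm z))"

lemma kappa_measurable[measurable]: "kappa \<in> borel_measurable borel"
proof -
  define h where "h r = (if r \<in> {0<..} then j r else 0)" for r
  have "(\<lambda>r. - j r) \<in> borel_measurable (restrict_space borel {0<..})"
    by (rule borel_measurable_mono_on_fnc) (use j_antimono in \<open>auto simp: monotone_on_def\<close>)
  then have "(\<lambda>r. - (- j r)) \<in> borel_measurable (restrict_space borel {0<..})"
    by (rule borel_measurable_uminus)
  then have "(\<lambda>r. indicator {0<..} r *\<^sub>R (- (- j r))) \<in> borel_measurable borel"
    by (subst (asm) borel_measurable_restrict_space_iff) auto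
  moreover have "(\<lambda>r. indicator {0<..} r *\<^sub>R (- (- j r))) = h"
    by (auto simp: h_def fun_eq_iff)
  ultimately have [measurable]: "h \<in> borel_measurable borel" by simp
  have "kappa = (\<lambda>z. h (norm z))" by (auto simp: kappa_def h_def fun_eq_iff)
  then show ?thesis by simp
qed

lemma kappa_nonneg: "0 \<le> kappa z"
  using j_pos[of "norm z"] by (auto simp: kappa_def less_imp_le)

lemma kappa_commute: "kappa (x - y) = kappa (y - x)"
  by (auto simp: kappa_def norm_minus_commute)

lemma kern_eq_kappa: "x \<noteq> y \<Longrightarrow> kern j x y = kappa (x - y)"
  by (simp add: kern_def kappa_def)

lemma D_measurable[measurable]: "D \<in> sets borel"
  using D_open by simp

definition good :: "('a \<times> 'a) set" where
  "good = UNIV - (- D) \<times> (- D)"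

lemma good_iff: "p \<in> good \<longleftrightarrow> fst p \<in> D \<or> snd p \<in> D"
  by (cases p) (auto simp: good_def)

lemma good_measurable[measurable]: "good \<in> sets (borel \<Otimes>\<^sub>M borel)"
proof -
  have "good = {p \<in> space (borel \<Otimes>\<^sub>M borel). fst p \<in> D \<or> snd p \<in> D}"
    by (auto simp: good_def space_pair_measure)
  also have "\<dots> \<in> sets (borel \<Otimes>\<^sub>M borel)" by measurable
  finally show ?thesis .
qed

definition J :: "('a \<times> 'a) measure" where
  "J = density (lborel \<Otimes>\<^sub>M lborel) (\<lambda>p. ennreal (indicator good p * kappa (fst p - snd p)))"

definition rho :: "'a \<Rightarrow> ennreal" where
  "rho x = indicator D x + indicator (- D) x * mu j D x"

abbreviation M :: "'a measure" where
  "M \<equiv> m_measure j D"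

lemma M_eq: "M = density lborel rho"
  unfolding m_measure_def rho_def by simp

text \<open>Outside \<open>D\<close>, \<open>x\<close> differs from every \<open>y\<close> in
  \<open>D\<close>, so \<open>kern\<close> agrees with the Borel function \<open>kappa\<close>;
  inside \<open>D\<close> the indicator hides \<open>mu\<close>. Measurability of \<open>rho\<close>
  follows.\<close>

lemma indicator_mu: "indicator (- D) x * mu j D x =
    indicator (- D) x * (\<integral>\<^sup>+y. indicator D y * ennreal (kappa (x - y)) \<partial>lborel)"
proof (cases "x \<in> D")
  case False
  then have "mu j D x = (\<integral>\<^sup>+y. indicator D y * ennreal (kappa (x - y)) \<partial>lborel)"
    unfolding mu_def using False
    by (intro nn_integral_cong) (auto simp: indicator_def intro!: arg_cong[where f=ennreal] kern_eq_kappa)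
  then show ?thesis by simp
qed simp

lemma rho_measurable[measurable]: "rho \<in> borel_measurable borel"
  unfolding rho_def indicator_mu by measurable

lemma rho_D: "x \<in> D \<Longrightarrow> rho x = 1"
  by (simp add: rho_def)

lemma rho_notin_D: "x \<notin> D \<Longrightarrow> rho x = (\<integral>\<^sup>+y. indicator D y * ennreal (kappa (x - y)) \<partial>lborel)"
  using indicator_mu[of x] by (simp add: rho_def)

lemma sets_M: "sets M = sets borel"
  by (simp add: M_eq)

lemma sets_J: "sets J = sets (borel \<Otimes>\<^sub>M borel)"
  unfolding J_def by (simp cong: sets_pair_measure_cong)

lemma nn_integral_M:
  assumes [measurable]: "f \<in> borel_measurable borel"
  shows "(\<integral>\<^sup>+x. f x \<partial>M) = (\<integral>\<^sup>+x. rho x * f x \<partial>lborel)"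
  unfolding M_eq by (rule nn_integral_density) auto

lemma nn_integral_J:
  assumes [measurable]: "f \<in> borel_measurable (borel \<Otimes>\<^sub>M borel)"
  shows "(\<integral>\<^sup>+p. f p \<partial>J) =
    (\<integral>\<^sup>+x. \<integral>\<^sup>+y. ennreal (indicator good (x, y) * kappa (x - y)) * f (x, y) \<partial>lborel \<partial>lborel)"
proof -
  have "(\<integral>\<^sup>+p. f p \<partial>J) =
      (\<integral>\<^sup>+p. ennreal (indicator good p * kappa (fst p - snd p)) * f p \<partial>(lborel \<Otimes>\<^sub>M lborel))"
    unfolding J_def by (rule nn_integral_density) auto
  also have "\<dots> = (\<integral>\<^sup>+x. \<integral>\<^sup>+y. ennreal (indicator good (x, y) * kappa (x - y)) * f (x, y) \<partial>lborel \<partial>lborel)"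
    by (subst lborel.nn_integral_fst[symmetric]) auto
  finally show ?thesis .
qed

lemma nn_integral_J_swap:
  assumes [measurable]: "f \<in> borel_measurable (borel \<Otimes>\<^sub>M borel)"
  shows "(\<integral>\<^sup>+p. f p \<partial>J) = (\<integral>\<^sup>+p. f (snd p, fst p) \<partial>J)"
proof -
  have "(\<integral>\<^sup>+p. f p \<partial>J) =
    (\<integral>\<^sup>+x. \<integral>\<^sup>+y. ennreal (indicator good (x, y) * kappa (x - y)) * f (x, y) \<partial>lborel \<partial>lborel)"
    by (rule nn_integral_J) simp
  also have "\<dots> = (\<integral>\<^sup>+y. \<integral>\<^sup>+x. ennreal (indicator good (x, y) * kappa (x - y)) * f (x, y) \<partial>lborel \<partial>lborel)"
    by (rule lborel_pair.Fubini'[symmetric]) measurable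
  also have "\<dots> = (\<integral>\<^sup>+y. \<integral>\<^sup>+x. ennreal (indicator good (y, x) * kappa (y - x)) * f (x, y) \<partial>lborel \<partial>lborel)"
  proof -
    have "indicator good (x, y) * kappa (x - y) = indicator good (y, x) * kappa (y - x)" for x y
      using kappa_commute[of x y] by (auto simp: indicator_def good_iff)
    then show ?thesis by simp
  qed
  also have "\<dots> = (\<integral>\<^sup>+p. f (snd p, fst p) \<partial>J)"
    by (subst nn_integral_J) auto
  finally show ?thesis .
qed

text \<open>An \<open>M\<close>-null set may have positive Lebesgue measure outside
  \<open>D\<close>, where \<open>rho\<close> can vanish. But there \<open>rho x\<close> is the total
  rate of admissible jumps from \<open>x\<close>, so \<open>J\<close> does not see such points
  either.\<close>

lemma AE_J_fst:
  assumes "AE x in M. P x"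
  shows "AE p in J. P (fst p)"
proof -
  obtain N where N: "N \<in> null_sets M" "{x \<in> space M. \<not> P x} \<subseteq> N"
    using assms by (auto simp: eventually_ae_filter)
  have [measurable]: "N \<in> sets borel" using N(1) sets_M by auto
  have "0 = (\<integral>\<^sup>+x. indicator N x \<partial>M)" using N(1) by (simp add: null_setsD1 null_setsD2)
  also have "\<dots> = (\<integral>\<^sup>+x. rho x * indicator N x \<partial>lborel)" by (rule nn_integral_M) simp
  finally have z: "AE x in lborel. rho x * indicator N x = 0"
    by (subst nn_integral_0_iff_AE[symmetric]) auto
  have "(\<integral>\<^sup>+p. indicator N (fst p) \<partial>J) =
      (\<integral>\<^sup>+x. \<integral>\<^sup>+y. ennreal (indicator good (x, y) * kappa (x - y)) * indicator N x \<partial>lborel \<partial>lborel)"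
    by (subst nn_integral_J) auto
  also have "\<dots> = (\<integral>\<^sup>+x. 0 \<partial>(lborel :: 'a measure))"
  proof (rule nn_integral_cong_AE, use z in eventually_elim)
    case (elim x)
    show ?case
    proof (cases "x \<in> N")
      case True
      then have rho: "rho x = 0" using elim by simp
      then have "x \<notin> D" using rho_D[of x] by auto
      then have "ennreal (indicator good (x, y) * kappa (x - y)) * indicator N x =
          indicator D y * ennreal (kappa (x - y))" for y
        using True by (auto simp: indicator_def good_iff)
      then show ?thesis using rho rho_notin_D[OF \<open>x \<notin> D\<close>] by simp
    qed simp
  qed
  finally have "(\<integral>\<^sup>+p. indicator N (fst p) \<partial>J) = 0" by simp
  moreover have [measurable]: "(\<lambda>p. indicator N (fst p) :: ennreal) \<in> borel_measurable J"
    unfolding measurable_cong_sets[OF sets_J refl] by measurable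
  ultimately have "AE p in J. (indicator N (fst p) :: ennreal) = 0"
    by (subst nn_integral_0_iff_AE[symmetric]) auto
  then show ?thesis
  proof eventually_elim
    case (elim p)
    then have "fst p \<notin> N" by (auto simp: indicator_def split: if_splits)
    moreover have "space M = UNIV" using sets_eq_imp_space_eq[OF sets_M] by simp
    ultimately show ?case using N(2) by auto
  qed
qed

lemma AE_J_snd:
  assumes "AE x in M. P x"
  shows "AE p in J. P (snd p)"
proof -
  have "AE p in J. P (fst p)" by (rule AE_J_fst[OF assms])
  then obtain N where N: "N \<in> null_sets J" "{p \<in> space J. \<not> P (fst p)} \<subseteq> N"
    by (auto simp: eventually_ae_filter)
  have [measurable]: "N \<in> sets (borel \<Otimes>\<^sub>M borel)" using N(1) sets_J by auto
  have "(\<integral>\<^sup>+p. indicator N p \<partial>J) = 0" using N(1) by (simp add: null_setsD1 null_setsD2)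
  then have "(\<integral>\<^sup>+p. indicator N (snd p, fst p) \<partial>J) = 0"
    by (subst (asm) nn_integral_J_swap) auto
  moreover have [measurable]: "(\<lambda>p. indicator N (snd p, fst p) :: ennreal) \<in> borel_measurable J"
    unfolding measurable_cong_sets[OF sets_J refl] by measurable
  ultimately have "AE p in J. (indicator N (snd p, fst p) :: ennreal) = 0"
    by (subst nn_integral_0_iff_AE[symmetric]) auto
  then show ?thesis
  proof eventually_elim
    case (elim p)
    then have "(snd p, fst p) \<notin> N" by (auto simp: indicator_def split: if_splits)
    moreover have "space J = UNIV"
      using sets_eq_imp_space_eq[OF sets_J] by (simp add: space_pair_measure)
    ultimately show ?case using N(2) by (auto dest!: subsetD[where c="(snd p, fst p)"])
  qed
qed

lemma incr_measurable[measurable]: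
  assumes [measurable]: "u \<in> borel_measurable borel"
  shows "incr u \<in> borel_measurable (borel \<Otimes>\<^sub>M borel)"
  unfolding incr_def by measurable

lemma E_hat_eq:
  assumes [measurable]: "u \<in> borel_measurable borel" "v \<in> borel_measurable borel"
  shows "E_hat j D u v = 1/2 * L2_inner J (incr u) (incr v)"
proof -
  have "L2_inner J (incr u) (incr v) = (\<integral>p. (indicator good p * kappa (fst p - snd p)) *\<^sub>R (incr u p * incr v p)
      \<partial>(lborel \<Otimes>\<^sub>M lborel))"
    unfolding L2_inner_def J_def by (rule integral_density) (auto simp: kappa_nonneg)
  also have "\<dots> = (LINT (x, y) : UNIV - (- D) \<times> (- D) | lborel \<Otimes>\<^sub>M lborel.
      (u x - u y) * (v x - v y) * kern j x y)"
    unfolding set_lebesgue_integral_def good_def[symmetric]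
  proof (intro Bochner_Integration.integral_cong refl)
    fix p :: "'a \<times> 'a"
    show "(indicator good p * kappa (fst p - snd p)) *\<^sub>R (incr u p * incr v p) =
        indicator good p *\<^sub>R (case p of (x, y) \<Rightarrow> (u x - u y) * (v x - v y) * kern j x y)"
      by (cases p; cases "fst p = snd p") (auto simp: incr_def kern_eq_kappa)
  qed
  finally show ?thesis unfolding E_hat_def by simp
qed

lemma energy_eq:
  assumes [measurable]: "u \<in> borel_measurable borel"
  shows "energy j D u = ennreal (1/2) * sqn J (incr u)"
proof -
  have "sqn J (incr u) = (\<integral>\<^sup>+p. ennreal (indicator good p * kappa (fst p - snd p)) * ennreal ((incr u p)\<^sup>2)
      \<partial>(lborel \<Otimes>\<^sub>M lborel))"
    unfolding sqn_def J_def by (rule nn_integral_density) auto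
  also have "\<dots> = (\<integral>\<^sup>+(x, y) \<in> UNIV - (- D) \<times> (- D).
      ennreal ((u x - u y) * (u x - u y) * kern j x y) \<partial>(lborel \<Otimes>\<^sub>M lborel))"
    unfolding good_def[symmetric]
  proof (intro nn_integral_cong)
    fix p :: "'a \<times> 'a"
    show "ennreal (indicator good p * kappa (fst p - snd p)) * ennreal ((incr u p)\<^sup>2) =
        (case p of (x, y) \<Rightarrow> ennreal ((u x - u y) * (u x - u y) * kern j x y)) * indicator good p"
    proof (cases "fst p = snd p")
      case False
      then show ?thesis
        by (cases p) (auto simp: incr_def kern_eq_kappa power2_eq_square indicator_def mult_ac
            kappa_nonneg simp flip: ennreal_mult)
    qed (cases p, auto simp: incr_def)
  qed
  finally show ?thesis unfolding energy_def by simp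
qed

lemma F_dom_eq: "F_dom j D = {u \<in> borel_measurable borel. sqn M u < \<infinity> \<and> sqn J (incr u) < \<infinity>}"
proof -
  have "borel_measurable M = (borel_measurable borel :: ('a \<Rightarrow> real) set)"
    by (rule measurable_cong_sets) (auto simp: sets_M)
  then show ?thesis
    unfolding F_dom_def L2_def by (auto simp: energy_eq sqn_def ennreal_mult_less_top)
qed

sublocale jump_form M J "E_hat j D" "F_dom j D"
  by unfold_locales (use AE_J_fst AE_J_snd E_hat_eq F_dom_eq sets_M sets_J in auto)


section \<open>Comparison with the kernel on the whole space and energy estimates\<close>

lemma full_kernel_integral:
  assumes [measurable]: "f \<in> borel_measurable (borel \<Otimes>\<^sub>M borel)"
  shows "(\<integral>\<^sup>+x. \<integral>\<^sup>+y. ennreal (kappa (x - y)) * f (x, y) \<partial>lborel \<partial>lborel) =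
    (\<integral>\<^sup>+t. ennreal (kappa t) * (\<integral>\<^sup>+y. f (y + t, y) \<partial>lborel) \<partial>lborel)"
proof -
  have "(\<integral>\<^sup>+x. \<integral>\<^sup>+y. ennreal (kappa (x - y)) * f (x, y) \<partial>lborel \<partial>lborel) =
      (\<integral>\<^sup>+y. \<integral>\<^sup>+x. ennreal (kappa (x - y)) * f (x, y) \<partial>lborel \<partial>lborel)"
    by (rule lborel_pair.Fubini'[symmetric]) measurable
  also have "\<dots> = (\<integral>\<^sup>+y. \<integral>\<^sup>+t. ennreal (kappa t) * f (y + t, y) \<partial>lborel \<partial>lborel)"
  proof (rule nn_integral_cong)
    fix y :: 'a
    show "(\<integral>\<^sup>+x. ennreal (kappa (x - y)) * f (x, y) \<partial>lborel) =
        (\<integral>\<^sup>+t. ennreal (kappa t) * f (y + t, y) \<partial>lborel)"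
      using nn_integral_lborel_shift[of "\<lambda>x. ennreal (kappa (x - y)) * f (x, y)" y] by simp
  qed
  also have "\<dots> = (\<integral>\<^sup>+t. \<integral>\<^sup>+y. ennreal (kappa t) * f (y + t, y) \<partial>lborel \<partial>lborel)"
    by (rule lborel_pair.Fubini') measurable
  also have "\<dots> = (\<integral>\<^sup>+t. ennreal (kappa t) * (\<integral>\<^sup>+y. f (y + t, y) \<partial>lborel) \<partial>lborel)"
    by (intro nn_integral_cong nn_integral_cmult) measurable
  finally show ?thesis .
qed

lemma nn_integral_J_le_full:
  assumes [measurable]: "f \<in> borel_measurable (borel \<Otimes>\<^sub>M borel)"
  shows "(\<integral>\<^sup>+p. f p \<partial>J) \<le> (\<integral>\<^sup>+t. ennreal (kappa t) * (\<integral>\<^sup>+y. f (y + t, y) \<partial>lborel) \<partial>lborel)"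
proof -
  have "(\<integral>\<^sup>+p. f p \<partial>J) \<le> (\<integral>\<^sup>+x. \<integral>\<^sup>+y. ennreal (kappa (x - y)) * f (x, y) \<partial>lborel \<partial>lborel)"
    unfolding nn_integral_J[OF assms]
    by (intro nn_integral_mono mult_right_mono) (auto simp: indicator_def kappa_nonneg)
  then show ?thesis by (simp add: full_kernel_integral)
qed

text \<open>Meant for functions vanishing off \<open>D\<close>: their increments are 0 on removed
  pairs, so their energy is that of the whole space, written as an integral over jump vectors
  \<open>t\<close> of translation differences.\<close>

lemma nn_integral_J_eq_full:
  assumes [measurable]: "f \<in> borel_measurable (borel \<Otimes>\<^sub>M borel)"
    and f: "\<And>p. p \<notin> good \<Longrightarrow> f p = 0"
  shows "(\<integral>\<^sup>+p. f p \<partial>J) = (\<integral>\<^sup>+t. ennreal (kappa t) * (\<integral>\<^sup>+y. f (y + t, y) \<partial>lborel) \<partial>lborel)"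
proof -
  have "ennreal (indicator good (x, y) * kappa (x - y)) * f (x, y) = ennreal (kappa (x - y)) * f (x, y)" for x y
    using f[of "(x, y)"] by (cases "(x, y) \<in> good") auto
  then show ?thesis unfolding nn_integral_J[OF assms(1)] by (simp add: full_kernel_integral)
qed

definition C1 :: ennreal where
  "C1 = (\<integral>\<^sup>+t. ennreal (kappa t) * ennreal ((min 1 (norm t))\<^sup>2) \<partial>lborel)"

lemma C1_finite: "C1 < \<infinity>"
proof -
  have "C1 = (\<integral>\<^sup>+x. ennreal (min 1 ((norm x)\<^sup>2) * j (norm x)) \<partial>(lborel :: 'a measure))"
    unfolding C1_def
  proof (intro nn_integral_cong)
    fix x :: 'a
    have "(min 1 (norm x))\<^sup>2 = min 1 ((norm x)\<^sup>2)"
      using power_le_one_iff[of "norm x" 2] by (auto simp: min_def)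
    then show "ennreal (kappa x) * ennreal ((min 1 (norm x))\<^sup>2) = ennreal (min 1 ((norm x)\<^sup>2) * j (norm x))"
      using j_pos[of "norm x"] by (cases "x = 0") (auto simp: kappa_def ennreal_mult' mult.commute)
  qed
  then show ?thesis using j_integrable by simp
qed

lemma D_emeasure_finite: "emeasure lborel D < \<infinity>"
  by (rule emeasure_bounded_finite[OF D_bounded])

lemma C1_shift: "(\<integral>\<^sup>+x. ennreal (kappa (x - y)) * ennreal ((min 1 (dist x y))\<^sup>2) \<partial>lborel) = C1"
proof -
  have "C1 = (\<integral>\<^sup>+x. ennreal (kappa (- y + x)) * ennreal ((min 1 (norm (- y + x)))\<^sup>2) \<partial>lborel)"
    unfolding C1_def by (rule nn_integral_lborel_shift[symmetric]) simp
  then show ?thesis by (simp add: dist_norm)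
qed

lemma C1_D: "(\<integral>\<^sup>+x. \<integral>\<^sup>+y. indicator D y * (ennreal (kappa (x - y)) * ennreal ((min 1 (dist x y))\<^sup>2)) \<partial>lborel \<partial>lborel)
    = emeasure lborel D * C1"
proof -
  have "(\<integral>\<^sup>+x. \<integral>\<^sup>+y. indicator D y * (ennreal (kappa (x - y)) * ennreal ((min 1 (dist x y))\<^sup>2)) \<partial>lborel \<partial>lborel)
     = (\<integral>\<^sup>+y. \<integral>\<^sup>+x. indicator D y * (ennreal (kappa (x - y)) * ennreal ((min 1 (dist x y))\<^sup>2)) \<partial>lborel \<partial>lborel)"
    by (rule lborel_pair.Fubini'[symmetric]) measurable
  also have "\<dots> = (\<integral>\<^sup>+y. indicator D y * C1 \<partial>lborel)"
    by (subst nn_integral_cmult) (auto simp: C1_shift)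
  also have "\<dots> = emeasure lborel D * C1"
    by (subst nn_integral_multc) auto
  finally show ?thesis .
qed

text \<open>Every admissible pair has an endpoint in \<open>D\<close>; integrating over the other
  endpoint gives \<open>C1\<close>, and \<open>D\<close> has finite Lebesgue measure.\<close>

lemma J_min: "sqn J (\<lambda>p. min 1 (dist (fst p) (snd p))) < \<infinity>"
proof -
  let ?d = "\<lambda>x y. ennreal (kappa (x - y)) * ennreal ((min 1 (dist x y))\<^sup>2)"
  have "sqn J (\<lambda>p. min 1 (dist (fst p) (snd p))) =
    (\<integral>\<^sup>+x. \<integral>\<^sup>+y. ennreal (indicator good (x, y) * kappa (x - y)) * ennreal ((min 1 (dist x y))\<^sup>2) \<partial>lborel \<partial>lborel)"
    unfolding sqn_def by (subst nn_integral_J) auto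
  also have "\<dots> \<le> (\<integral>\<^sup>+x. \<integral>\<^sup>+y. indicator D x * ?d x y + indicator D y * ?d x y \<partial>lborel \<partial>lborel)"
    by (intro nn_integral_mono) (auto simp: indicator_def good_iff)
  also have "\<dots> = (\<integral>\<^sup>+x. indicator D x * C1 \<partial>lborel) + emeasure lborel D * C1"
  proof -
    have "(\<integral>\<^sup>+y. ?d x y \<partial>lborel) = C1" for x
      using C1_shift[of x] by (simp add: kappa_commute[of x] dist_commute[of x])
    then show ?thesis by (simp add: nn_integral_add nn_integral_cmult C1_D)
  qed
  also have "(\<integral>\<^sup>+x. indicator D x * C1 \<partial>lborel) = emeasure lborel D * C1"
    by (subst nn_integral_multc) auto
  also have "emeasure lborel D * C1 + emeasure lborel D * C1 < \<infinity>"
    using C1_finite D_emeasure_finite by (simp add: ennreal_mult_less_top)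
  finally show ?thesis .
qed

lemma sqn_J_lipschitz_finite:
  assumes L: "\<And>x y. \<bar>f x - f y\<bar> \<le> L * dist x y" and B: "\<And>x. \<bar>f x\<bar> \<le> B"
  shows "sqn J (incr f) < \<infinity>"
proof -
  \<comment> \<open>\<open>\<bar>L\<bar>\<close> serves distances up to 1 and
    \<open>2 * \<bar>B\<bar>\<close> the larger ones.\<close>
  define C where "C = \<bar>L\<bar> + 2 * \<bar>B\<bar>"
  have "\<bar>f x - f y\<bar> \<le> C * min 1 (dist x y)" for x y
  proof (cases "dist x y \<le> 1")
    case True
    have "L * dist x y \<le> C * dist x y" unfolding C_def by (intro mult_right_mono) auto
    then show ?thesis using L[of x y] True by (simp add: min_def)
  next
    case False
    have "\<bar>f x - f y\<bar> \<le> C" using B[of x] B[of y] unfolding C_def by linarith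
    then show ?thesis using False by (simp add: min_def)
  qed
  moreover have "0 \<le> C" by (simp add: C_def)
  ultimately have "sqn J (incr f) \<le> sqn J (\<lambda>p. C * min 1 (dist (fst p) (snd p)))"
    by (intro sqn_mono) (simp add: incr_def abs_mult)
  also have "\<dots> = ennreal (C\<^sup>2) * sqn J (\<lambda>p. min 1 (dist (fst p) (snd p)))"
  proof (rule sqn_cmult)
    show "(\<lambda>p. min 1 (dist (fst p) (snd p))) \<in> borel_measurable J"
      unfolding measurable_cong_sets[OF sets_J refl] by measurable
  qed
  also have "\<dots> < \<infinity>" using J_min by (simp add: ennreal_mult_less_top)
  finally show ?thesis .
qed

text \<open>On an admissible pair one endpoint lies in \<open>D\<close>, where \<open>w\<close>
  vanishes. Integrating out that endpoint turns the squared value at the other one into an integral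
  against \<open>mu\<close>; the factor 2 counts the two orders.\<close>

lemma sqn_J_le_if_0_on_D:
  assumes [measurable]: "w \<in> borel_measurable borel" and w0: "\<And>x. x \<in> D \<Longrightarrow> w x = 0"
  shows "sqn J (incr w) \<le> 2 * sqn M w"
proof -
  have part: "(\<integral>\<^sup>+p. indicator D (snd p) * ennreal ((w (fst p))\<^sup>2) \<partial>J) \<le> sqn M w"
  proof -
    have "(\<integral>\<^sup>+p. indicator D (snd p) * ennreal ((w (fst p))\<^sup>2) \<partial>J) =
      (\<integral>\<^sup>+x. \<integral>\<^sup>+y. ennreal (indicator good (x, y) * kappa (x - y)) * (indicator D y * ennreal ((w x)\<^sup>2)) \<partial>lborel \<partial>lborel)"
      by (subst nn_integral_J) auto
    also have "\<dots> \<le> (\<integral>\<^sup>+x. rho x * ennreal ((w x)\<^sup>2) \<partial>lborel)"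
    proof (rule nn_integral_mono)
      fix x
      show "(\<integral>\<^sup>+y. ennreal (indicator good (x, y) * kappa (x - y)) * (indicator D y * ennreal ((w x)\<^sup>2)) \<partial>lborel)
          \<le> rho x * ennreal ((w x)\<^sup>2)"
      proof (cases "x \<in> D")
        case True
        then show ?thesis by (simp add: w0)
      next
        case False
        have "(\<integral>\<^sup>+y. ennreal (indicator good (x, y) * kappa (x - y)) * (indicator D y * ennreal ((w x)\<^sup>2)) \<partial>lborel)
          = (\<integral>\<^sup>+y. (indicator D y * ennreal (kappa (x - y))) * ennreal ((w x)\<^sup>2) \<partial>lborel)"
          by (intro nn_integral_cong) (auto simp: indicator_def good_iff)
        also have "\<dots> = rho x * ennreal ((w x)\<^sup>2)"
          using False by (subst nn_integral_multc) (auto simp: rho_notin_D)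
        finally show ?thesis by simp
      qed
    qed
    also have "\<dots> = sqn M w" unfolding sqn_def by (subst nn_integral_M) auto
    finally show ?thesis .
  qed
  have "sqn J (incr w) \<le> (\<integral>\<^sup>+p. indicator D (snd p) * ennreal ((w (fst p))\<^sup>2)
      + indicator D (fst p) * ennreal ((w (snd p))\<^sup>2) \<partial>J)"
  proof -
    have "AE p in J. p \<in> good"
      unfolding J_def by (subst AE_density) (auto simp: indicator_def)
    then show ?thesis unfolding sqn_def
    proof (intro nn_integral_mono_AE, eventually_elim)
      case (elim p)
      then show ?case using w0[of "fst p"] w0[of "snd p"]
        by (auto simp: good_iff incr_def indicator_def)
    qed
  qed
  also have "\<dots> = (\<integral>\<^sup>+p. indicator D (snd p) * ennreal ((w (fst p))\<^sup>2) \<partial>J)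
      + (\<integral>\<^sup>+p. indicator D (fst p) * ennreal ((w (snd p))\<^sup>2) \<partial>J)"
    by (rule nn_integral_add) (simp_all add: measurable_cong_sets[OF sets_J refl])
  also have "(\<integral>\<^sup>+p. indicator D (fst p) * ennreal ((w (snd p))\<^sup>2) \<partial>J) =
      (\<integral>\<^sup>+p. indicator D (snd p) * ennreal ((w (fst p))\<^sup>2) \<partial>J)"
    by (subst nn_integral_J_swap) auto
  finally show ?thesis using part by (simp add: mult_2 add_mono order_trans)
qed

lemma F_if_0_on_D:
  assumes [measurable]: "w \<in> borel_measurable borel" and w0: "\<And>x. x \<in> D \<Longrightarrow> w x = 0"
    and "sqn M w < \<infinity>"
  shows "w \<in> F_dom j D"
proof -
  have "2 * sqn M w < \<infinity>" using assms(3) by (simp add: ennreal_mult_less_top)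
  then show ?thesis using assms sqn_J_le_if_0_on_D[of w]
    by (intro F_I) (auto elim: le_less_trans)
qed

lemma sqn_M_0_off_D:
  assumes [measurable]: "w \<in> borel_measurable borel" and w0: "\<And>x. x \<notin> D \<Longrightarrow> w x = 0"
  shows "sqn M w = sqn lborel w"
proof -
  have "sqn M w = (\<integral>\<^sup>+x. rho x * ennreal ((w x)\<^sup>2) \<partial>lborel)"
    unfolding sqn_def by (subst nn_integral_M) auto
  also have "\<dots> = sqn lborel w" unfolding sqn_def
  proof (rule nn_integral_cong)
    fix x show "rho x * ennreal ((w x)\<^sup>2) = ennreal ((w x)\<^sup>2)"
      using w0[of x] rho_D[of x] by (cases "x \<in> D") auto
  qed
  finally show ?thesis .
qed

text \<open>At distance at least \<open>s\<close> from \<open>D\<close> all jump rates into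
  \<open>D\<close> are at most \<open>j s\<close>, so \<open>mu\<close> is bounded and
  \<open>M\<close> is controlled by Lebesgue measure.\<close>

lemma sqn_M_le_away_from_D:
  assumes [measurable]: "w \<in> borel_measurable borel" and s: "0 < s"
    and w0: "\<And>x. infdist x D < s \<Longrightarrow> w x = 0"
  shows "sqn M w \<le> ennreal (j s) * emeasure lborel D * sqn lborel w"
proof -
  have rho_le: "rho x \<le> ennreal (j s) * emeasure lborel D" if x: "s \<le> infdist x D" for x
  proof -
    have xD: "x \<notin> D" using x s by auto
    have "kappa (x - y) \<le> j s" if y: "y \<in> D" for y
    proof -
      have "s \<le> norm (x - y)" using x infdist_le[OF y, of x] by (simp add: dist_norm)
      then show ?thesis using j_antimono s by (auto simp: kappa_def monotone_on_def)
    qed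
    then have "rho x \<le> (\<integral>\<^sup>+y. indicator D y * ennreal (j s) \<partial>lborel)"
      unfolding rho_notin_D[OF xD]
      by (intro nn_integral_mono) (auto simp: indicator_def intro!: ennreal_leI)
    also have "\<dots> = ennreal (j s) * emeasure lborel D"
      by (subst nn_integral_multc) (auto simp: mult.commute)
    finally show ?thesis .
  qed
  have "sqn M w = (\<integral>\<^sup>+x. rho x * ennreal ((w x)\<^sup>2) \<partial>lborel)"
    unfolding sqn_def by (subst nn_integral_M) auto
  also have "\<dots> \<le> (\<integral>\<^sup>+x. (ennreal (j s) * emeasure lborel D) * ennreal ((w x)\<^sup>2) \<partial>lborel)"
  proof (rule nn_integral_mono)
    fix x show "rho x * ennreal ((w x)\<^sup>2) \<le> (ennreal (j s) * emeasure lborel D) * ennreal ((w x)\<^sup>2)"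
      using w0[of x] rho_le[of x] by (cases "infdist x D < s") (auto intro!: mult_right_mono)
  qed
  also have "\<dots> = ennreal (j s) * emeasure lborel D * sqn lborel w"
    unfolding sqn_def by (rule nn_integral_cmult) simp
  finally show ?thesis .
qed

section \<open>The comparison measure and continuous approximation\<close>

lemma AE_M_if_AE_lborel:
  assumes "AE x in lborel. P x" shows "AE x in M. P x"
  unfolding M_eq using assms by (subst AE_density) (auto elim: eventually_mono)

lemma AE_M_frontier: "AE x in M. x \<notin> frontier D"
  by (rule AE_M_if_AE_lborel, rule AE_not_in) (use D_frontier in \<open>auto intro!: null_setsI\<close>)

text \<open>\<open>min 1 rho\<close> vanishes exactly where \<open>rho\<close> does, so
  \<open>R\<close> has the null sets of \<open>M\<close>; at the same time \<open>R\<close> lies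
  below both \<open>M\<close> and Lebesgue measure, so errors can be estimated in whichever is
  available.\<close>

definition R :: "'a measure" where
  "R = density lborel (\<lambda>x. min 1 (rho x))"

lemma sets_R: "sets R = sets borel" by (simp add: R_def)

lemma AE_R: "AE x in R. P x \<Longrightarrow> AE x in M. P x"
  unfolding R_def M_eq by (simp add: AE_density)

lemma sqn_R_le:
  assumes [measurable]: "f \<in> borel_measurable borel"
  shows sqn_R_le_lborel: "sqn R f \<le> sqn lborel f" and sqn_R_le_M: "sqn R f \<le> sqn M f"
proof -
  have R: "sqn R f = (\<integral>\<^sup>+x. min 1 (rho x) * ennreal ((f x)\<^sup>2) \<partial>lborel)"
    unfolding sqn_def R_def by (rule nn_integral_density) auto
  have "sqn R f \<le> (\<integral>\<^sup>+x. 1 * ennreal ((f x)\<^sup>2) \<partial>lborel)"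
    unfolding R by (intro nn_integral_mono mult_right_mono) auto
  then show "sqn R f \<le> sqn lborel f" by (simp add: sqn_def)
  have "sqn R f \<le> (\<integral>\<^sup>+x. rho x * ennreal ((f x)\<^sup>2) \<partial>lborel)"
    unfolding R by (intro nn_integral_mono mult_right_mono) auto
  then show "sqn R f \<le> sqn M f" unfolding sqn_def by (subst nn_integral_M) auto
qed

text \<open>The quantity in which continuous approximation takes place. Unlike \<open>N\<close> it
  can be small for \<open>u - v\<close> although \<open>v\<close> is not square integrable under
  \<open>M\<close>.\<close>

definition S :: "('a \<Rightarrow> real) \<Rightarrow> ennreal" where
  "S u = sqn J (incr u) + sqn R u"

lemma incr_meas_J: "u \<in> borel_measurable borel \<Longrightarrow> incr u \<in> borel_measurable J"
  unfolding measurable_cong_sets[OF sets_J refl] by (rule incr_measurable)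

lemma meas_R: "u \<in> borel_measurable borel \<Longrightarrow> u \<in> borel_measurable R"
  unfolding measurable_cong_sets[OF sets_R refl] .

lemma S_add:
  assumes "u \<in> borel_measurable borel" "v \<in> borel_measurable borel"
  shows "S (\<lambda>x. u x + v x) \<le> 2 * S u + 2 * S v"
proof -
  have "S (\<lambda>x. u x + v x) \<le> (2 * sqn J (incr u) + 2 * sqn J (incr v)) + (2 * sqn R u + 2 * sqn R v)"
    unfolding S_def incr_add using assms by (intro add_mono sqn_add incr_meas_J meas_R)
  then show ?thesis by (simp add: S_def algebra_simps)
qed

lemma S_le_N:
  assumes "u \<in> borel_measurable borel"
  shows "S u \<le> 2 * N u"
proof -
  have "2 * N u = 2 * sqn M u + 2 * ennreal (1/2) * sqn J (incr u)"
    by (simp add: N_def distrib_left mult.assoc)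
  also have "2 * ennreal (1/2) = ennreal (2 * (1/2))" by (subst ennreal_mult) simp_all
  finally have "2 * N u = 2 * sqn M u + sqn J (incr u)" by simp
  moreover have "sqn R u \<le> 2 * sqn M u"
    using sqn_R_le_M[OF assms] by (simp add: mult_2 add_increasing)
  ultimately show ?thesis by (simp add: S_def add.commute add_left_mono)
qed

lemma S_le_if_0_on_D:
  assumes "w \<in> borel_measurable borel" "\<And>x. x \<in> D \<Longrightarrow> w x = 0"
  shows "S w \<le> 3 * sqn M w"
proof -
  have "S w \<le> 2 * sqn M w + sqn M w"
    unfolding S_def by (intro add_mono sqn_J_le_if_0_on_D sqn_R_le_M assms)
  also have "\<dots> = (2 + 1) * sqn M w" by (simp only: distrib_right mult_1)
  finally show ?thesis by simp
qed

text \<open>Mollification commutes with translations and contracts \<open>L\<^sup>2\<close>, hence the translation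
  increments of the mollified function are dominated by those of \<open>f\<close>.\<close>

lemma ex_mollify_close_D:
  assumes [measurable]: "f \<in> borel_measurable borel" and bdd: "\<And>x. \<bar>f x\<bar> \<le> B"
    and f0: "\<And>x. x \<notin> D \<Longrightarrow> f x = 0" and fJ: "sqn J (incr f) < \<infinity>" and e: "0 < e"
  shows "\<exists>v. continuous_on UNIV v \<and> S (\<lambda>x. f x - v x) < ennreal e"
proof -
  obtain c where c: "\<And>x. x \<in> D \<Longrightarrow> norm x \<le> c" using D_bounded by (auto simp: bounded_iff)
  have supp: "f x = 0" if "c < norm x" for x using c[of x] f0[of x] that by fastforce
  have "\<forall>n. \<exists>r>0. sqn lborel (\<lambda>x. f x - mollify r f x) < ennreal (1 / real (Suc n))"
  proof
    fix n
    obtain r0 where "0 < r0" "\<forall>r. 0 < r \<and> r \<le> r0 \<longrightarrow> sqn lborel (\<lambda>x. f x - mollify r f x) < ennreal (1 / real (Suc n))"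
      using sqn_mollify_diff[OF assms(1) bdd supp, where e="1 / real (Suc n)"] by auto
    then show "\<exists>r>0. sqn lborel (\<lambda>x. f x - mollify r f x) < ennreal (1 / real (Suc n))"
      by (intro exI[of _ r0]) auto
  qed
  then obtain r where r: "\<And>n. 0 < r n" and rl: "\<And>n. sqn lborel (\<lambda>x. f x - mollify (r n) f x) < ennreal (1 / real (Suc n))"
    by metis
  define v where "v n = mollify (r n) f" for n
  have [measurable]: "v n \<in> borel_measurable borel" for n unfolding v_def by (rule mollify_measurable[OF r]) simp
  have lim_inv: "(\<lambda>n. ennreal (1 / real (Suc n))) \<longlonglongrightarrow> 0"
    using tendsto_ennrealI[OF LIMSEQ_inverse_real_of_nat] by (simp add: inverse_eq_divide)
  have lim: "(\<lambda>n. sqn lborel (\<lambda>x. f x - v n x)) \<longlonglongrightarrow> 0"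
    by (rule tendsto_0_le_ennreal[OF lim_inv]) (use rl in \<open>auto simp: v_def intro: less_imp_le\<close>)
  define T where "T t g = sqn lborel (\<lambda>y. g (y + t) - g y)" for t :: 'a and g :: "'a \<Rightarrow> real"
  have T_meas: "(\<lambda>t. T t g) \<in> borel_measurable borel" if [measurable]: "g \<in> borel_measurable borel" for g
    unfolding T_def sqn_def by measurable
  have full: "sqn J (incr g) \<le> (\<integral>\<^sup>+t. ennreal (kappa t) * T t g \<partial>lborel)"
    if [measurable]: "g \<in> borel_measurable borel" for g
    using nn_integral_J_le_full[of "\<lambda>p. ennreal ((incr g p)\<^sup>2)"] by (simp add: sqn_def T_def incr_def)
  \<comment> \<open>Equality holds for \<open>f\<close>, which vanishes off \<open>D\<close>, and
    makes the majorant integrable. Mollified functions spill over the boundary, so for the errors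
    only the inequality \<open>full\<close> is available.\<close>
  have full_f: "sqn J (incr f) = (\<integral>\<^sup>+t. ennreal (kappa t) * T t f \<partial>lborel)"
    using nn_integral_J_eq_full[of "\<lambda>p. ennreal ((incr f p)\<^sup>2)"] f0
    by (simp add: sqn_def T_def incr_def good_iff)
  have Tv: "T t (v n) \<le> T t f" for t n
  proof -
    have b: "\<bar>f (y + t) - f y\<bar> \<le> B + B" for y using bdd[of "y + t"] bdd[of y] by linarith
    have "v n (y + t) - v n y = mollify (r n) (\<lambda>y. f (y + t) - f y) y" for y
      unfolding v_def mollify_shift[OF r, symmetric]
      by (rule mollify_diff[OF r _ _ bdd bdd, symmetric]) simp_all
    then show ?thesis unfolding T_def by (simp only:) (rule sqn_mollify_le[OF r _ b], simp)
  qed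
  have T_diff: "T t (\<lambda>x. f x - v n x) \<le> 4 * T t f" for t n
  proof -
    have "T t (\<lambda>x. f x - v n x) = sqn lborel (\<lambda>y. (f (y + t) - f y) - (v n (y + t) - v n y))"
      by (simp add: T_def algebra_simps)
    also have "\<dots> \<le> 2 * T t f + 2 * T t (v n)" unfolding T_def by (rule sqn_diff) auto
    also have "\<dots> \<le> 2 * T t f + 2 * T t f" by (intro add_left_mono mult_left_mono Tv) auto
    also have "\<dots> = (2 + 2) * T t f" by (simp only: distrib_right)
    finally show ?thesis by simp
  qed
  have T_lim: "(\<lambda>n. T t (\<lambda>x. f x - v n x)) \<longlonglongrightarrow> 0" for t
  proof -
    \<comment> \<open>For each fixed jump vector, translation invariance bounds the translation
      difference of the error by the error itself.\<close>
    have le: "T t (\<lambda>x. f x - v n x) \<le> 4 * sqn lborel (\<lambda>x. f x - v n x)" for n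
    proof -
      have "T t (\<lambda>x. f x - v n x) \<le> 2 * sqn lborel (\<lambda>y. f (y + t) - v n (y + t)) + 2 * sqn lborel (\<lambda>x. f x - v n x)"
        unfolding T_def by (rule sqn_diff) auto
      also have "sqn lborel (\<lambda>y. f (y + t) - v n (y + t)) = sqn lborel (\<lambda>x. f x - v n x)"
        by (rule sqn_lborel_shift) simp
      also have "2 * sqn lborel (\<lambda>x. f x - v n x) + 2 * sqn lborel (\<lambda>x. f x - v n x) =
          (2 + 2) * sqn lborel (\<lambda>x. f x - v n x)" by (simp only: distrib_right)
      finally show ?thesis by simp
    qed
    have "(\<lambda>n. 4 * sqn lborel (\<lambda>x. f x - v n x)) \<longlonglongrightarrow> 4 * 0"
      by (intro ennreal_tendsto_cmult lim) simp
    then show ?thesis by (intro tendsto_0_le_ennreal[OF _ le]) simp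
  qed
  have "(\<lambda>n. \<integral>\<^sup>+t. ennreal (kappa t) * T t (\<lambda>x. f x - v n x) \<partial>lborel) \<longlonglongrightarrow> (\<integral>\<^sup>+t. 0 \<partial>(lborel :: 'a measure))"
  proof (rule nn_integral_dominated_convergence[where w="\<lambda>t. ennreal (kappa t) * (4 * T t f)"])
    show "(\<integral>\<^sup>+t. ennreal (kappa t) * (4 * T t f) \<partial>lborel) < \<infinity>"
    proof -
      have "(\<integral>\<^sup>+t. ennreal (kappa t) * (4 * T t f) \<partial>lborel) = (\<integral>\<^sup>+t. 4 * (ennreal (kappa t) * T t f) \<partial>lborel)"
        by (simp add: mult_ac)
      also have "\<dots> = 4 * sqn J (incr f)"
        unfolding full_f using T_meas[of f] by (intro nn_integral_cmult) simp
      finally show ?thesis using fJ by (simp add: ennreal_mult_less_top)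
    qed
    show "AE t in lborel. (\<lambda>n. ennreal (kappa t) * T t (\<lambda>x. f x - v n x)) \<longlonglongrightarrow> 0"
      using ennreal_tendsto_cmult[OF ennreal_less_top T_lim] by simp
    show "AE t in lborel. ennreal (kappa t) * T t (\<lambda>x. f x - v n x) \<le> ennreal (kappa t) * (4 * T t f)" for n
      by (intro AE_I2 mult_left_mono T_diff) simp
  qed (use T_meas in auto)
  then have "(\<lambda>n. sqn J (incr (\<lambda>x. f x - v n x))) \<longlonglongrightarrow> 0"
    by (intro tendsto_0_le_ennreal[where f="\<lambda>n. sqn J (incr (\<lambda>x. f x - v n x))", OF _ full]) simp_all
  moreover have "(\<lambda>n. sqn R (\<lambda>x. f x - v n x)) \<longlonglongrightarrow> 0"
    by (rule tendsto_0_le_ennreal[OF lim]) (rule sqn_R_le_lborel, simp)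
  ultimately have "(\<lambda>n. S (\<lambda>x. f x - v n x)) \<longlonglongrightarrow> 0 + 0"
    unfolding S_def by (rule tendsto_add)
  then have "\<forall>\<^sub>F n in sequentially. S (\<lambda>x. f x - v n x) < ennreal e"
    using order_tendstoD(2)[of _ "0 + 0" _ "ennreal e"] e by simp
  then obtain n where "S (\<lambda>x. f x - v n x) < ennreal e" by (auto simp: eventually_sequentially)
  moreover have "continuous_on UNIV (v n)"
    unfolding v_def by (rule mollify_continuous[OF r _ bdd supp]) simp_all
  ultimately show ?thesis by blast
qed

end

lemma borel_measurable_infdist[measurable]:
  "(\<lambda>x. infdist x A) \<in> borel_measurable (borel :: 'a::metric_space measure)"
  by (intro borel_measurable_continuous_onI continuous_on_infdist continuous_on_id)

context censored_kernel
begin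

lemma S_diff_trans:
  assumes [measurable]: "u \<in> borel_measurable borel" "v \<in> borel_measurable borel" "w \<in> borel_measurable borel"
    and "S (\<lambda>x. u x - v x) < ennreal (e/4)" "S (\<lambda>x. v x - w x) < ennreal (e/4)"
  shows "S (\<lambda>x. u x - w x) < ennreal e"
proof -
  have e: "0 < e" using assms(4) by (cases "0 < e") (auto simp: ennreal_neg)
  have "S (\<lambda>x. u x - w x) \<le> 2 * S (\<lambda>x. u x - v x) + 2 * S (\<lambda>x. v x - w x)"
    using S_add[of "\<lambda>x. u x - v x" "\<lambda>x. v x - w x"] by simp
  also have "\<dots> < 2 * ennreal (e/4) + 2 * ennreal (e/4)"
    using assms(4,5) by (intro add_strict_mono ennreal_mult_strict_left_mono) auto
  also have "\<dots> = ennreal (2 * (e/4) + 2 * (e/4))"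
    using e by (simp flip: ennreal_plus ennreal_mult ennreal_numeral)
  finally show ?thesis by simp
qed

text \<open>\<open>infdist x {}\<close> is 0 by convention, so distance arguments break down for
  empty \<open>D\<close>; but then \<open>M\<close> is the zero measure.\<close>

lemma M_trivial_if_empty:
  assumes "D = {}" shows "AE x in M. P x"
proof -
  have "rho x = 0" for x using assms rho_notin_D[of x] by simp
  then show ?thesis unfolding M_eq by (simp add: AE_density)
qed

text \<open>Restrict \<open>w\<close> to a bounded region at positive distance from \<open>D\<close>
  and mollify at a smaller scale: every function involved then vanishes on \<open>D\<close>, so
  energy reduces to \<open>sqn M\<close>, which is controlled by Lebesgue measure away from
  \<open>D\<close>.\<close>

lemma ex_mollify_close_exterior:
  assumes [measurable]: "w \<in> borel_measurable borel" and bdd: "\<And>x. \<bar>w x\<bar> \<le> B"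
    and w0: "\<And>x. x \<in> D \<Longrightarrow> w x = 0" and wM: "sqn M w < \<infinity>" and e: "0 < e"
  shows "\<exists>v. continuous_on UNIV v \<and> S (\<lambda>x. w x - v x) < ennreal e"
proof (cases "D = {}")
  case True
  have "sqn M w = 0"
    by (subst sqn_eq_0_iff) (auto simp: borel_measurable_M intro: M_trivial_if_empty[OF True])
  then have "S w \<le> 0" using S_le_if_0_on_D[OF assms(1) w0] by simp
  then show ?thesis using e by (intro exI[of _ "\<lambda>x. 0"]) simp
next
  case False
  define A where "A n = {x. 1 / real (Suc n) \<le> infdist x D \<and> norm x \<le> real n}" for n
  have [measurable]: "A n \<in> sets borel" for n unfolding A_def by measurable
  define f where "f n x = w x * indicator (A n) x" for n x
  have [measurable]: "f n \<in> borel_measurable borel" for n unfolding f_def by measurable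
  have f_bdd: "\<bar>f n x\<bar> \<le> B" for n x using bdd[of x] by (auto simp: f_def indicator_def)
  have f_supp: "f n x = 0" if "real n < norm x" for n x using that by (auto simp: f_def A_def)
  have f_near: "f n x = 0" if "infdist x D < 1 / real (Suc n)" for n x
    using that by (auto simp: f_def A_def indicator_def simp del: of_nat_Suc)
  have "(\<lambda>n. sqn M (\<lambda>x. w x - f n x)) \<longlonglongrightarrow> 0"
  proof (rule sqn_dominated[OF _ _ _ wM])
    show "AE x in M. \<bar>w x - f n x\<bar> \<le> \<bar>w x\<bar>" for n by (auto simp: f_def indicator_def)
    show "AE x in M. (\<lambda>n. w x - f n x) \<longlonglongrightarrow> 0"
      using AE_M_frontier
    proof eventually_elim
      case (elim x)
      show ?case
      proof (cases "x \<in> D")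
        case True
        then show ?thesis by (simp add: w0 f_def)
      next
        case xD: False
        then have "x \<notin> closure D" using elim D_open by (auto simp: frontier_def interior_open)
        then have pos: "0 < infdist x D"
          using False in_closure_iff_infdist_zero[of D x] infdist_nonneg[of x D] by (simp add: less_le)
        obtain n1 :: nat where n1: "1 / infdist x D < real n1" using reals_Archimedean2 by blast
        obtain n2 :: nat where n2: "norm x \<le> real n2" using real_arch_simple by blast
        have "w x - f n x = 0" if "max n1 n2 \<le> n" for n
        proof -
          have "1 / infdist x D \<le> real (Suc n)" using n1 that by simp
          then have "1 / real (Suc n) \<le> infdist x D" using pos
            by (simp add: field_simps)
          moreover have "norm x \<le> real n" using n2 that by simp
          ultimately show ?thesis by (simp add: f_def A_def)
        qed
        then show ?thesis by (intro tendsto_eventually eventually_sequentiallyI[of "max n1 n2"])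
      qed
    qed
  qed (auto simp: borel_measurable_M)
  then have "\<forall>\<^sub>F n in sequentially. sqn M (\<lambda>x. w x - f n x) < ennreal (e / 12)"
    using order_tendstoD(2)[of _ 0 _ "ennreal (e / 12)"] e by simp
  then obtain n where n: "sqn M (\<lambda>x. w x - f n x) < ennreal (e / 12)" by (auto simp: eventually_sequentially)
  \<comment> \<open>The factor 3 turns the error \<open>e / 12\<close> into
    \<open>e / 4\<close>.\<close>
  have "S (\<lambda>x. w x - f n x) \<le> 3 * sqn M (\<lambda>x. w x - f n x)"
    by (rule S_le_if_0_on_D) (auto simp: w0 f_def)
  also have "\<dots> < 3 * ennreal (e / 12)"
    using n by (intro ennreal_mult_strict_left_mono) auto
  also have "\<dots> = ennreal (3 * (e / 12))" using e by (simp flip: ennreal_mult ennreal_numeral)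
  finally have S1: "S (\<lambda>x. w x - f n x) < ennreal (e / 4)" by simp
  \<comment> \<open>Half of the clearance of \<open>f n\<close>: mollifying at scale at most
    \<open>s\<close> leaves the other half free.\<close>
  define s where "s = 1 / real (Suc n) / 2"
  have s: "0 < s" by (simp add: s_def)
  define k where "k = j s * measure lborel D"
  have k: "0 \<le> k" using j_pos[OF s] by (simp add: k_def)
  have k_eq: "ennreal (j s) * emeasure lborel D = ennreal k"
    unfolding k_def using D_emeasure_finite j_pos[OF s]
    by (subst emeasure_eq_ennreal_measure) (auto simp: ennreal_mult)
  \<comment> \<open>With the factors 3 and \<open>k\<close> the error is at most
    \<open>3 * e / 13\<close>, just below \<open>e / 4\<close>; the summand 1 covers
    \<open>k = 0\<close>.\<close>
  have d: "0 < e / (13 * (k + 1))" using e k by simp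
  obtain r0 where r0: "0 < r0" "\<And>r. 0 < r \<Longrightarrow> r \<le> r0 \<Longrightarrow>
      sqn lborel (\<lambda>x. f n x - mollify r (f n) x) < ennreal (e / (13 * (k + 1)))"
    using sqn_mollify_diff[of "f n" B "real n", OF _ f_bdd f_supp d] by auto
  define r where "r = min r0 s"
  have r: "0 < r" using r0 s by (simp add: r_def)
  define v where "v = mollify r (f n)"
  have [measurable]: "v \<in> borel_measurable borel" unfolding v_def by (rule mollify_measurable[OF r]) simp
  have near0: "f n x - v x = 0" if x: "infdist x D < s" for x
  proof -
    have "f n x = 0" using x by (intro f_near) (simp add: s_def field_simps)
    moreover have "v x = 0" unfolding v_def
    proof (rule mollify_eq_0[OF r])
      fix z :: 'a assume z: "norm z < r"
      have "infdist (x + z) D \<le> infdist x D + dist (x + z) x" by (rule infdist_triangle)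
      also have "\<dots> < s + s" using x z by (simp add: r_def dist_norm)
      also have "s + s = 1 / real (Suc n)" by (simp only: s_def field_sum_of_halves)
      finally show "f n (x + z) = 0" by (rule f_near)
    qed
    ultimately show ?thesis by simp
  qed
  have "S (\<lambda>x. f n x - v x) \<le> 3 * sqn M (\<lambda>x. f n x - v x)"
    by (rule S_le_if_0_on_D) (use near0 s in \<open>auto simp: infdist_zero\<close>)
  also have "\<dots> \<le> 3 * (ennreal (j s) * emeasure lborel D * sqn lborel (\<lambda>x. f n x - v x))"
    by (intro mult_left_mono sqn_M_le_away_from_D[OF _ s near0]) auto
  also have "\<dots> \<le> 3 * (ennreal k * ennreal (e / (13 * (k + 1))))"
    unfolding k_eq using r0(2)[OF r] by (intro mult_left_mono) (auto simp: v_def r_def)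
  also have "\<dots> = ennreal (3 * (k * (e / (13 * (k + 1)))))"
    using k e by (simp flip: ennreal_mult ennreal_numeral)
  also have "\<dots> < ennreal (e / 4)"
  proof (rule ennreal_lessI)
    have "3 * (k * (e / (13 * (k + 1)))) = (3 * e / 13) * (k / (k + 1))" using k by (simp add: field_simps)
    also have "\<dots> \<le> (3 * e / 13) * 1" using k e by (intro mult_left_mono) auto
    also have "\<dots> < e / 4" using e by simp
    finally show "3 * (k * (e / (13 * (k + 1)))) < e / 4" .
  qed (use e in simp)
  finally have "S (\<lambda>x. f n x - v x) < ennreal (e / 4)" .
  from S_diff_trans[OF _ _ _ S1 this] have "S (\<lambda>x. w x - v x) < ennreal e" by simp
  moreover have "continuous_on UNIV v"
    unfolding v_def by (rule mollify_continuous[OF r _ f_bdd f_supp]) simp_all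
  ultimately show ?thesis by blast
qed

lemma approx:
  assumes u: "u \<in> F_dom j D" and e: "0 < e"
  shows "\<exists>v. continuous_on UNIV v \<and> sqn J (incr (\<lambda>x. u x - v x)) < ennreal e \<and>
    sqn R (\<lambda>x. u x - v x) < ennreal e"
proof -
  have "(\<lambda>n. N (\<lambda>x. u x - soft_clamp n (u x))) \<longlonglongrightarrow> 0"
    by (rule N_contraction_tendsto_0[OF u]) (auto intro: soft_clamp_contraction soft_clamp_tendsto)
  then have "\<forall>\<^sub>F n in sequentially. N (\<lambda>x. u x - soft_clamp n (u x)) < ennreal (e/8)"
    by (rule N_tendsto_0_D) (use e in simp)
  then obtain n where n: "N (\<lambda>x. u x - soft_clamp n (u x)) < ennreal (e/8)"
    by (auto simp: eventually_sequentially)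
  define u1 where "u1 x = soft_clamp n (u x)" for x
  have u_meas[measurable]: "u \<in> borel_measurable borel" using u by (rule F_meas)
  have [measurable]: "u1 \<in> borel_measurable borel" unfolding u1_def by measurable
  have u1F: "u1 \<in> F_dom j D"
  proof (rule F_contraction[OF u])
    show "\<bar>u1 x\<bar> \<le> \<bar>u x\<bar>" for x using soft_clamp_contraction[of n "u x" 0] by (simp add: u1_def)
    show "\<bar>u1 x - u1 y\<bar> \<le> \<bar>u x - u y\<bar>" for x y unfolding u1_def by (rule soft_clamp_contraction)
  qed simp
  have u1_bdd: "\<bar>u1 x\<bar> \<le> real n" for x unfolding u1_def by (rule soft_clamp_bounded)
  have "S (\<lambda>x. u x - u1 x) \<le> 2 * N (\<lambda>x. u x - u1 x)" by (rule S_le_N) simp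
  also have "\<dots> < 2 * ennreal (e/8)" using n by (intro ennreal_mult_strict_left_mono) (auto simp: u1_def)
  also have "\<dots> = ennreal (2 * (e/8))" using e by (simp flip: ennreal_mult ennreal_numeral)
  finally have S1: "S (\<lambda>x. u x - u1 x) < ennreal (e/4)" by simp
  \<comment> \<open>The decoupling: the exterior part lies in the domain by square integrability
    alone, hence so does the remaining part on \<open>D\<close>, and the two are approximated
    independently.\<close>
  define uE where "uE x = u1 x * indicator (- D) x" for x
  define uD where "uD x = u1 x - uE x" for x
  have [measurable]: "uE \<in> borel_measurable borel" "uD \<in> borel_measurable borel"
    unfolding uE_def uD_def by measurable
  have uE_bdd: "\<bar>uE x\<bar> \<le> real n" for x using u1_bdd[of x] by (auto simp: uE_def indicator_def)
  have uD_bdd: "\<bar>uD x\<bar> \<le> real n" for x using u1_bdd[of x] by (auto simp: uE_def uD_def indicator_def)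
  have "sqn M uE \<le> sqn M u1" by (rule sqn_mono) (auto simp: uE_def indicator_def)
  also have "\<dots> < \<infinity>" using u1F by (rule F_sqn)
  finally have uE_M: "sqn M uE < \<infinity>" .
  then have "uE \<in> F_dom j D" by (intro F_if_0_on_D) (auto simp: uE_def)
  then have "uD \<in> F_dom j D" unfolding uD_def by (intro F_diff u1F)
  then have uD_J: "sqn J (incr uD) < \<infinity>" by (rule F_incr)
  have e16: "0 < e/4/4" using e by simp
  obtain vE where vE: "continuous_on UNIV vE" "S (\<lambda>x. uE x - vE x) < ennreal (e/4/4)"
    using ex_mollify_close_exterior[OF _ uE_bdd _ uE_M e16] by (auto simp: uE_def)
  obtain vD where vD: "continuous_on UNIV vD" "S (\<lambda>x. uD x - vD x) < ennreal (e/4/4)"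
    using ex_mollify_close_D[OF _ uD_bdd _ uD_J e16] by (auto simp: uD_def uE_def)
  have [measurable]: "vE \<in> borel_measurable borel" "vD \<in> borel_measurable borel"
    using vE vD by (auto intro: borel_measurable_continuous_onI)
  have "S (\<lambda>x. u1 x - (vD x + vE x)) < ennreal (e/4)"
  proof (rule S_diff_trans[of _ "\<lambda>x. vD x + uE x"])
    show "S (\<lambda>x. u1 x - (vD x + uE x)) < ennreal (e/4/4)"
      using vD(2) by (simp add: uD_def algebra_simps)
    show "S (\<lambda>x. vD x + uE x - (vD x + vE x)) < ennreal (e/4/4)"
      using vE(2) by simp
  qed simp_all
  from S_diff_trans[OF _ _ _ S1 this] have "S (\<lambda>x. u x - (vD x + vE x)) < ennreal e" by simp
  moreover have "sqn J (incr w) \<le> S w" "sqn R w \<le> S w" for w by (auto simp: S_def)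
  moreover have "continuous_on UNIV (\<lambda>x. vD x + vE x)" by (intro continuous_intros vD vE)
  ultimately show ?thesis by (intro exI[of _ "\<lambda>x. vD x + vE x"]) (auto intro: le_less_trans)
qed

section \<open>Density of the domain and a strictly positive element\<close>

lemma complement_nonempty: "- D \<noteq> {}"
  using D_bounded not_bounded_UNIV by (metis Compl_empty_eq double_complement)

lemma infdist_complement_pos: "x \<in> D \<Longrightarrow> 0 < infdist x (- D)"
  using in_closed_iff_infdist_zero[of "- D" x] D_open complement_nonempty infdist_nonneg[of x "- D"]
  by (simp add: closed_Compl less_le)

text \<open>The exterior part of \<open>u\<close> already belongs to the domain. The part on
  \<open>D\<close>, cut off near the boundary, is mollified to Lipschitz functions vanishing off
  \<open>D\<close>, where \<open>M\<close> is Lebesgue measure and \<open>mu\<close> has no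
  influence.\<close>

lemma densely_defined: "densely_defined M (F_dom j D)"
  unfolding densely_defined_def
proof (intro ballI allI impI)
  fix u and e :: real assume u: "u \<in> L2 M" and e: "0 < e"
  have [measurable]: "u \<in> borel_measurable borel" using u by (simp add: L2_def borel_measurable_M)
  have uM: "sqn M u < \<infinity>" using u by (simp add: L2_def sqn_def)
  define uE where "uE x = u x * indicator (- D) x" for x
  have [measurable]: "uE \<in> borel_measurable borel" unfolding uE_def by measurable
  have "sqn M uE \<le> sqn M u" by (rule sqn_mono) (auto simp: uE_def indicator_def)
  then have uE: "uE \<in> F_dom j D" using uM
    by (intro F_if_0_on_D) (auto simp: uE_def intro: le_less_trans)
  define A where "A n = {x. 1 / real (Suc n) \<le> infdist x (- D)}" for n
  have [measurable]: "A n \<in> sets borel" for n unfolding A_def by measurable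
  define f where "f n x = soft_clamp n (u x) * indicator (A n) x" for n x
  have [measurable]: "f n \<in> borel_measurable borel" for n unfolding f_def by measurable
  have f_bdd: "\<bar>f n x\<bar> \<le> real n" for n x
    using soft_clamp_bounded[of n "u x"] by (auto simp: f_def indicator_def)
  have f_near: "f n x = 0" if "infdist x (- D) < 1 / real (Suc n)" for n x
    using that by (auto simp: f_def A_def indicator_def simp del: of_nat_Suc)
  have f_off: "f n x = 0" if "x \<notin> D" for n x
    using that by (intro f_near) (simp add: infdist_zero)
  obtain c where c: "\<And>x. x \<in> D \<Longrightarrow> norm x \<le> c" using D_bounded by (auto simp: bounded_iff)
  have f_supp: "f n x = 0" if "c < norm x" for n x using c[of x] f_off[of x n] that by fastforce
  have "(\<lambda>n. sqn M (\<lambda>x. (u x - uE x) - f n x)) \<longlonglongrightarrow> 0"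
  proof (rule sqn_dominated)
    show "AE x in M. \<bar>u x - uE x - f n x\<bar> \<le> \<bar>2 * u x\<bar>" for n
    proof (rule AE_I2)
      fix x
      have "\<bar>u x - uE x\<bar> \<le> \<bar>u x\<bar>" by (auto simp: uE_def indicator_def)
      moreover have "\<bar>f n x\<bar> \<le> \<bar>u x\<bar>"
        using soft_clamp_contraction[of n "u x" 0] by (auto simp: f_def indicator_def)
      ultimately show "\<bar>u x - uE x - f n x\<bar> \<le> \<bar>2 * u x\<bar>" by (simp add: abs_mult)
    qed
    show "sqn M (\<lambda>x. 2 * u x) < \<infinity>"
      using uM by (subst sqn_cmult) (auto simp: borel_measurable_M ennreal_mult_less_top)
    have "(\<lambda>n. u x - uE x - f n x) \<longlonglongrightarrow> 0" for x
    proof (cases "x \<in> D")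
      case True
      obtain n0 :: nat where n0: "1 / infdist x (- D) < real n0" using reals_Archimedean2 by blast
      have eq: "u x - soft_clamp n (u x) = u x - uE x - f n x" if "n0 \<le> n" for n
      proof -
        have "1 / infdist x (- D) \<le> real (Suc n)" using n0 that by simp
        then have "1 / real (Suc n) \<le> infdist x (- D)" using infdist_complement_pos[OF True]
          by (simp add: field_simps)
        then show ?thesis using True by (simp add: f_def A_def uE_def)
      qed
      have "(\<lambda>n. u x - soft_clamp n (u x)) \<longlonglongrightarrow> u x - u x"
        by (intro tendsto_diff tendsto_const soft_clamp_tendsto)
      then have "(\<lambda>n. u x - uE x - f n x) \<longlonglongrightarrow> u x - u x"
        by (rule Lim_transform_eventually) (rule eventually_sequentiallyI[OF eq])
      then show ?thesis by simp
    next
      case False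
      then show ?thesis by (simp add: uE_def f_off)
    qed
    then show "AE x in M. (\<lambda>n. u x - uE x - f n x) \<longlonglongrightarrow> 0" by simp
  qed (auto simp: borel_measurable_M)
  then have "\<forall>\<^sub>F n in sequentially. sqn M (\<lambda>x. (u x - uE x) - f n x) < ennreal (e\<^sup>2 / 4)"
    using order_tendstoD(2)[of _ 0 _ "ennreal (e\<^sup>2 / 4)"] e by simp
  then obtain n where n: "sqn M (\<lambda>x. (u x - uE x) - f n x) < ennreal (e\<^sup>2 / 4)"
    by (auto simp: eventually_sequentially)
  obtain r0 where r0: "0 < r0" "\<And>r. 0 < r \<Longrightarrow> r \<le> r0 \<Longrightarrow>
      sqn lborel (\<lambda>x. f n x - mollify r (f n) x) < ennreal (e\<^sup>2 / 4)"
    using sqn_mollify_diff[of "f n" "real n" c "e\<^sup>2 / 4", OF _ f_bdd f_supp] e by auto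
  \<comment> \<open>\<open>f n\<close> vanishes at depth less than \<open>1 / real (Suc n)\<close>
    in \<open>D\<close>, so this scale keeps the mollified function zero off
    \<open>D\<close>.\<close>
  define r where "r = min r0 (1 / real (Suc n))"
  have r: "0 < r" using r0 by (simp add: r_def)
  define v where "v = mollify r (f n)"
  have [measurable]: "v \<in> borel_measurable borel" unfolding v_def by (rule mollify_measurable[OF r]) simp
  have v_off: "v x = 0" if x: "x \<notin> D" for x
    unfolding v_def
  proof (rule mollify_eq_0[OF r])
    fix z :: 'a assume z: "norm z < r"
    have "infdist (x + z) (- D) \<le> infdist x (- D) + dist (x + z) x" by (rule infdist_triangle)
    also have "\<dots> < 1 / real (Suc n)" using x z by (simp add: r_def infdist_zero dist_norm)
    finally show "f n (x + z) = 0" by (rule f_near)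
  qed
  have vF: "v \<in> F_dom j D"
  proof (rule F_I)
    have "sqn M v = sqn lborel v" by (rule sqn_M_0_off_D) (auto simp: v_off)
    also have "\<dots> \<le> sqn lborel (f n)" unfolding v_def by (rule sqn_mollify_le[OF r _ f_bdd]) simp
    also have "\<dots> \<le> ennreal ((real n)\<^sup>2) * emeasure lborel (cball (0::'a) c)"
      by (rule sqn_lborel_bounded_support[OF f_bdd f_supp])
    also have "\<dots> < \<infinity>"
      using emeasure_lborel_cball_finite[of "0::'a" c] by (simp add: ennreal_mult_less_top)
    finally show "sqn M v < \<infinity>" .
    obtain L where "\<And>x y. \<bar>v x - v y\<bar> \<le> L * dist x y"
      unfolding v_def using mollify_lipschitz[where f="f n" and c=c, OF r _ f_bdd f_supp] by auto
    then show "sqn J (incr v) < \<infinity>"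
      by (rule sqn_J_lipschitz_finite) (unfold v_def, rule mollify_bounded[OF r _ f_bdd], simp)
  qed simp
  have "sqn M (\<lambda>x. u x - (uE x + v x)) \<le> 2 * sqn M (\<lambda>x. (u x - uE x) - f n x) + 2 * sqn M (\<lambda>x. f n x - v x)"
  proof -
    have "(\<lambda>x. u x - (uE x + v x)) = (\<lambda>x. ((u x - uE x) - f n x) + (f n x - v x))" by auto
    then show ?thesis by (simp only:) (rule sqn_add, auto simp: borel_measurable_M)
  qed
  also have "sqn M (\<lambda>x. f n x - v x) = sqn lborel (\<lambda>x. f n x - v x)"
    by (rule sqn_M_0_off_D) (auto simp: v_off f_off)
  also have "2 * sqn M (\<lambda>x. (u x - uE x) - f n x) + 2 * sqn lborel (\<lambda>x. f n x - v x) <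
      2 * ennreal (e\<^sup>2 / 4) + 2 * ennreal (e\<^sup>2 / 4)"
    using n r0(2)[OF r] by (intro add_strict_mono ennreal_mult_strict_left_mono) (auto simp: r_def v_def)
  also have "\<dots> = ennreal (2 * (e\<^sup>2 / 4) + 2 * (e\<^sup>2 / 4))"
    by (simp flip: ennreal_plus ennreal_mult ennreal_numeral)
  finally have less: "sqn M (\<lambda>x. u x - (uE x + v x)) < ennreal (e\<^sup>2)" by simp
  have "L2_inner M (\<lambda>x. u x - (uE x + v x)) (\<lambda>x. u x - (uE x + v x)) =
      enn2real (sqn M (\<lambda>x. u x - (uE x + v x)))"
    by (rule L2_inner_self) (simp add: borel_measurable_M)
  also have "\<dots> < e\<^sup>2"
    using less by (cases "sqn M (\<lambda>x. u x - (uE x + v x))" rule: ennreal_cases) (auto simp: ennreal_less_iff)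
  finally have "sqrt (L2_inner M (\<lambda>x. u x - (uE x + v x)) (\<lambda>x. u x - (uE x + v x))) < sqrt (e\<^sup>2)"
    by (rule real_sqrt_less_mono)
  then show "\<exists>v\<in>F_dom j D. sqrt (L2_inner M (\<lambda>x. u x - v x) (\<lambda>x. u x - v x)) < e"
    using e by (intro bexI[of _ "\<lambda>x. uE x + v x"] F_add uE vF) simp
qed

text \<open>For nonempty \<open>D\<close> its zero set is exactly the boundary. Halving makes both
  the bound and the Lipschitz constant 1.\<close>

definition u0 :: "'a \<Rightarrow> real" where
  "u0 x = (min 1 (infdist x D) + min 1 (infdist x (- D))) / 2"

lemma u0_measurable[measurable]: "u0 \<in> borel_measurable borel"
  unfolding u0_def by measurable

lemma u0_bounds: "0 \<le> u0 x" "u0 x \<le> 1"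
  by (auto simp: u0_def infdist_nonneg)

text \<open>Outside \<open>D\<close>, \<open>u0 x\<close> is at most \<open>min 1 (dist x y)\<close>
  for every \<open>y\<close> in \<open>D\<close>. Its square thus compensates the singularity of the
  kernel in \<open>mu\<close>, and the norm is bounded through \<open>C1\<close> and the measure of
  \<open>D\<close>.\<close>

lemma u0_F: "u0 \<in> F_dom j D"
proof (rule F_I)
  have lip: "\<bar>min 1 (infdist x A) - min 1 (infdist y A)\<bar> \<le> dist x y" for x y :: 'a and A
  proof -
    have "\<bar>infdist x A - infdist y A\<bar> \<le> dist x y"
      using infdist_triangle[of x A y] infdist_triangle[of y A x] by (simp add: abs_le_iff dist_commute)
    moreover have "\<bar>min 1 a - min 1 b\<bar> \<le> \<bar>a - b\<bar>" for a b :: real by (auto simp: min_def abs_if)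
    ultimately show ?thesis by (meson order_trans)
  qed
  have "\<bar>u0 x - u0 y\<bar> \<le> 1 * dist x y" for x y
    using lip[of x D y] lip[of x "- D" y] unfolding u0_def abs_le_iff by (simp add: field_simps)
  then show "sqn J (incr u0) < \<infinity>"
    by (rule sqn_J_lipschitz_finite[where B=1]) (use u0_bounds in \<open>simp add: abs_le_iff\<close>)
  have pt: "rho x * ennreal ((u0 x)\<^sup>2) \<le> indicator D x +
      (\<integral>\<^sup>+y. indicator D y * (ennreal (kappa (x - y)) * ennreal ((min 1 (dist x y))\<^sup>2)) \<partial>lborel)" for x
  proof (cases "x \<in> D")
    case True
    have "(u0 x)\<^sup>2 \<le> 1" using u0_bounds[of x] by (intro power_le_one) auto
    then show ?thesis using True by (simp add: rho_D add_increasing2 ennreal_le_1)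
  next
    case False
    have "rho x * ennreal ((u0 x)\<^sup>2) =
        (\<integral>\<^sup>+y. (indicator D y * ennreal (kappa (x - y))) * ennreal ((u0 x)\<^sup>2) \<partial>lborel)"
      unfolding rho_notin_D[OF False] by (rule nn_integral_multc[symmetric]) simp
    also have "\<dots> \<le> (\<integral>\<^sup>+y. indicator D y * (ennreal (kappa (x - y)) * ennreal ((min 1 (dist x y))\<^sup>2)) \<partial>lborel)"
    proof (rule nn_integral_mono)
      fix y
      show "(indicator D y * ennreal (kappa (x - y))) * ennreal ((u0 x)\<^sup>2) \<le>
          indicator D y * (ennreal (kappa (x - y)) * ennreal ((min 1 (dist x y))\<^sup>2))"
      proof (cases "y \<in> D")
        case True
        have "u0 x = min 1 (infdist x D) / 2" using False by (simp add: u0_def infdist_zero)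
        also have "\<dots> \<le> min 1 (infdist x D)"
        proof -
          have "0 \<le> min 1 (infdist x D)" by (simp add: infdist_nonneg)
          then show ?thesis by linarith
        qed
        also have "\<dots> \<le> min 1 (dist x y)" by (intro min.mono infdist_le True) simp
        finally have "u0 x \<le> min 1 (dist x y)" .
        then have "(u0 x)\<^sup>2 \<le> (min 1 (dist x y))\<^sup>2" using u0_bounds by (intro power_mono) auto
        then show ?thesis using True by (auto intro!: mult_left_mono ennreal_leI)
      qed simp
    qed
    finally show ?thesis using False by simp
  qed
  have "sqn M u0 = (\<integral>\<^sup>+x. rho x * ennreal ((u0 x)\<^sup>2) \<partial>lborel)"
    unfolding sqn_def by (subst nn_integral_M) auto
  also have "\<dots> \<le> (\<integral>\<^sup>+x. indicator D x +
      (\<integral>\<^sup>+y. indicator D y * (ennreal (kappa (x - y)) * ennreal ((min 1 (dist x y))\<^sup>2)) \<partial>lborel) \<partial>lborel)"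
    by (intro nn_integral_mono pt)
  also have "\<dots> = emeasure lborel D + emeasure lborel D * C1"
    by (subst nn_integral_add) (auto simp: C1_D)
  also have "\<dots> < \<infinity>" using D_emeasure_finite C1_finite by (simp add: ennreal_mult_less_top)
  finally show "sqn M u0 < \<infinity>" .
qed simp

lemma u0_pos: "AE x in M. 0 < u0 x"
proof (cases "D = {}")
  case True then show ?thesis by (rule M_trivial_if_empty)
next
  case False
  show ?thesis using AE_M_frontier
  proof eventually_elim
    case (elim x)
    show ?case
    proof (cases "x \<in> D")
      case True
      then show ?thesis using infdist_complement_pos[OF True] infdist_nonneg[of x D]
        by (simp add: u0_def add_nonneg_pos)
    next
      case xD: False
      then have "x \<notin> closure D" using elim D_open by (auto simp: frontier_def interior_open)
      then have "0 < infdist x D"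
        using False in_closure_iff_infdist_zero[of D x] infdist_nonneg[of x D] by (simp add: less_le)
      then show ?thesis using infdist_nonneg[of x "- D"]
        by (simp add: u0_def add_pos_nonneg)
    qed
  qed
qed

sublocale approximable_jump_form M J "E_hat j D" "F_dom j D" R u0
  by unfold_locales (use sets_R AE_R approx J_min u0_F u0_pos in auto)

end

theorem theorem4p4:
  fixes j :: "real \<Rightarrow> real" and D :: "'a::euclidean_space set"
  assumes "DIM('a) \<ge> 2"
    and "\<And>r. r > 0 \<Longrightarrow> j r > 0"
    and "antimono_on {0<..} j"
    and "(\<integral>\<^sup>+x. ennreal (min 1 ((norm x)\<^sup>2) * j (norm x)) \<partial>(lborel :: 'a measure)) < \<infinity>"
    and "bounded D" and "open D"
    and "emeasure lborel (frontier D) = 0"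
  shows "dirichlet_form (m_measure j D) (E_hat j D) (F_dom j D) \<and>
    quasi_regular (m_measure j D) (E_hat j D) (F_dom j D)"
proof -
  interpret censored_kernel j D by unfold_locales (use assms in auto)
  show ?thesis
    unfolding dirichlet_form_def
    using bilinear symmetric nonneg densely_defined closed markovian quasi_regular by blast
qed

end
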